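(* Let $T$ be a scalar Calder\'on--Zygmund operator with Dini-continuous kernel $K$ (as defined in the context), let $\rho\in(2,\infty)$, and suppose that $\mathcal{V}_{\rho}(\mathcal T_{\ast})$ is bounded on $L^q(\mathbb R^d)$ for some $q\in(1,\infty)$. Let $\varepsilon\in(0,1)$. Then there is a constant $C>0$ (independent of $f$ and $Q_0$) such that for every cube $Q_0\subset\mathbb R^d$ and every $f\in L^\infty(\mathbb R^d)$ with $\operatorname{supp}(f)\subset Q_0$, there exists a family $\mathcal F\subset\mathcal D(Q_0)$ of pairwise disjoint dyadic subcubes of $Q_0$ such that (i) $\sum_{Q\in\mathcal F}|Q|\le\varepsilon|Q_0|$; (ii) for a.e. $x\in Q_0$, $$\Big|\mathcal{V}_{\rho}(\mathcal T_{\ast}f)(x)-\sum_{Q\in\mathcal F}\mathcal{V}_{\rho}(\mathcal T_{\ast}(f\chi_{3Q}))(x)\chi_Q(x)\Big|\le C\,|f|_{3Q_0};$$ (iii) for every collection $\overline{\mathcal F}$ of pairwise disjoint dyadic subcubes of $Q_0$ that covers $\mathcal F$, for a.e. $x\in Q_0$, $$\Big|\mathcal{V}_{\rho}(\mathcal T_{\ast}f)(x)-\sum_{Q\in\overline{\mathcal F}}\mathcal{V}_{\rho}(\mathcal T_{\ast}(f\chi_{3Q}))(x)\chi_Q(x)\Big|\le C\,|f|_{3Q_0}.$$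
   Context: A scalar Calder\'on--Zygmund operator $T$ is a linear operator bounded on $L^2(\mathbb R^d)$ associated with a kernel $K(x,y)$ defined for $x\neq y$ in $\mathbb R^d$ satisfying: $|K(x,y)|\le C|x-y|^{-d}$ for $x\ne y$; and for all $x,x',y$ with $|x-x'|\le|x-y|/2$, $|K(x,y)-K(x',y)|+|K(y,x)-K(y,x')|\le C\,\omega(|x-x'|/|x-y|)\,|x-y|^{-d}$, where $\omega:[0,\infty)\to[0,\infty)$ is increasing, subadditive, $\omega(0)=0$, and satisfies the Dini condition $\int_0^1\omega(t)\,dt/t<\infty$. For $\epsilon>0$, $T_\epsilon f(x):=\int_{|x-y|>\epsilon}K(x,y)f(y)\,dy$. For $\rho\in(2,\infty)$ the variation operator is $\mathcal{V}_{\rho}(\mathcal T_{\ast}f)(x):=\sup_{\epsilon_i\searrow0}\big(\sum_{i=1}^\infty|T_{\epsilon_{i+1}}f(x)-T_{\epsilon_i}f(x)|^\rho\big)^{1/\rho}$, the supremum over all sequences $\{\epsilon_i\}$ decreasing to $0$. Cubes have sides parallel to the axes; for $t>0$, $tQ$ is the cube concentric with $Q$ of side length $t\,\ell(Q)$. $|f|_{Q}:=\frac1{|Q|}\int_Q|f|$. $\mathcal D(Q_0)$ is the set of dyadic subcubes of $Q_0$ (obtained by repeatedly subdividing $Q_0$ and its descendants into $2^d$ congruent subcubes). A collection $\overline{\mathcal F}$ of cubes covers $\mathcal F$ if every $Q\in\mathcal F$ is contained in some $R\in\overline{\mathcal F}$. *)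

theory Defs
  imports "HOL-Analysis.Analysis"
begin

definition hcube :: "'a::euclidean_space \<Rightarrow> real \<Rightarrow> 'a set" where
  "hcube c r = {x. \<forall>i\<in>Basis. c \<bullet> i - r \<le> x \<bullet> i \<and> x \<bullet> i < c \<bullet> i + r}"

definition is_cube :: "'a::euclidean_space set \<Rightarrow> bool" where
  "is_cube Q \<longleftrightarrow> (\<exists>c r. 0 < r \<and> Q = hcube c r)"

definition dilate :: "real \<Rightarrow> 'a::euclidean_space set \<Rightarrow> 'a set" where
  "dilate t Q = (THE S. \<exists>c r. 0 < r \<and> Q = hcube c r \<and> S = hcube c (t * r))"

definition dyadic_sub :: "'a::euclidean_space \<Rightarrow> real \<Rightarrow> 'a set set" where
  "dyadic_sub c r =
     {hcube (c + (\<Sum>i\<in>Basis. (- r + (r / 2 ^ k) * (2 * real (n i) + 1)) *\<^sub>R i)) (r / 2 ^ k)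
      | (k::nat) (n::'a \<Rightarrow> nat). \<forall>i\<in>Basis. n i < 2 ^ k}"

definition memLp :: "real \<Rightarrow> ('a::euclidean_space \<Rightarrow> real) \<Rightarrow> bool" where
  "memLp p f \<longleftrightarrow> f \<in> borel_measurable lebesgue \<and> integrable lebesgue (\<lambda>x. \<bar>f x\<bar> powr p)"

definition Lp_norm :: "real \<Rightarrow> ('a::euclidean_space \<Rightarrow> real) \<Rightarrow> real" where
  "Lp_norm p f = (\<integral>x. \<bar>f x\<bar> powr p \<partial>lebesgue) powr (1 / p)"

definition memLinf :: "('a::euclidean_space \<Rightarrow> real) \<Rightarrow> bool" where
  "memLinf f \<longleftrightarrow> f \<in> borel_measurable lebesgue \<and> (\<exists>M. AE x in lebesgue. \<bar>f x\<bar> \<le> M)"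

definition avg :: "('a::euclidean_space \<Rightarrow> real) \<Rightarrow> 'a set \<Rightarrow> real" where
  "avg f Q = (LINT y:Q|lebesgue. \<bar>f y\<bar>) / measure lebesgue Q"

definition dini_modulus :: "(real \<Rightarrow> real) \<Rightarrow> bool" where
  "dini_modulus \<omega> \<longleftrightarrow>
     (\<forall>s\<ge>0. \<forall>t\<ge>s. \<omega> s \<le> \<omega> t) \<and>
     (\<forall>t\<ge>0. 0 \<le> \<omega> t) \<and>
     (\<forall>s\<ge>0. \<forall>t\<ge>0. \<omega> (s + t) \<le> \<omega> s + \<omega> t) \<and>
     \<omega> 0 = 0 \<and>
     set_integrable lborel {0<..1} (\<lambda>t. \<omega> t / t)"

definition CZ_kernel :: "('a::euclidean_space \<Rightarrow> 'a \<Rightarrow> real) \<Rightarrow> (real \<Rightarrow> real) \<Rightarrow> bool" where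
  "CZ_kernel K \<omega> \<longleftrightarrow>
     (\<forall>x. (\<lambda>y. K x y) \<in> borel_measurable lebesgue) \<and>
     (\<exists>C. (\<forall>x y. x \<noteq> y \<longrightarrow> \<bar>K x y\<bar> \<le> C / dist x y ^ DIM('a)) \<and>
          (\<forall>x x' y. x \<noteq> y \<and> dist x x' \<le> dist x y / 2 \<longrightarrow>
              \<bar>K x y - K x' y\<bar> + \<bar>K y x - K y x'\<bar>
                \<le> C * \<omega> (dist x x' / dist x y) / dist x y ^ DIM('a)))"

definition CZO :: "(('a::euclidean_space \<Rightarrow> real) \<Rightarrow> ('a \<Rightarrow> real)) \<Rightarrow>
                   ('a \<Rightarrow> 'a \<Rightarrow> real) \<Rightarrow> (real \<Rightarrow> real) \<Rightarrow> bool" where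
  "CZO T K \<omega> \<longleftrightarrow>
     dini_modulus \<omega> \<and> CZ_kernel K \<omega> \<and>
     (\<forall>f g a b. memLp 2 f \<longrightarrow> memLp 2 g \<longrightarrow>
        (AE x in lebesgue. T (\<lambda>y. a * f y + b * g y) x = a * T f x + b * T g x)) \<and>
     (\<exists>B. \<forall>f. memLp 2 f \<longrightarrow> memLp 2 (T f) \<and> Lp_norm 2 (T f) \<le> B * Lp_norm 2 f) \<and>
     (\<forall>f S. memLp 2 f \<longrightarrow> compact S \<longrightarrow> (\<forall>y. y \<notin> S \<longrightarrow> f y = 0) \<longrightarrow>
        (AE x in lebesgue. x \<notin> S \<longrightarrow> T f x = (LINT y|lebesgue. K x y * f y)))"

definition trunc_op :: "('a::euclidean_space \<Rightarrow> 'a \<Rightarrow> real) \<Rightarrow> real \<Rightarrow> ('a \<Rightarrow> real) \<Rightarrow> 'a \<Rightarrow> real" where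
  "trunc_op K e f x = (LINT y:{y. e < dist x y}|lebesgue. K x y * f y)"

definition null_decr_seqs :: "(nat \<Rightarrow> real) set" where
  "null_decr_seqs = {e. (\<forall>i. 0 < e i) \<and> decseq e \<and> e \<longlonglongrightarrow> 0}"

text \<open>V_rho(T_* f)(x), valued in the extended reals (may be infinite).
  The supremum of the rho-sums is taken via partial sums, which is the same.\<close>
definition var_op :: "('a::euclidean_space \<Rightarrow> 'a \<Rightarrow> real) \<Rightarrow> real \<Rightarrow> ('a \<Rightarrow> real) \<Rightarrow> 'a \<Rightarrow> ereal" where
  "var_op K \<rho> f x =
     (SUP e\<in>null_decr_seqs. SUP N::nat.
        ereal ((\<Sum>i<N. \<bar>trunc_op K (e (Suc i)) f x - trunc_op K (e i) f x\<bar> powr \<rho>) powr (1 / \<rho>)))"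

definition var_bounded_Lq :: "('a::euclidean_space \<Rightarrow> 'a \<Rightarrow> real) \<Rightarrow> real \<Rightarrow> real \<Rightarrow> bool" where
  "var_bounded_Lq K \<rho> q \<longleftrightarrow>
     (\<exists>B. \<forall>f. memLp q f \<longrightarrow>
        (AE x in lebesgue. var_op K \<rho> f x \<noteq> \<infinity>) \<and>
        memLp q (\<lambda>x. real_of_ereal (var_op K \<rho> f x)) \<and>
        Lp_norm q (\<lambda>x. real_of_ereal (var_op K \<rho> f x)) \<le> B * Lp_norm q f)"

end

theory Submission
  imports Defs
begin

text \<open>Fix \<open>f\<close>, take the dyadic Calderon--Zygmund decomposition \<open>f = g + b\<close> at a height \<open>\<tau>\<close> comparable to the
  average of \<open>\<bar>f\<bar>\<close>, and let \<open>E\<close> be the set where \<open>V g\<close> is large, or which lies near a bad cube, or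
  where a potential \<open>\<Phi>\<close> of \<open>b\<close>, with the Dini modulus as its kernel, is large. \<open>E\<close> is small
  by the \<open>L\<^sup>q\<close> bound and Tonelli. The family consists of the stopping cubes of \<open>E\<close>.

  If at least half of a cube \<open>R\<close> lies outside \<open>E\<close>, then every bad cube is contained in \<open>3R\<close> or disjoint
  from it, and \<open>R\<close> has a point at which \<open>V g\<close>, \<open>V (g \<chi>\<^bsub>3R\<^esub>)\<close> and \<open>\<Phi>\<close> are all at most a multiple of \<open>\<tau>\<close>.
  The bounds for the bad part and for \<open>g \<chi>\<close> off \<open>3R\<close> then transfer from this point to all of \<open>R\<close>; a
  maximal function or a separate weak (1,1) estimate is not needed. The truncations cut bad cubes
  (and, when two centres are compared, shift the annuli); these terms are square summable, which is
  where \<open>\<rho> \<ge> 2\<close> enters.\<close>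

subsection \<open>Finite sequence norms\<close>

text \<open>The variation is a supremum over uncountably many sequences, so every bound must hold at
  a given point for all of them at once. The potential achieves this because it does not see the
  sequence: the smooth parts of the increments add up to at most a multiple of it, and the crossing
  parts have an l2 norm bounded by the geometric mean of the potential and the height \<tau>. Where
  the potential is at most a multiple of \<tau>, both are linear in \<tau>. Arbitrary covering
  families cost nothing extra. The stopping threshold for the density of \<open>E\<close> is
  2^-(d+1), so that a stopping cube, whose parent is below the threshold, is still at most half
  filled by \<open>E\<close>. A cube of a disjoint covering family either lies in no stopping cube
  or is itself one, so at least half of it is free in both cases. The good point is chosen
  separately for each \<open>R\<close>. Hence the L^q bound for g restricted to 3R only has to beat
  a fixed fraction of |R|, which it does as |3R| = 3^d |R|, and the exceptional sets belonging to
  different cubes never have to be united.\<close>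

definition lnorm :: "real \<Rightarrow> nat \<Rightarrow> (nat \<Rightarrow> real) \<Rightarrow> real" where
  "lnorm p N a = (\<Sum>i<N. \<bar>a i\<bar> powr p) powr (1 / p)"

lemma lnorm_nonneg: "0 \<le> lnorm p N a"
  by (simp add: lnorm_def)

lemma lnorm_mono:
  assumes "0 \<le> p" "\<And>i. i < N \<Longrightarrow> \<bar>a i\<bar> \<le> \<bar>b i\<bar>"
  shows "lnorm p N a \<le> lnorm p N b"
  unfolding lnorm_def using assms
  by (intro powr_mono2 sum_mono) (auto intro!: powr_mono2 sum_nonneg)

text \<open>Convexity of the power is taken from the open half line; a zero argument is settled by u
  powr p \<le> u for 0 \<le> u \<le> 1.\<close>

lemma powr_jensen:
  fixes a b s t p :: real
  assumes "1 \<le> p" "0 \<le> a" "0 \<le> b" "0 \<le> s" "0 \<le> t" "s + t = 1"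
  shows "(s * a + t * b) powr p \<le> s * a powr p + t * b powr p"
proof -
  have one: "(u * v) powr p \<le> u * v powr p" if "0 \<le> u" "u \<le> 1" "0 \<le> v" for u v :: real
  proof (cases "u = 0")
    case False
    then have "u powr p \<le> u powr 1"
      using that assms(1) by (intro powr_mono') auto
    then show ?thesis
      using that by (simp add: powr_mult mult_right_mono)
  qed auto
  show ?thesis
  proof (cases "a = 0 \<or> b = 0")
    case True
    then show ?thesis
      using one[of s a] one[of t b] assms by auto
  next
    case False
    then have ab: "a \<in> {0<..}" "b \<in> {0<..}" using assms by auto
    have "s = 1 - t" "t \<le> 1" using assms by auto
    with convex_onD[OF powr_convex[OF assms(1)] assms(5) _ ab]
    show ?thesis by simp
  qed
qed

lemma lnorm_eq_0: "lnorm p N a = 0 \<Longrightarrow> i < N \<Longrightarrow> a i = 0"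
  unfolding lnorm_def by (auto simp: sum_nonneg_eq_0_iff)

lemma lnorm_powr: "0 < p \<Longrightarrow> lnorm p N a powr p = (\<Sum>i<N. \<bar>a i\<bar> powr p)"
  unfolding lnorm_def by (simp add: powr_powr sum_nonneg)

lemma lnorm_le_iff:
  assumes "0 < p" "0 \<le> B"
  shows "lnorm p N a \<le> B \<longleftrightarrow> (\<Sum>i<N. \<bar>a i\<bar> powr p) \<le> B powr p"
  using assms lnorm_powr[OF assms(1), of N a] lnorm_nonneg[of p N a]
  by (metis linorder_not_le powr_less_mono2 powr_mono2 less_eq_real_def)

text \<open>Minkowski's inequality by normalisation: \<bar>a i\<bar> + \<bar>b i\<bar> is
  \<open>A + B\<close> times the convex combination of \<bar>a i\<bar> / A and \<bar>b i\<bar> / B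
  with weights \<open>A / (A + B)\<close> and \<open>B / (A + B)\<close>; Jensen's inequality is
  then summed over \<open>i\<close>.\<close>

lemma lnorm_triangle:
  assumes p: "1 \<le> p"
  shows "lnorm p N (\<lambda>i. a i + b i) \<le> lnorm p N a + lnorm p N b"
proof -
  define A where "A = lnorm p N a"
  define B where "B = lnorm p N b"
  have A0: "0 \<le> A" and B0: "0 \<le> B" by (simp_all add: A_def B_def lnorm_nonneg)
  consider "A = 0" | "B = 0" | "A > 0" "B > 0" using A0 B0 by fastforce
  then have "lnorm p N (\<lambda>i. a i + b i) \<le> A + B"
  proof cases
    case 1
    then have "lnorm p N (\<lambda>i. a i + b i) \<le> lnorm p N b"
      using p by (intro lnorm_mono) (auto simp: A_def dest: lnorm_eq_0)
    then show ?thesis using A0 B_def by simp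
  next
    case 2
    then have "lnorm p N (\<lambda>i. a i + b i) \<le> lnorm p N a"
      using p by (intro lnorm_mono) (auto simp: B_def dest: lnorm_eq_0)
    then show ?thesis using B0 A_def by simp
  next
    case 3
    have pt: "\<bar>a i + b i\<bar> powr p \<le> (A + B) powr p * (A / (A + B) * (\<bar>a i\<bar> powr p / A powr p)
        + B / (A + B) * (\<bar>b i\<bar> powr p / B powr p))" for i
    proof -
      have "\<bar>a i + b i\<bar> \<le> (A + B) * (A / (A + B) * (\<bar>a i\<bar> / A) + B / (A + B) * (\<bar>b i\<bar> / B))"
      proof -
        have "(A + B) * (A / (A + B) * (\<bar>a i\<bar> / A) + B / (A + B) * (\<bar>b i\<bar> / B))
            = (A + B) * (\<bar>a i\<bar> / (A + B) + \<bar>b i\<bar> / (A + B))"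
          using 3 by simp
        also have "\<dots> = \<bar>a i\<bar> + \<bar>b i\<bar>"
          using 3 nonzero_mult_div_cancel_left[of "A + B"]
          by (simp add: add_divide_distrib[symmetric])
        finally show ?thesis by (simp add: abs_triangle_ineq)
      qed
      then have "\<bar>a i + b i\<bar> powr p \<le> ((A + B) * (A / (A + B) * (\<bar>a i\<bar> / A) + B / (A + B) * (\<bar>b i\<bar> / B))) powr p"
        using p by (intro powr_mono2) auto
      also have "\<dots> = (A + B) powr p * (A / (A + B) * (\<bar>a i\<bar> / A) + B / (A + B) * (\<bar>b i\<bar> / B)) powr p"
        using 3 by (simp add: powr_mult)
      also have "\<dots> \<le> (A + B) powr p * (A / (A + B) * (\<bar>a i\<bar> / A) powr p + B / (A + B) * (\<bar>b i\<bar> / B) powr p)"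
        using 3 p by (intro mult_left_mono powr_jensen) (auto simp: add_divide_distrib[symmetric])
      finally show ?thesis using 3 by (simp add: powr_divide)
    qed
    have "(\<Sum>i<N. \<bar>a i + b i\<bar> powr p) \<le> (\<Sum>i<N. (A + B) powr p * (A / (A + B) * (\<bar>a i\<bar> powr p / A powr p)
        + B / (A + B) * (\<bar>b i\<bar> powr p / B powr p)))"
      by (intro sum_mono pt)
    also have "\<dots> = (A + B) powr p * (A / (A + B) * ((\<Sum>i<N. \<bar>a i\<bar> powr p) / A powr p)
        + B / (A + B) * ((\<Sum>i<N. \<bar>b i\<bar> powr p) / B powr p))"
      by (simp add: sum_distrib_left sum.distrib sum_divide_distrib distrib_left)
    also have "\<dots> = (A + B) powr p * (A / (A + B) + B / (A + B))"
      using 3 p by (simp add: lnorm_powr[symmetric] A_def[symmetric] B_def[symmetric])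
    also have "\<dots> = (A + B) powr p"
      using 3 by (simp add: add_divide_distrib[symmetric])
    finally show ?thesis
      using p A0 B0 by (subst lnorm_le_iff) auto
  qed
  then show ?thesis by (simp add: A_def B_def)
qed

text \<open>No single entry exceeds the norm \<open>A\<close>, so the surplus power r - p of each
  entry can be replaced by \<open>A powr (r - p)\<close>.\<close>

lemma lnorm_antimono:
  assumes p: "0 < p" "p \<le> r"
  shows "lnorm r N a \<le> lnorm p N a"
proof -
  define A where "A = lnorm p N a"
  have A0: "0 \<le> A" by (simp add: A_def lnorm_nonneg)
  show ?thesis
  proof (cases "A = 0")
    case True
    then have "lnorm r N a \<le> lnorm p N a"
      by (subst lnorm_le_iff) (use p lnorm_eq_0[of p N a] A_def in auto)
    then show ?thesis .
  next
    case False
    then have A: "A > 0" using A0 by simp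
    have le: "\<bar>a i\<bar> \<le> A" if "i < N" for i
    proof -
      have "\<bar>a i\<bar> powr p \<le> (\<Sum>i<N. \<bar>a i\<bar> powr p)"
        using that by (intro member_le_sum) auto
      then have "\<bar>a i\<bar> powr p \<le> A powr p" using p by (simp add: A_def lnorm_powr)
      then show ?thesis using A p by (meson powr_less_mono2 linorder_not_le less_eq_real_def)
    qed
    have "(\<Sum>i<N. \<bar>a i\<bar> powr r) \<le> (\<Sum>i<N. A powr (r - p) * \<bar>a i\<bar> powr p)"
    proof (intro sum_mono)
      fix i assume "i \<in> {..<N}"
      then have "\<bar>a i\<bar> powr (r - p) \<le> A powr (r - p)"
        using p le by (intro powr_mono2) auto
      then have "\<bar>a i\<bar> powr (r - p) * \<bar>a i\<bar> powr p \<le> A powr (r - p) * \<bar>a i\<bar> powr p"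
        by (intro mult_right_mono) auto
      then show "\<bar>a i\<bar> powr r \<le> A powr (r - p) * \<bar>a i\<bar> powr p"
        by (simp add: powr_add[symmetric])
    qed
    also have "\<dots> = A powr (r - p) * A powr p"
      using p by (simp add: sum_distrib_left[symmetric] A_def lnorm_powr)
    also have "\<dots> = A powr r" using A by (simp add: powr_add[symmetric])
    finally show ?thesis using p A unfolding A_def[symmetric] by (subst lnorm_le_iff) auto
  qed
qed

lemma lnorm_le_sum:
  assumes "1 \<le> p" shows "lnorm p N a \<le> (\<Sum>i<N. \<bar>a i\<bar>)"
  using lnorm_antimono[of 1 p N a] assms by (simp add: lnorm_def sum_nonneg)

lemma lnorm_le_l2:
  assumes "2 \<le> p" "0 \<le> B" "(\<Sum>i<N. (a i)\<^sup>2) \<le> B\<^sup>2"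
  shows "lnorm p N a \<le> B"
proof -
  have "lnorm p N a \<le> lnorm 2 N a" using assms by (intro lnorm_antimono) auto
  also have "\<dots> \<le> B"
    using assms by (subst lnorm_le_iff) auto
  finally show ?thesis .
qed

subsection \<open>The variation operator\<close>

definition incr :: "('a::euclidean_space \<Rightarrow> 'a \<Rightarrow> real) \<Rightarrow> (nat \<Rightarrow> real) \<Rightarrow> ('a \<Rightarrow> real) \<Rightarrow> 'a \<Rightarrow> nat \<Rightarrow> real" where
  "incr K e f x i = trunc_op K (e (Suc i)) f x - trunc_op K (e i) f x"

lemma var_op_altdef:
  "var_op K \<rho> f x = (SUP e\<in>null_decr_seqs. SUP N::nat. ereal (lnorm \<rho> N (incr K e f x)))"
  by (simp add: var_op_def lnorm_def incr_def)

lemma lnorm_le_var_op: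
  assumes "e \<in> null_decr_seqs"
  shows "ereal (lnorm \<rho> N (incr K e f x)) \<le> var_op K \<rho> f x"
  unfolding var_op_altdef using assms by (meson SUP_upper2 UNIV_I order_refl)

lemma var_op_leI:
  assumes "\<And>e N. e \<in> null_decr_seqs \<Longrightarrow> ereal (lnorm \<rho> N (incr K e f x)) \<le> B"
  shows "var_op K \<rho> f x \<le> B"
  unfolding var_op_altdef using assms by (auto intro!: SUP_least)

lemma null_decr_seqs_nonempty: "(\<lambda>n. 1 / real (Suc n)) \<in> null_decr_seqs"
  unfolding null_decr_seqs_def
  using LIMSEQ_inverse_real_of_nat by (auto simp: decseq_def frac_le inverse_eq_divide)

lemma var_op_nonneg: "0 \<le> var_op K \<rho> f x"
  using lnorm_le_var_op[OF null_decr_seqs_nonempty, of \<rho> 0 K f x] lnorm_nonneg[of \<rho> 0]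
  by (metis ereal_less_eq(5) order_trans)

lemma trunc_op_cong_AE:
  assumes "AE y in lebesgue. f y = g y" "f \<in> borel_measurable lebesgue" "g \<in> borel_measurable lebesgue"
    "K x \<in> borel_measurable lebesgue"
  shows "trunc_op K e f x = trunc_op K e g x"
proof -
  have "open {y. e < dist x y}"
    by (intro open_Collect_less continuous_intros)
  then have [measurable]: "{y. e < dist x y} \<in> sets lebesgue"
    by (simp add: borel_open)
  note [measurable] = assms(2-4)
  show ?thesis
    unfolding trunc_op_def set_lebesgue_integral_def
    by (rule integral_cong_AE) (use assms(1) in \<open>measurable, auto\<close>)
qed

text \<open>Truncations are integrals, so the equality holds at every \<open>x\<close>. This allows
  \<open>f\<close> to be altered on a null set without creating exceptional points.\<close>

lemma var_op_cong_AE: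
  assumes "AE y in lebesgue. f y = g y" "f \<in> borel_measurable lebesgue" "g \<in> borel_measurable lebesgue"
    "K x \<in> borel_measurable lebesgue"
  shows "var_op K \<rho> f x = var_op K \<rho> g x"
  using trunc_op_cong_AE[of f g K x] assms by (simp add: var_op_def)

lemma var_op_zero: "var_op K \<rho> (\<lambda>_. 0) x = 0"
  by (intro antisym var_op_nonneg) (auto intro!: var_op_leI simp: lnorm_def incr_def trunc_op_def zero_ereal_def)

subsection \<open>Cubes\<close>

lemma hcube_sandwich:
  "box (c - r *\<^sub>R One) (c + r *\<^sub>R One) \<subseteq> hcube c r"
  "hcube c r \<subseteq> cbox (c - r *\<^sub>R One) (c + r *\<^sub>R One)"
  by (auto simp: hcube_def mem_box inner_diff_left inner_add_left less_imp_le)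

lemma hcube_borel [measurable]: "hcube (c::'a::euclidean_space) r \<in> sets borel"
proof -
  have "hcube c r = (\<Inter>i\<in>Basis. {x. c \<bullet> i - r \<le> x \<bullet> i} \<inter> {x. x \<bullet> i < c \<bullet> i + r})"
    by (auto simp: hcube_def)
  also have "\<dots> \<in> sets borel"
    by (intro sets.finite_INT) (auto intro!: sets.Int)
  finally show ?thesis .
qed

lemma hcube_lebesgue [measurable]: "hcube c r \<in> sets lebesgue"
  by (simp add: hcube_borel)

lemma emeasure_hcube:
  assumes "0 \<le> r"
  shows "emeasure lebesgue (hcube (c::'a::euclidean_space) r) = ennreal ((2 * r) ^ DIM('a))"
proof -
  let ?a = "c - r *\<^sub>R One" and ?b = "c + r *\<^sub>R One"
  have e: "(\<Prod>i\<in>Basis. (?b - ?a) \<bullet> i) = (2 * r) ^ DIM('a)"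
    by (simp add: inner_diff_left inner_add_left)
  have le: "?a \<bullet> i \<le> ?b \<bullet> i" if "i \<in> Basis" for i
    using assms that by (simp add: inner_diff_left inner_add_left)
  have "emeasure lebesgue (box ?a ?b) \<le> emeasure lebesgue (hcube c r)"
    "emeasure lebesgue (hcube c r) \<le> emeasure lebesgue (cbox ?a ?b)"
    by (intro emeasure_mono hcube_sandwich; simp)+
  moreover have "emeasure lebesgue (box ?a ?b) = ennreal ((2 * r) ^ DIM('a))"
    using le e by (simp add: emeasure_lborel_box_eq)
  moreover have "emeasure lebesgue (cbox ?a ?b) = ennreal ((2 * r) ^ DIM('a))"
    using le e by (simp add: emeasure_lborel_cbox_eq)
  ultimately show ?thesis by simp
qed

text \<open>The volume determines the radius, and the corner \<open>c - r *\<^sub>R One\<close>,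
  which belongs to the half-open cube, determines the centre. The definite descriptions behind
  dilates, radii and centres of cubes depend on this.\<close>

lemma hcube_inject:
  fixes c c' :: "'a::euclidean_space"
  assumes "0 < r" "0 < r'" "hcube c r = hcube c' r'"
  shows "c = c'" "r = r'"
proof -
  have "(2 * r) ^ DIM('a) = (2 * r') ^ DIM('a)"
    using emeasure_hcube[of r c] emeasure_hcube[of r' c'] assms by simp
  then have "2 * r = 2 * r'"
    using assms power_eq_imp_eq_base[of "2*r" "DIM('a)" "2*r'"] by simp
  then show r: "r = r'" by simp
  have corner: "c' \<bullet> i \<le> c \<bullet> i" if "hcube c r = hcube c' r" "i \<in> Basis" for c c' i
  proof -
    have "c - r *\<^sub>R One \<in> hcube c r"
      using assms by (auto simp: hcube_def inner_diff_left)
    then have "c - r *\<^sub>R One \<in> hcube c' r" using that by simp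
    then show ?thesis using that by (auto simp: hcube_def inner_diff_left)
  qed
  show "c = c'"
    using corner[of c c'] corner[of c' c] assms(3) r
    by (intro euclidean_eqI[where 'a='a] order.antisym) auto
qed

lemma dilate_hcube:
  assumes "0 < r"
  shows "dilate t (hcube c r) = hcube c (t * r)"
  unfolding dilate_def using assms by (intro the_equality) (auto dest: hcube_inject)

lemma hcube_subset: "r \<le> r' \<Longrightarrow> hcube c r \<subseteq> hcube c r'"
  by (force simp: hcube_def)

lemma dist_hcube_le:
  fixes x y :: "'a::euclidean_space"
  assumes "x \<in> hcube c r" "y \<in> hcube c r"
  shows "dist x y \<le> 2 * real DIM('a) * r"
proof -
  have "norm (x - y) \<le> (\<Sum>i\<in>Basis. \<bar>(x - y) \<bullet> i\<bar>)" by (rule norm_le_l1)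
  also have "\<dots> \<le> (\<Sum>i\<in>(Basis::'a set). 2 * r)"
    using assms by (intro sum_mono) (force simp: hcube_def inner_diff_left abs_le_iff)
  finally show ?thesis by (simp add: dist_norm mult_ac)
qed

lemma dist_hcube_ge:
  fixes x y :: "'a::euclidean_space"
  assumes "x \<in> hcube c r" "y \<notin> hcube c r'"
  shows "r' - r \<le> dist x y"
proof -
  obtain i where i: "i \<in> Basis" "\<not> (c \<bullet> i - r' \<le> y \<bullet> i \<and> y \<bullet> i < c \<bullet> i + r')"
    using assms(2) by (auto simp: hcube_def)
  have x: "c \<bullet> i - r \<le> x \<bullet> i" "x \<bullet> i < c \<bullet> i + r"
    using assms(1) i(1) by (auto simp: hcube_def)
  have "r' - r \<le> \<bar>(x - y) \<bullet> i\<bar>"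
    using i(2) x by (auto simp: inner_diff_left)
  also have "\<dots> \<le> dist x y" using i(1) by (simp add: dist_norm Basis_le_norm)
  finally show ?thesis .
qed

subsection \<open>Dyadic subcubes\<close>

definition dindex :: "'a::euclidean_space \<Rightarrow> real \<Rightarrow> nat \<Rightarrow> 'a \<Rightarrow> 'a \<Rightarrow> int" where
  "dindex c r k x i = \<lfloor>2 ^ k * ((x \<bullet> i - c \<bullet> i + r) / (2 * r))\<rfloor>"

text \<open>Encoding cells as classes of equal integer indices turns nesting, disjointness and
  triples into arithmetic of integers. The indices exist on the whole space, so the grid also
  subdivides triples that stick out of the initial cube.\<close>

definition dcell :: "'a::euclidean_space \<Rightarrow> real \<Rightarrow> nat \<Rightarrow> 'a \<Rightarrow> 'a set" where
  "dcell c r k x = {y. \<forall>i\<in>Basis. dindex c r k y i = dindex c r k x i}"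

definition dcenter :: "'a::euclidean_space \<Rightarrow> real \<Rightarrow> nat \<Rightarrow> ('a \<Rightarrow> int) \<Rightarrow> 'a" where
  "dcenter c r k n = c + (\<Sum>i\<in>Basis. (- r + (r / 2 ^ k) * (2 * real_of_int (n i) + 1)) *\<^sub>R i)"

lemma dcenter_inner: "i \<in> Basis \<Longrightarrow> dcenter c r k n \<bullet> i = c \<bullet> i + (- r + (r / 2 ^ k) * (2 * real_of_int (n i) + 1))"
  by (simp add: dcenter_def inner_add_left inner_sum_left inner_Basis if_distrib cong: if_cong)

text \<open>Passing to an ancestor deletes the last \<open>k' - k\<close> binary digits of the
  index.\<close>

lemma dindex_div:
  assumes "k \<le> k'"
  shows "dindex c r k x i = dindex c r k' x i div 2 ^ (k' - k)"
proof -
  let ?t = "(x \<bullet> i - c \<bullet> i + r) / (2 * r)"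
  have "(2::real) ^ k' = 2 ^ k * 2 ^ (k' - k)"
    using assms by (simp add: power_add[symmetric])
  then have "2 ^ k * ?t = (2 ^ k' * ?t) / real_of_int (2 ^ (k' - k))"
    by simp
  then show ?thesis
    unfolding dindex_def by (metis floor_divide_real_eq_div zero_le_numeral zero_le_power)
qed

text \<open>One computation for two uses: \<open>m = 0\<close> gives a cell and \<open>m = 1\<close>
  its triple. The half-open sides of the cube match the rounding of the floor function
  exactly.\<close>

lemma dcell_hcube_gen:
  fixes m :: int
  assumes "0 < r"
  shows "hcube (dcenter c r k n) ((2 * real_of_int m + 1) * (r / 2 ^ k)) = {y. \<forall>i\<in>Basis. \<bar>dindex c r k y i - n i\<bar> \<le> m}"
proof -
  have "dcenter c r k n \<bullet> i - (2 * real_of_int m + 1) * (r / 2 ^ k) \<le> y \<bullet> i \<and> y \<bullet> i < dcenter c r k n \<bullet> i + (2 * real_of_int m + 1) * (r / 2 ^ k)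
     \<longleftrightarrow> \<bar>dindex c r k y i - n i\<bar> \<le> m" if i: "i \<in> Basis" for i y
  proof -
    let ?t = "(y \<bullet> i - c \<bullet> i + r) / (2 * r)"
    have y: "y \<bullet> i = c \<bullet> i - r + 2 * r * ?t" using assms by simp
    have q: "r / 2 ^ k > 0" using assms by simp
    have "dcenter c r k n \<bullet> i - (2 * real_of_int m + 1) * (r / 2 ^ k) \<le> y \<bullet> i \<longleftrightarrow>
        (r / 2 ^ k) * (2 * (real_of_int (n i) - real_of_int m)) \<le> (r / 2 ^ k) * (2 * (2 ^ k * ?t))"
      unfolding dcenter_inner[OF i] by (subst y) (simp add: algebra_simps)
    also have "\<dots> \<longleftrightarrow> n i - m \<le> dindex c r k y i"
      unfolding mult_le_cancel_left_pos[OF q] dindex_def le_floor_iff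
      by (simp only: mult_le_cancel_left_pos[OF zero_less_numeral] of_int_diff)
    finally have 1: "dcenter c r k n \<bullet> i - (2 * real_of_int m + 1) * (r / 2 ^ k) \<le> y \<bullet> i \<longleftrightarrow> n i - m \<le> dindex c r k y i" .
    have "y \<bullet> i < dcenter c r k n \<bullet> i + (2 * real_of_int m + 1) * (r / 2 ^ k) \<longleftrightarrow>
        (r / 2 ^ k) * (2 * (2 ^ k * ?t)) < (r / 2 ^ k) * (2 * (real_of_int (n i) + real_of_int m + 1))"
      unfolding dcenter_inner[OF i] by (subst y) (simp add: algebra_simps)
    also have "\<dots> \<longleftrightarrow> dindex c r k y i < n i + m + 1"
      unfolding mult_less_cancel_left_pos[OF q] dindex_def floor_less_iff
      by (simp only: mult_less_cancel_left_pos[OF zero_less_numeral] of_int_add of_int_1)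
    finally have 2: "y \<bullet> i < dcenter c r k n \<bullet> i + (2 * real_of_int m + 1) * (r / 2 ^ k) \<longleftrightarrow> dindex c r k y i < n i + m + 1" .
    show ?thesis using 1 2 by auto
  qed
  then show ?thesis by (simp add: hcube_def)
qed

lemma dcell_hcube:
  assumes "0 < r"
  shows "dcell c r k x = hcube (dcenter c r k (dindex c r k x)) (r / 2 ^ k)"
  using dcell_hcube_gen[OF assms, of c k "dindex c r k x" 0] by (simp add: dcell_def)

lemma dcell_triple:
  assumes "0 < r"
  shows "dilate 3 (dcell c r k x) = {y. \<forall>i\<in>Basis. \<bar>dindex c r k y i - dindex c r k x i\<bar> \<le> 1}"
  using dcell_hcube_gen[OF assms, of c k "dindex c r k x" 1] dcell_hcube[OF assms, of c k x] assms
  by (simp add: dilate_hcube)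

lemma hcube_dindex:
  assumes "0 < r"
  shows "x \<in> hcube c r \<longleftrightarrow> (\<forall>i\<in>Basis. dindex c r 0 x i = 0)"
proof -
  have "dcenter c r 0 (\<lambda>_. 0) = c"
    by (rule euclidean_eqI) (simp add: dcenter_inner)
  then show ?thesis
    using dcell_hcube_gen[OF assms, of c 0 "\<lambda>_. 0" 0] by auto
qed

lemma dcell_0: "0 < r \<Longrightarrow> x \<in> hcube c r \<Longrightarrow> dcell c r 0 x = hcube c r"
  by (auto simp: dcell_def hcube_dindex)

lemma dindex_bounds:
  assumes "0 < r" "x \<in> hcube c r" "i \<in> Basis"
  shows "0 \<le> dindex c r k x i" "dindex c r k x i < 2 ^ k"
proof -
  have "dindex c r k x i div 2 ^ k = 0"
    using dindex_div[of 0 k c r x i] assms by (simp add: hcube_dindex)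
  then show "0 \<le> dindex c r k x i" "dindex c r k x i < 2 ^ k"
    using div_mult_mod_eq[of "dindex c r k x i" "2 ^ k"] pos_mod_sign[of "2 ^ k" "dindex c r k x i"]
      pos_mod_bound[of "2 ^ k" "dindex c r k x i"] by simp_all
qed

lemma dcell_self [simp]: "x \<in> dcell c r k x"
  by (simp add: dcell_def)

lemma dcell_eq: "y \<in> dcell c r k x \<Longrightarrow> dcell c r k y = dcell c r k x"
  by (auto simp: dcell_def)

lemma dcell_mono:
  assumes "k \<le> k'" shows "dcell c r k' x \<subseteq> dcell c r k x"
  by (auto simp: dcell_def dindex_div[OF assms])

lemma dcell_subset_hcube:
  assumes "0 < r" "x \<in> hcube c r" shows "dcell c r k x \<subseteq> hcube c r"
  using dcell_mono[of 0 k c r x] dcell_0[OF assms] by simp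

text \<open>Replaces explicit centres by cells of points, so that a dyadic cube can be named after
  any point it contains.\<close>

lemma dyadic_sub_eq:
  assumes r: "0 < r"
  shows "dyadic_sub c r = {dcell c r k x | k x. x \<in> hcube c r}"
proof (intro equalityI subsetI)
  fix Q assume "Q \<in> dyadic_sub c r"
  then obtain k and n :: "'a \<Rightarrow> nat" where n: "\<forall>i\<in>Basis. n i < 2 ^ k"
    and Q: "Q = hcube (dcenter c r k (\<lambda>i. int (n i))) (r / 2 ^ k)"
    by (auto simp: dyadic_sub_def dcenter_def)
  define x where "x = dcenter c r k (\<lambda>i. int (n i))"
  have "x \<in> Q" using r unfolding Q x_def[symmetric] by (simp add: hcube_def)
  then have x: "\<forall>i\<in>Basis. dindex c r k x i = int (n i)"
    using dcell_hcube_gen[OF r, of c k "\<lambda>i. int (n i)" 0] by (simp add: Q)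
  have "dcenter c r k (dindex c r k x) = dcenter c r k (\<lambda>i. int (n i))"
    using x by (simp add: dcenter_def)
  then have "Q = dcell c r k x" by (simp only: Q dcell_hcube[OF r])
  moreover have "x \<in> hcube c r"
    unfolding hcube_dindex[OF r]
  proof
    fix i :: 'a assume i: "i \<in> Basis"
    then have "int (n i) < 2 ^ k"
      using n by (metis of_nat_less_iff of_nat_numeral of_nat_power)
    then show "dindex c r 0 x i = 0"
      using dindex_div[of 0 k c r x i] x i by (simp add: div_pos_pos_trivial)
  qed
  ultimately show "Q \<in> {dcell c r k x | k x. x \<in> hcube c r}" by blast
next
  fix Q assume "Q \<in> {dcell c r k x | k x. x \<in> hcube c r}"
  then obtain k x where x: "x \<in> hcube c r" "Q = dcell c r k x" by blast
  define n where "n i = nat (dindex c r k x i)" for i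
  have n: "\<forall>i\<in>Basis. n i < 2 ^ k \<and> int (n i) = dindex c r k x i"
    using dindex_bounds[OF r x(1), of _ k] by (auto simp: n_def nat_less_iff)
  have "dcenter c r k (dindex c r k x) = c + (\<Sum>i\<in>Basis. (- r + (r / 2 ^ k) * (2 * real (n i) + 1)) *\<^sub>R i)"
  proof -
    have "real_of_int (dindex c r k x i) = real (n i)" if "i \<in> Basis" for i
      using n that by (metis of_int_of_nat_eq)
    then show ?thesis by (simp add: dcenter_def)
  qed
  then show "Q \<in> dyadic_sub c r"
    unfolding dyadic_sub_def x(2) dcell_hcube[OF r]
    by (intro CollectI exI[of _ k] exI[of _ n]) (use n in auto)
qed

lemma countable_dyadic_sub: "countable (dyadic_sub (c::'a::euclidean_space) r)"
proof -
  have "dyadic_sub c r \<subseteq> (\<lambda>(k::nat, n::'a \<Rightarrow> nat). hcube (c + (\<Sum>i\<in>Basis. (- r + (r / 2 ^ k) * (2 * real (n i) + 1)) *\<^sub>R i)) (r / 2 ^ k))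
      ` (UNIV \<times> (Basis \<rightarrow>\<^sub>E UNIV))"
  proof
    fix Q assume "Q \<in> dyadic_sub c r"
    then obtain k :: nat and n :: "'a \<Rightarrow> nat" where "Q = hcube (c + (\<Sum>i\<in>Basis. (- r + (r / 2 ^ k) * (2 * real (n i) + 1)) *\<^sub>R i)) (r / 2 ^ k)"
      by (auto simp: dyadic_sub_def)
    \<comment> \<open>Only the values of \<open>n\<close> on the finite set \<open>Basis\<close>
      matter; restricting \<open>n\<close> puts it into a countable product.\<close>
    then show "Q \<in> (\<lambda>(k, n). hcube (c + (\<Sum>i\<in>Basis. (- r + (r / 2 ^ k) * (2 * real (n i) + 1)) *\<^sub>R i)) (r / 2 ^ k))
      ` (UNIV \<times> (Basis \<rightarrow>\<^sub>E UNIV))"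
      by (intro image_eqI[of _ _ "(k, restrict n Basis)"]) auto
  qed
  moreover have "countable ((UNIV :: nat set) \<times> (Basis \<rightarrow>\<^sub>E UNIV :: ('a \<Rightarrow> nat) set))"
    by (intro countable_SIGMA countable_PiE) auto
  ultimately show ?thesis by (meson countable_image countable_subset)
qed

lemma dyadic_nested:
  assumes "0 < r" "P \<in> dyadic_sub c r" "Q \<in> dyadic_sub c r" "P \<inter> Q \<noteq> {}"
  shows "P \<subseteq> Q \<or> Q \<subseteq> P"
proof -
  obtain k x k' y where "P = dcell c r k x" "Q = dcell c r k' y"
    using assms by (auto simp: dyadic_sub_eq)
  moreover obtain z where "z \<in> P" "z \<in> Q" using assms(4) by blast
  ultimately have "P = dcell c r k z" "Q = dcell c r k' z" by (simp_all add: dcell_eq)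
  then show ?thesis by (metis dcell_mono linorder_linear)
qed

lemma dyadic_sub_lebesgue: "Q \<in> dyadic_sub c r \<Longrightarrow> Q \<in> sets lebesgue"
  by (auto simp: dyadic_sub_def)

lemma emeasure_dcell:
  assumes "0 < r"
  shows "emeasure lebesgue (dcell c r k (x::'a::euclidean_space)) = ennreal ((2 * (r / 2 ^ k)) ^ DIM('a))"
  unfolding dcell_hcube[OF assms] using assms by (subst emeasure_hcube) auto

lemma emeasure_dcell_Suc:
  assumes "0 < r"
  shows "emeasure lebesgue (dcell c r k (x::'a::euclidean_space)) = 2 ^ DIM('a) * emeasure lebesgue (dcell c r (Suc k) x)"
proof -
  have "(2 * (r / 2 ^ k)) ^ DIM('a) = 2 ^ DIM('a) * (2 * (r / 2 ^ Suc k)) ^ DIM('a)"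
    by (simp add: power_mult_distrib[symmetric])
  then show ?thesis
    using assms by (simp add: emeasure_dcell ennreal_mult' ennreal_power[symmetric] del: power_Suc)
qed

section \<open>Maximal members of a family of dyadic cubes\<close>

definition maximal_cells :: "'a set set \<Rightarrow> 'a set set" where
  "maximal_cells S = {Q \<in> S. \<forall>Q'\<in>S. Q \<subseteq> Q' \<longrightarrow> Q' = Q}"

lemma maximal_cells_subset: "maximal_cells S \<subseteq> S"
  by (auto simp: maximal_cells_def)

lemma disjoint_maximal_cells:
  assumes "0 < r" "S \<subseteq> dyadic_sub c r"
  shows "disjoint (maximal_cells S)"
proof (rule disjointI)
  fix P Q assume PQ: "P \<in> maximal_cells S" "Q \<in> maximal_cells S" "P \<noteq> Q"
  then have D: "P \<in> dyadic_sub c r" "Q \<in> dyadic_sub c r" using assms maximal_cells_subset by auto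
  show "P \<inter> Q = {}"
    using dyadic_nested[OF assms(1) D] PQ by (auto simp: maximal_cells_def)
qed

text \<open>Going up through the ancestors of a cube ends at generation 0, so the least generation
  whose cell belongs to \<open>S\<close> supplies the maximal one.\<close>

lemma maximal_cells_cover:
  assumes r: "0 < r" and S: "S \<subseteq> dyadic_sub c r" and Q: "Q \<in> S"
  shows "\<exists>P\<in>maximal_cells S. Q \<subseteq> P"
proof -
  obtain k x where x: "x \<in> hcube c r" "Q = dcell c r k x"
    using Q S r by (auto simp: dyadic_sub_eq)
  define k0 where "k0 = (LEAST k. dcell c r k x \<in> S)"
  have k0: "dcell c r k0 x \<in> S" unfolding k0_def using Q x by (metis LeastI)
  have least: "k0 \<le> k" if "dcell c r k x \<in> S" for k
    unfolding k0_def using that by (rule Least_le)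
  have "dcell c r k0 x \<in> maximal_cells S"
    unfolding maximal_cells_def
  proof (intro CollectI conjI ballI impI k0)
    fix Q' assume Q': "Q' \<in> S" "dcell c r k0 x \<subseteq> Q'"
    then obtain k' x' where "Q' = dcell c r k' x'" using S r by (auto simp: dyadic_sub_eq)
    with Q' have "Q' = dcell c r k' x" by (metis dcell_eq dcell_self subsetD)
    with Q' least[of k'] have "Q' \<subseteq> dcell c r k0 x" by (metis dcell_mono)
    then show "Q' = dcell c r k0 x" using Q' by blast
  qed
  moreover have "Q \<subseteq> dcell c r k0 x" using least[of k] Q x dcell_mono[of k0 k c r x] by simp
  ultimately show ?thesis by blast
qed

lemma Union_maximal_cells:
  assumes "0 < r" "S \<subseteq> dyadic_sub c r"
  shows "\<Union>(maximal_cells S) = \<Union>S"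
  using maximal_cells_cover[OF assms] maximal_cells_subset[of S] by blast

subsection \<open>Disjoint unions and double integrals\<close>

text \<open>Tonelli's theorem is applied to the completed measure; the exhausting Borel sets of
  \<open>lborel\<close> serve again.\<close>

lemma sigma_finite_lebesgue: "sigma_finite_measure (lebesgue :: 'a::euclidean_space measure)"
proof
  obtain A :: "'a set set" where A: "countable A" "A \<subseteq> sets lborel" "\<Union>A = space lborel" "\<forall>a\<in>A. emeasure lborel a \<noteq> \<infinity>"
    using lborel.sigma_finite_countable by blast
  show "\<exists>A. countable A \<and> A \<subseteq> sets (lebesgue :: 'a measure) \<and> \<Union>A = space lebesgue \<and> (\<forall>a\<in>A. emeasure lebesgue a \<noteq> \<infinity>)"
    by (intro exI[of _ A]) (use A in \<open>auto simp: sets_completionI_sets subset_eq\<close>)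
qed

interpretation lebesgue_pair: pair_sigma_finite lebesgue lebesgue
  by (simp add: pair_sigma_finite_def sigma_finite_lebesgue)

lemma id_measurable_lebesgue [measurable]: "(\<lambda>x. x) \<in> borel_measurable lebesgue"
  by (rule measurable_completion) simp

lemma fst_measurable_lebesgue [measurable]: "fst \<in> borel_measurable (lebesgue \<Otimes>\<^sub>M lebesgue)"
  using measurable_compose[OF measurable_fst id_measurable_lebesgue] by (simp add: o_def eta_contract_eq)

lemma snd_measurable_lebesgue [measurable]: "snd \<in> borel_measurable (lebesgue \<Otimes>\<^sub>M lebesgue)"
  using measurable_compose[OF measurable_snd id_measurable_lebesgue] by (simp add: o_def eta_contract_eq)

lemma emeasure_disjoint_Union:
  assumes "countable J" "J \<subseteq> sets M" "disjoint J"
  shows "emeasure M (\<Union>J) = (\<integral>\<^sup>+Q. emeasure M Q \<partial>count_space J)"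
proof -
  have "disjoint_family_on (\<lambda>Q. Q) J" using assms(3) by (auto simp: disjoint_family_on_def disjoint_def)
  then show ?thesis using emeasure_UN_countable[of J "\<lambda>Q. Q" M] assms by auto
qed

lemma nn_integral_Union_mono:
  fixes h1 h2 :: "'a \<Rightarrow> ennreal"
  assumes J: "countable J" "J \<subseteq> sets M" "disjoint J"
    and [measurable]: "h1 \<in> borel_measurable M" "h2 \<in> borel_measurable M"
    and le: "\<And>Q. Q \<in> J \<Longrightarrow> (\<integral>\<^sup>+x\<in>Q. h1 x \<partial>M) \<le> (\<integral>\<^sup>+x\<in>Q. h2 x \<partial>M)"
  shows "(\<integral>\<^sup>+x\<in>\<Union>J. h1 x \<partial>M) \<le> (\<integral>\<^sup>+x\<in>\<Union>J. h2 x \<partial>M)"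
proof -
  have U: "\<Union>J \<in> sets M" using J by (intro sets.countable_Union) auto
  have "(\<integral>\<^sup>+x\<in>\<Union>J. h1 x \<partial>M) = emeasure (density M h1) (\<Union>J)"
    using U by (simp add: emeasure_density)
  also have "\<dots> = (\<integral>\<^sup>+Q. emeasure (density M h1) Q \<partial>count_space J)"
    using J by (intro emeasure_disjoint_Union) auto
  also have "\<dots> \<le> (\<integral>\<^sup>+Q. emeasure (density M h2) Q \<partial>count_space J)"
    using J le by (intro nn_integral_mono) (auto simp: emeasure_density subset_eq)
  also have "\<dots> = emeasure (density M h2) (\<Union>J)"
    using J by (intro emeasure_disjoint_Union[symmetric]) auto
  also have "\<dots> = (\<integral>\<^sup>+x\<in>\<Union>J. h2 x \<partial>M)"
    using U by (simp add: emeasure_density)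
  finally show ?thesis .
qed

text \<open>The square is a double integral. Exchanging the two variables maps the part with
  \<open>s y \<le> s z\<close> onto the part with \<open>s z \<le> s y\<close>, so always placing
  the larger piece in the outer integral costs a factor 2.\<close>

lemma nn_integral_square_le:
  assumes M: "sigma_finite_measure M"
    and [measurable]: "F \<in> borel_measurable M" "s \<in> borel_measurable M"
  shows "(\<integral>\<^sup>+y. F y \<partial>M)\<^sup>2 \<le> 2 * (\<integral>\<^sup>+y. F y * (\<integral>\<^sup>+z. F z * indicator {z. s z \<le> (s y :: real)} z \<partial>M) \<partial>M)"
proof -
  interpret pair_sigma_finite M M using M by (simp add: pair_sigma_finite_def)
  have le: "F y * F z \<le> F y * (F z * indicator {z. s z \<le> s y} z) + F y * (F z * indicator {z. s y \<le> s z} z)" for y z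
    by (auto simp: indicator_def)
  have "(\<integral>\<^sup>+y. F y \<partial>M)\<^sup>2 = (\<integral>\<^sup>+y. (\<integral>\<^sup>+z. F y * F z \<partial>M) \<partial>M)"
    by (simp add: nn_integral_cmult nn_integral_multc power2_eq_square)
  also have "\<dots> \<le> (\<integral>\<^sup>+y. (\<integral>\<^sup>+z. F y * (F z * indicator {z. s z \<le> s y} z) + F y * (F z * indicator {z. s y \<le> s z} z) \<partial>M) \<partial>M)"
    by (intro nn_integral_mono le)
  also have "\<dots> = (\<integral>\<^sup>+y. (\<integral>\<^sup>+z. F y * (F z * indicator {z. s z \<le> s y} z) \<partial>M) \<partial>M)
     + (\<integral>\<^sup>+y. (\<integral>\<^sup>+z. F y * (F z * indicator {z. s y \<le> s z} z) \<partial>M) \<partial>M)"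
    by (simp add: nn_integral_add indicator_def of_bool_def)
  also have "(\<integral>\<^sup>+y. (\<integral>\<^sup>+z. F y * (F z * indicator {z. s y \<le> s z} z) \<partial>M) \<partial>M)
     = (\<integral>\<^sup>+z. (\<integral>\<^sup>+y. F y * (F z * indicator {z. s y \<le> s z} z) \<partial>M) \<partial>M)"
    by (rule Fubini'[symmetric]) (simp add: indicator_def)
  also have "\<dots> = (\<integral>\<^sup>+y. (\<integral>\<^sup>+z. F y * (F z * indicator {z. s z \<le> s y} z) \<partial>M) \<partial>M)"
    by (intro nn_integral_cong) (auto simp: indicator_def mult_ac)
  finally show ?thesis
    by (simp add: nn_integral_cmult mult_2[symmetric] indicator_def)
qed

subsection \<open>Dyadic stopping cubes\<close>

text \<open>Serves twice: for the function itself at height \<tau>, and for the indicator of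
  \<open>E\<close> at height \<theta>. The last conclusion, usually drawn from Lebesgue's
  differentiation theorem, comes here from outer regularity: the set in question is covered by
  dyadic cubes inside a slightly larger open set, and none of these cubes has average above
  \<open>l\<close>.\<close>

lemma dyadic_stopping:
  fixes h :: "'a::euclidean_space \<Rightarrow> ennreal"
  assumes r: "0 < r" and hm [measurable]: "h \<in> borel_measurable lebesgue" and l: "0 \<le> l"
    and top: "(\<integral>\<^sup>+x\<in>hcube c r. h x \<partial>lebesgue) \<le> ennreal l * emeasure lebesgue (hcube c r)"
  obtains J where "J \<subseteq> dyadic_sub c r" "disjoint J"
    "\<And>Q. Q \<in> J \<Longrightarrow> ennreal l * emeasure lebesgue Q \<le> (\<integral>\<^sup>+x\<in>Q. h x \<partial>lebesgue)"
    "\<And>Q. Q \<in> J \<Longrightarrow> (\<integral>\<^sup>+x\<in>Q. h x \<partial>lebesgue) \<le> 2 ^ DIM('a) * ennreal l * emeasure lebesgue Q"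
    "\<And>Q. Q \<in> dyadic_sub c r \<Longrightarrow> (\<nexists>P. P \<in> J \<and> Q \<subseteq> P) \<Longrightarrow> (\<integral>\<^sup>+x\<in>Q. h x \<partial>lebesgue) \<le> ennreal l * emeasure lebesgue Q"
    "AE x in lebesgue. x \<in> hcube c r \<longrightarrow> x \<notin> \<Union>J \<longrightarrow> h x \<le> ennreal l"
proof -
  define S where "S = {Q \<in> dyadic_sub c r. ennreal l * emeasure lebesgue Q < (\<integral>\<^sup>+x\<in>Q. h x \<partial>lebesgue)}"
  define J where "J = maximal_cells S"
  have SD: "S \<subseteq> dyadic_sub c r" by (auto simp: S_def)
  have JS: "J \<subseteq> S" by (simp add: J_def maximal_cells_subset)
  have JD: "J \<subseteq> dyadic_sub c r" using SD JS by blast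
  have disj: "disjoint J" unfolding J_def by (rule disjoint_maximal_cells[OF r SD])
  have low: "ennreal l * emeasure lebesgue Q \<le> (\<integral>\<^sup>+x\<in>Q. h x \<partial>lebesgue)" if "Q \<in> J" for Q
    using that JS by (auto simp: S_def)
  have unsel: "(\<integral>\<^sup>+x\<in>Q. h x \<partial>lebesgue) \<le> ennreal l * emeasure lebesgue Q"
    if "Q \<in> dyadic_sub c r" "\<nexists>P. P \<in> J \<and> Q \<subseteq> P" for Q
    using that maximal_cells_cover[OF r SD, of Q] by (force simp: S_def J_def not_less)
  have up: "(\<integral>\<^sup>+x\<in>Q. h x \<partial>lebesgue) \<le> 2 ^ DIM('a) * ennreal l * emeasure lebesgue Q" if Q: "Q \<in> J" for Q
  proof -
    obtain k x where x: "x \<in> hcube c r" "Q = dcell c r k x"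
      using Q JD r by (auto simp: dyadic_sub_eq)
    \<comment> \<open>The initial cube has average at most \<open>l\<close>, so a selected cube has
      a parent; the parent is unselected and has 2^d times the volume.\<close>
    have "k \<noteq> 0"
    proof
      assume "k = 0"
      then have "Q = hcube c r" using dcell_0[OF r x(1)] x(2) by simp
      moreover have "ennreal l * emeasure lebesgue Q < (\<integral>\<^sup>+x\<in>Q. h x \<partial>lebesgue)"
        using Q JS unfolding S_def by blast
      ultimately show False using top leD by blast
    qed
    then obtain m where m: "k = Suc m" by (cases k) auto
    let ?P = "dcell c r m x"
    have sub: "Q \<subseteq> ?P" unfolding x m by (rule dcell_mono) simp
    have PD: "?P \<in> dyadic_sub c r" using x by (auto simp: dyadic_sub_eq[OF r])
    have "?P \<notin> S"
    proof
      assume "?P \<in> S"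
      then have "?P = Q" using Q sub by (auto simp: J_def maximal_cells_def)
      then have "(2 * (r / 2 ^ m)) ^ DIM('a) = (2 * (r / 2 ^ Suc m)) ^ DIM('a)"
        using emeasure_dcell[OF r, of c m x] emeasure_dcell[OF r, of c "Suc m" x] r x m by simp
      then have "2 * (r / 2 ^ m) = 2 * (r / 2 ^ Suc m)"
        by (rule power_eq_imp_eq_base[where n="DIM('a)"]) (use r in auto)
      then show False using r by simp
    qed
    then have "(\<integral>\<^sup>+x\<in>?P. h x \<partial>lebesgue) \<le> ennreal l * emeasure lebesgue ?P"
      using PD unfolding S_def mem_Collect_eq by (meson leI)
    also have "\<dots> = 2 ^ DIM('a) * ennreal l * emeasure lebesgue Q"
      using emeasure_dcell_Suc[OF r, of c m x] unfolding x(2) m by (simp only: mult_ac)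
    finally have "(\<integral>\<^sup>+x\<in>?P. h x \<partial>lebesgue) \<le> 2 ^ DIM('a) * ennreal l * emeasure lebesgue Q" .
    moreover have "(\<integral>\<^sup>+x\<in>Q. h x \<partial>lebesgue) \<le> (\<integral>\<^sup>+x\<in>?P. h x \<partial>lebesgue)"
      using sub by (intro nn_integral_mono) (auto simp: indicator_def)
    ultimately show ?thesis by simp
  qed
  have UJ [measurable]: "\<Union>J \<in> sets lebesgue"
    using JD countable_subset[OF JD countable_dyadic_sub] dyadic_sub_lebesgue
    by (intro sets.countable_Union) auto
  \<comment> \<open>\<open>h\<close> exceeds \<open>l\<close> on \<open>A\<close>; once its integral
    over \<open>A\<close> is shown to be at most \<open>l\<close> times the measure of
    \<open>A\<close>, the set must be null.\<close>
  define A where "A = {x \<in> hcube c r. x \<notin> \<Union>J \<and> ennreal l < h x}"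
  have "A = hcube c r \<inter> (- \<Union>J) \<inter> {x \<in> space lebesgue. ennreal l < h x}"
    by (auto simp: A_def)
  also have "\<dots> \<in> sets lebesgue" by measurable
  finally have Am [measurable]: "A \<in> sets lebesgue" .
  have "emeasure lebesgue A \<le> emeasure lebesgue (hcube c r)"
    by (intro emeasure_mono) (auto simp: A_def)
  also have "\<dots> < \<infinity>" using r by (subst emeasure_hcube) simp_all
  finally have Afin: "emeasure lebesgue A < \<infinity>" .
  have key: "(\<integral>\<^sup>+x\<in>A. h x \<partial>lebesgue) \<le> ennreal l * emeasure lebesgue A + ennreal l * ennreal e" if e: "0 < e" for e
  proof -
    obtain U where U: "open U" "A \<subseteq> U" "U - A \<in> lmeasurable" "emeasure lebesgue (U - A) < ennreal e"
      using sets_lebesgue_outer_open[OF Am e] .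
    \<comment> \<open>A cube meeting \<open>A\<close> is contained in no member of \<open>J\<close>,
      since \<open>A\<close> avoids the union of \<open>J\<close>; hence \<open>unsel\<close>
      applies to it.\<close>
    define S' where "S' = {Q \<in> dyadic_sub c r. Q \<subseteq> U \<and> Q \<inter> A \<noteq> {}}"
    define M where "M = maximal_cells S'"
    have S'D: "S' \<subseteq> dyadic_sub c r" by (auto simp: S'_def)
    have MS: "M \<subseteq> S'" by (simp add: M_def maximal_cells_subset)
    have MD: "M \<subseteq> dyadic_sub c r" using MS S'D by blast
    have Mc: "countable M" "M \<subseteq> sets lebesgue" "disjoint M"
      using countable_subset[OF MD countable_dyadic_sub] MD dyadic_sub_lebesgue
        disjoint_maximal_cells[OF r S'D] by (blast, blast, simp add: M_def)
    have cover: "A \<subseteq> \<Union>M"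
    proof
      fix x assume x: "x \<in> A"
      then obtain d where d: "d > 0" "ball x d \<subseteq> U" using U open_contains_ball by blast
      obtain k where k: "2 * real DIM('a) * r / d < 2 ^ k"
        using real_arch_pow[of 2] by auto
      have "2 * real DIM('a) * (r / 2 ^ k) < d"
        using k d(1) by (simp add: field_simps)
      then have "dcell c r k x \<subseteq> ball x d"
        using dist_hcube_le[of x _ "r / 2 ^ k"] dcell_self[of x c r k]
        unfolding dcell_hcube[OF r] by (fastforce simp: mem_ball)
      moreover have "x \<in> hcube c r" using x by (simp add: A_def)
      ultimately have "dcell c r k x \<in> S'"
        using d x r by (auto simp: S'_def dyadic_sub_eq intro: dcell_self)
      then have "x \<in> \<Union>S'" using dcell_self by blast
      then show "x \<in> \<Union>M" unfolding M_def Union_maximal_cells[OF r S'D] .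
    qed
    have each: "(\<integral>\<^sup>+x\<in>Q. h x \<partial>lebesgue) \<le> (\<integral>\<^sup>+x\<in>Q. ennreal l \<partial>lebesgue)" if Q: "Q \<in> M" for Q
    proof -
      have QD: "Q \<in> dyadic_sub c r" and "Q \<inter> A \<noteq> {}" using Q MS by (auto simp: S'_def)
      then have "\<nexists>P. P \<in> J \<and> Q \<subseteq> P" by (auto simp: A_def)
      from unsel[OF QD this] show ?thesis
        using dyadic_sub_lebesgue[OF QD] by (simp add: nn_integral_cmult_indicator)
    qed
    have "(\<integral>\<^sup>+x\<in>A. h x \<partial>lebesgue) \<le> (\<integral>\<^sup>+x\<in>\<Union>M. h x \<partial>lebesgue)"
      using cover by (intro nn_integral_mono) (auto simp: indicator_def)
    also have "\<dots> \<le> (\<integral>\<^sup>+x\<in>\<Union>M. ennreal l \<partial>lebesgue)"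
      using Mc each by (intro nn_integral_Union_mono) auto
    also have "\<dots> \<le> (\<integral>\<^sup>+x\<in>U. ennreal l \<partial>lebesgue)"
      using MS by (intro nn_integral_mono) (auto simp: indicator_def S'_def)
    also have "\<dots> = ennreal l * emeasure lebesgue U"
      using U(1) by (intro nn_integral_cmult_indicator) (simp add: borel_open)
    also have "emeasure lebesgue U = emeasure lebesgue A + emeasure lebesgue (U - A)"
      using U Am by (subst plus_emeasure) (auto simp: Un_absorb1 fmeasurableD)
    also have "ennreal l * \<dots> \<le> ennreal l * (emeasure lebesgue A + ennreal e)"
      using U by (intro mult_left_mono add_left_mono) auto
    finally show ?thesis by (simp add: distrib_left)
  qed
  have le: "(\<integral>\<^sup>+x\<in>A. h x \<partial>lebesgue) \<le> ennreal l * emeasure lebesgue A"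
  proof (rule ennreal_le_epsilon)
    fix e :: real assume e: "0 < e"
    \<comment> \<open>Dividing by \<open>l + 1\<close> instead of \<open>l\<close> includes the
      height 0.\<close>
    have "l * (e / (l + 1)) \<le> e" using l e by (simp add: field_simps)
    then have "ennreal l * ennreal (e / (l + 1)) \<le> ennreal e"
      using l e by (simp add: ennreal_mult[symmetric] ennreal_leI)
    then show "(\<integral>\<^sup>+x\<in>A. h x \<partial>lebesgue) \<le> ennreal l * emeasure lebesgue A + ennreal e"
      using key[of "e / (l + 1)"] l e by (meson add_left_mono divide_pos_pos order_trans add_nonneg_pos zero_less_one)
  qed
  have "(\<integral>\<^sup>+x\<in>A. h x \<partial>lebesgue) = (\<integral>\<^sup>+x\<in>A. (h x - ennreal l) + ennreal l \<partial>lebesgue)"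
    by (intro nn_integral_cong) (auto simp: A_def indicator_def diff_add_cancel_ennreal)
  also have "\<dots> = (\<integral>\<^sup>+x\<in>A. (h x - ennreal l) \<partial>lebesgue) + (\<integral>\<^sup>+x\<in>A. ennreal l \<partial>lebesgue)"
    by (simp add: distrib_right nn_integral_add)
  also have "(\<integral>\<^sup>+x\<in>A. ennreal l \<partial>lebesgue) = ennreal l * emeasure lebesgue A"
    by (intro nn_integral_cmult_indicator) simp
  finally have "(\<integral>\<^sup>+x\<in>A. (h x - ennreal l) \<partial>lebesgue) + ennreal l * emeasure lebesgue A \<le> 0 + ennreal l * emeasure lebesgue A"
    using le by simp
  moreover have "ennreal l * emeasure lebesgue A \<noteq> \<infinity>"
    using Afin by (simp add: ennreal_mult_eq_top_iff)
  ultimately have "(\<integral>\<^sup>+x\<in>A. (h x - ennreal l) \<partial>lebesgue) = 0"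
    using ennreal_add_left_cancel_le[of "ennreal l * emeasure lebesgue A" _ 0]
    by (metis add.commute le_zero_eq)
  then have "AE x in lebesgue. (h x - ennreal l) * indicator A x = 0"
    by (subst (asm) nn_integral_0_iff_AE) auto
  then have "AE x in lebesgue. x \<in> hcube c r \<longrightarrow> x \<notin> \<Union>J \<longrightarrow> h x \<le> ennreal l"
  proof eventually_elim
    case (elim x)
    show ?case
    proof (intro impI leI notI)
      assume x: "x \<in> hcube c r" "x \<notin> \<Union>J" "ennreal l < h x"
      then have "x \<in> A" by (simp add: A_def)
      then show False using elim x(3) by (auto simp: diff_eq_0_iff_ennreal)
    qed
  qed
  with that[OF JD disj low up unsel] show ?thesis by blast
qed


subsection \<open>Thin shells and radial integrals\<close>

text \<open>Stems from (r + t)^d - (r - t)^d \<le> 2 t d (r + t)^(d-1), with r + t \<le> (1 +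
  \<kappa>) r inserted.\<close>

definition shell_const :: "nat \<Rightarrow> real \<Rightarrow> real" where
  "shell_const d \<kappa> = 2 * real d * unit_ball_vol (real d) * (1 + \<kappa>) ^ (d - 1)"

lemma shell_const_nonneg: "0 \<le> \<kappa> \<Longrightarrow> 0 \<le> shell_const d \<kappa>"
  by (simp add: shell_const_def)

lemma power_diff_le:
  fixes a b :: real
  assumes "0 \<le> b" "b \<le> a"
  shows "a ^ n - b ^ n \<le> real n * (a - b) * a ^ (n - 1)"
proof -
  have "a ^ n - b ^ n = (a - b) * (\<Sum>i<n. b ^ (n - Suc i) * a ^ i)"
    by (rule power_diff_sumr2)
  also have "\<dots> \<le> (a - b) * (\<Sum>i<n. a ^ (n - 1))"
  proof (intro mult_left_mono sum_mono)
    fix i assume "i \<in> {..<n}"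
    then have e: "n - 1 = (n - Suc i) + i" by auto
    have "b ^ (n - Suc i) * a ^ i \<le> a ^ (n - Suc i) * a ^ i"
      using assms by (intro mult_right_mono power_mono) auto
    then show "b ^ (n - Suc i) * a ^ i \<le> a ^ (n - 1)" unfolding e by (simp add: power_add)
  qed (use assms in auto)
  finally show ?thesis by (simp add: mult_ac)
qed

lemma emeasure_shell_le:
  fixes x :: "'a::euclidean_space"
  assumes "0 \<le> t" "t \<le> \<kappa> * r" "0 < r"
  shows "emeasure lebesgue {y. \<bar>dist x y - r\<bar> \<le> t} \<le> ennreal (shell_const DIM('a) \<kappa> * t * r ^ (DIM('a) - 1))"
proof -
  let ?d = "DIM('a)" and ?v = "unit_ball_vol (real DIM('a))"
  have v: "0 \<le> ?v" by simp
  have eb: "emeasure lebesgue (ball x u) = ennreal (?v * u ^ ?d)" "emeasure lebesgue (cball x u) = ennreal (?v * u ^ ?d)"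
    if "0 \<le> u" for u
    using that by (simp_all add: emeasure_ball emeasure_cball)
  have pw: "(r + t) ^ (?d - 1) \<le> ((1 + \<kappa>) * r) ^ (?d - 1)"
    using assms by (intro power_mono) (auto simp: algebra_simps)
  have "emeasure lebesgue {y. \<bar>dist x y - r\<bar> \<le> t} \<le> ennreal (?v * (2 * t * real ?d * (r + t) ^ (?d - 1)))"
  proof (cases "t \<le> r")
    case True
    have "{y. \<bar>dist x y - r\<bar> \<le> t} = cball x (r + t) - ball x (r - t)" by (auto simp: abs_le_iff)
    also have "emeasure lebesgue \<dots> = emeasure lebesgue (cball x (r + t)) - emeasure lebesgue (ball x (r - t))"
      using True assms eb(1)[of "r - t"] by (intro emeasure_Diff) (auto simp del: emeasure_completion)
    also have "\<dots> = ennreal (?v * (r + t) ^ ?d - ?v * (r - t) ^ ?d)"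
      using True assms by (subst eb, simp, subst eb, simp) (intro ennreal_minus mult_nonneg_nonneg, auto)
    also have "\<dots> \<le> ennreal (?v * (2 * t * real ?d * (r + t) ^ (?d - 1)))"
    proof (rule ennreal_leI)
      have "(r + t) ^ ?d - (r - t) ^ ?d \<le> real ?d * ((r + t) - (r - t)) * (r + t) ^ (?d - 1)"
        using True assms by (intro power_diff_le) auto
      then have "?v * ((r + t) ^ ?d - (r - t) ^ ?d) \<le> ?v * (real ?d * ((r + t) - (r - t)) * (r + t) ^ (?d - 1))"
        by (intro mult_left_mono) auto
      then show "?v * (r + t) ^ ?d - ?v * (r - t) ^ ?d \<le> ?v * (2 * t * real ?d * (r + t) ^ (?d - 1))"
        by (simp add: algebra_simps)
    qed
    finally show ?thesis .
  next
    case False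
    have "{y. \<bar>dist x y - r\<bar> \<le> t} \<subseteq> cball x (r + t)" by auto
    then have "emeasure lebesgue {y. \<bar>dist x y - r\<bar> \<le> t} \<le> emeasure lebesgue (cball x (r + t))"
      by (intro emeasure_mono) auto
    also have "\<dots> = ennreal (?v * (r + t) ^ ?d)" using assms by (intro eb) auto
    also have "\<dots> \<le> ennreal (?v * (2 * t * real ?d * (r + t) ^ (?d - 1)))"
    proof (rule ennreal_leI)
      \<comment> \<open>For \<open>t > r\<close> the shell is a full ball; bounding a single factor
        \<open>r + t\<close> by \<open>2 * t\<close> restores the linear dependence on
        \<open>t\<close>.\<close>
      have "r + t \<le> 2 * t * 1" using False by simp
      also have "\<dots> \<le> 2 * t * real ?d" using assms DIM_positive[where 'a='a]
        by (intro mult_left_mono) (auto simp: Suc_leI)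
      finally have "(r + t) * (r + t) ^ (?d - 1) \<le> (2 * t * real ?d) * (r + t) ^ (?d - 1)"
        using assms by (intro mult_right_mono) auto
      moreover have "(r + t) * (r + t) ^ (?d - 1) = (r + t) ^ ?d"
        using DIM_positive[where 'a='a] by (simp add: power_eq_if)
      ultimately show "?v * (r + t) ^ ?d \<le> ?v * (2 * t * real ?d * (r + t) ^ (?d - 1))"
        by (intro mult_left_mono) auto
    qed
    finally show ?thesis .
  qed
  also have "\<dots> \<le> ennreal (shell_const ?d \<kappa> * t * r ^ (?d - 1))"
  proof (rule ennreal_leI)
    have "?v * (2 * t * real ?d * (r + t) ^ (?d - 1)) \<le> ?v * (2 * t * real ?d * ((1 + \<kappa>) * r) ^ (?d - 1))"
      using pw assms by (intro mult_left_mono) auto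
    also have "\<dots> = shell_const ?d \<kappa> * t * r ^ (?d - 1)"
      by (simp add: shell_const_def power_mult_distrib mult_ac)
    finally show "?v * (2 * t * real ?d * (r + t) ^ (?d - 1)) \<le> shell_const ?d \<kappa> * t * r ^ (?d - 1)" .
  qed
  finally show ?thesis .
qed

text \<open>Dyadic annuli: where 2^k L \<le> dist x c < 2^(k+1) L the integrand is at most
  \<eta>(2^-k) / (2^k L)^d, and the ball of radius 2^(k+1) L has volume 2^d (2^k L)^d times that of
  the unit ball.\<close>

lemma nn_integral_radial_le:
  fixes c :: "'a::euclidean_space"
  assumes L: "0 < L" and mono: "\<And>s t. s \<le> t \<Longrightarrow> \<eta> s \<le> \<eta> t" and nonneg: "\<And>t. 0 \<le> \<eta> t"
    and summ: "summable (\<lambda>k::nat. \<eta> (1 / 2 ^ k))"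
  shows "(\<integral>\<^sup>+x\<in>{x. L \<le> dist x c}. ennreal (\<eta> (L / dist x c) / dist x c ^ DIM('a)) \<partial>lebesgue)
     \<le> ennreal (2 ^ DIM('a) * unit_ball_vol (real DIM('a)) * (\<Sum>k. \<eta> (1 / 2 ^ k)))"
proof -
  let ?d = "DIM('a)" and ?v = "unit_ball_vol (real DIM('a))"
  define a where "a k = \<eta> (1 / 2 ^ k) / (2 ^ k * L) ^ ?d" for k :: nat
  have a0: "0 \<le> a k" for k using L nonneg by (simp add: a_def)
  have pt: "ennreal (\<eta> (L / dist x c) / dist x c ^ ?d) * indicator {x. L \<le> dist x c} x
      \<le> (\<Sum>k. ennreal (a k) * indicator (ball c (2 ^ Suc k * L)) x)" for x
  proof (cases "L \<le> dist x c")
    case True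
    define k where "k = nat \<lfloor>log 2 (dist x c / L)\<rfloor>"
    have q: "1 \<le> dist x c / L" using True L by simp
    have pl: "2 powr (log 2 (dist x c / L)) = dist x c / L" using q by simp
    have l0: "0 \<le> log 2 (dist x c / L)" using q by simp
    have "2 powr real k \<le> 2 powr (log 2 (dist x c / L))"
      using l0 by (intro powr_mono) (auto simp: k_def)
    then have k1: "2 ^ k * L \<le> dist x c"
      unfolding pl using L by (simp add: powr_realpow field_simps)
    have "2 powr (log 2 (dist x c / L)) < 2 powr real (Suc k)"
      using l0 by (intro powr_less_mono) (auto simp: k_def, linarith)
    then have k2: "dist x c < 2 ^ Suc k * L"
      unfolding pl using L by (simp add: powr_realpow field_simps powr_add)
    have dp: "0 < dist x c" using True L by linarith
    have "\<eta> (L / dist x c) / dist x c ^ ?d \<le> a k"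
      unfolding a_def
    proof (rule frac_le)
      have "L / dist x c \<le> 1 / 2 ^ k" using k1 dp L by (simp add: field_simps)
      then show "\<eta> (L / dist x c) \<le> \<eta> (1 / 2 ^ k)" by (rule mono)
      show "(2 ^ k * L) ^ ?d \<le> dist x c ^ ?d" using k1 L by (intro power_mono) auto
    qed (use nonneg L in auto)
    then have "ennreal (\<eta> (L / dist x c) / dist x c ^ ?d) \<le> ennreal (a k) * indicator (ball c (2 ^ Suc k * L)) x"
      using k2 by (simp add: ennreal_leI dist_commute)
    also have "\<dots> = (\<Sum>j\<in>{k}. ennreal (a j) * indicator (ball c (2 ^ Suc j * L)) x)"
      by (subst sum.insert) auto
    also have "\<dots> \<le> (\<Sum>k. ennreal (a k) * indicator (ball c (2 ^ Suc k * L)) x)"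
      by (intro sum_le_suminf) auto
    finally show ?thesis using True by simp
  qed simp
  have "(\<integral>\<^sup>+x\<in>{x. L \<le> dist x c}. ennreal (\<eta> (L / dist x c) / dist x c ^ DIM('a)) \<partial>lebesgue)
     \<le> (\<integral>\<^sup>+x. (\<Sum>k. ennreal (a k) * indicator (ball c (2 ^ Suc k * L)) x) \<partial>lebesgue)"
    by (intro nn_integral_mono pt)
  also have "\<dots> = (\<Sum>k. (\<integral>\<^sup>+x. ennreal (a k) * indicator (ball c (2 ^ Suc k * L)) x \<partial>lebesgue))"
    by (intro nn_integral_suminf borel_measurable_times_ennreal borel_measurable_indicator) auto
  also have "\<dots> = (\<Sum>k. ennreal (a k) * emeasure lebesgue (ball c (2 ^ Suc k * L)))"
    by (intro suminf_cong nn_integral_cmult_indicator) auto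
  also have "\<dots> = (\<Sum>k. ennreal (2 ^ ?d * ?v * \<eta> (1 / 2 ^ k)))"
  proof (intro suminf_cong)
    fix k
    have "a k * (?v * (2 ^ Suc k * L) ^ ?d) = 2 ^ ?d * ?v * \<eta> (1 / 2 ^ k)"
      using L by (simp add: a_def power_mult_distrib)
    moreover have "emeasure lebesgue (ball c (2 ^ Suc k * L)) = ennreal (?v * (2 ^ Suc k * L) ^ ?d)"
      using L by (simp add: emeasure_ball)
    ultimately show "ennreal (a k) * emeasure lebesgue (ball c (2 ^ Suc k * L)) = ennreal (2 ^ ?d * ?v * \<eta> (1 / 2 ^ k))"
      using a0[of k] by (simp only: ennreal_mult'[symmetric])
  qed
  also have "\<dots> = ennreal (\<Sum>k. 2 ^ ?d * ?v * \<eta> (1 / 2 ^ k))"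
    using nonneg summ by (intro suminf_ennreal2) (auto intro: summable_mult)
  also have "(\<Sum>k. 2 ^ ?d * ?v * \<eta> (1 / 2 ^ k)) = 2 ^ ?d * ?v * (\<Sum>k. \<eta> (1 / 2 ^ k))"
    using summ by (rule suminf_mult)
  finally show ?thesis .
qed

subsection \<open>Sphere crossings\<close>

text \<open>A mass that lives on pieces of size \<open>s y\<close> near \<open>y\<close>, restricted to the pieces that cross a
  sphere. In the square of its integral against \<open>1 / dist x y ^ d\<close> one keeps the larger of the two
  pieces; the smaller ones then lie in a shell whose width is the size of the larger.\<close>

lemma sphere_crossing:
  fixes x :: "'a::euclidean_space" and h :: "'a \<Rightarrow> ennreal" and s :: "'a \<Rightarrow> real" and N :: nat
  assumes [measurable]: "h \<in> borel_measurable lebesgue" "s \<in> borel_measurable lebesgue"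
    and U [measurable]: "\<And>i. i < N \<Longrightarrow> U i \<in> sets lebesgue"
    and disj: "disjoint_family_on U {..<N}"
    and \<kappa>: "0 \<le> \<kappa>" and \<Lambda>: "0 \<le> \<Lambda>"
    and geom: "\<And>i y. i < N \<Longrightarrow> y \<in> U i \<Longrightarrow> 0 < s y \<and> \<bar>dist x y - r i\<bar> \<le> s y \<and> s y \<le> \<kappa> * r i \<and> s y \<le> \<kappa> * dist x y"
    and mass: "\<And>i t. i < N \<Longrightarrow> 0 < r i \<Longrightarrow> 0 < t \<Longrightarrow> t \<le> \<kappa> * r i \<Longrightarrow>
        (\<integral>\<^sup>+y\<in>{y \<in> U i. s y \<le> t}. h y \<partial>lebesgue) \<le> ennreal (\<Lambda> * t * r i ^ (DIM('a) - 1))"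
  shows "(\<Sum>i<N. (\<integral>\<^sup>+y\<in>U i. ennreal (1 / dist x y ^ DIM('a)) * h y \<partial>lebesgue)\<^sup>2)
     \<le> ennreal (2 * (1 + \<kappa>) ^ Suc DIM('a) * \<Lambda>) *
        (\<integral>\<^sup>+y\<in>(\<Union>i<N. U i). ennreal (s y / dist x y / dist x y ^ DIM('a)) * h y \<partial>lebesgue)"
proof -
  let ?d = "DIM('a)"
  define w where "w y = ennreal (1 / dist x y ^ ?d) * h y" for y
  have [measurable]: "w \<in> borel_measurable lebesgue" unfolding w_def by measurable
  define C where "C = (1 + \<kappa>) ^ Suc ?d * \<Lambda>"
  have C0: "0 \<le> C" using \<kappa> \<Lambda> by (simp add: C_def)
  have one: "(\<integral>\<^sup>+y\<in>U i. w y \<partial>lebesgue)\<^sup>2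
      \<le> ennreal (2 * C) * (\<integral>\<^sup>+y\<in>U i. ennreal (s y / dist x y / dist x y ^ ?d) * h y \<partial>lebesgue)" if i: "i < N" for i
  proof -
    note [measurable] = U[OF i]
    let ?F = "\<lambda>y. w y * indicator (U i) y"
    \<comment> \<open>With the larger piece \<open>y\<close> fixed, the weight at \<open>z\<close>
      is comparable to 1 / r^d, and \<open>mass\<close> at \<open>t = s y\<close> leaves the factor
      \<open>s y / r i\<close>. This decay turns the square of the integral into a single
      integral.\<close>
    have inner: "(\<integral>\<^sup>+z. ?F z * indicator {z. s z \<le> s y} z \<partial>lebesgue) \<le> ennreal (C * (s y / dist x y))"
      if y: "y \<in> U i" for y
    proof -
      have g: "0 < s y" "\<bar>dist x y - r i\<bar> \<le> s y" "s y \<le> \<kappa> * r i" "s y \<le> \<kappa> * dist x y"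
        using geom[OF i y] by auto
      have \<kappa>0: "0 < \<kappa>" using g \<kappa> by (metis less_eq_real_def mult_zero_left not_le)
      have rpos: "0 < r i" using g \<kappa>0 by (metis less_le_trans zero_less_mult_pos)
      have dpos: "0 < dist x y" using g \<kappa>0 by (metis less_le_trans zero_less_mult_pos)
      have "?F z * indicator {z. s z \<le> s y} z \<le> ennreal (((1 + \<kappa>) / r i) ^ ?d) * (h z * indicator {z \<in> U i. s z \<le> s y} z)" for z
      proof (cases "z \<in> U i \<and> s z \<le> s y")
        case True
        then have gz: "0 < s z" "\<bar>dist x z - r i\<bar> \<le> s z" "s z \<le> \<kappa> * r i" "s z \<le> \<kappa> * dist x z"
          using geom[OF i, of z] by auto
        have zpos: "0 < dist x z" using gz \<kappa>0 by (metis less_le_trans zero_less_mult_pos)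
        have "r i \<le> (1 + \<kappa>) * dist x z" using gz by (simp add: algebra_simps)
        then have "1 / dist x z \<le> (1 + \<kappa>) / r i" using zpos rpos by (simp add: field_simps)
        then have "(1 / dist x z) ^ ?d \<le> ((1 + \<kappa>) / r i) ^ ?d" by (intro power_mono) auto
        then have "ennreal (1 / dist x z ^ ?d) \<le> ennreal (((1 + \<kappa>) / r i) ^ ?d)"
          by (intro ennreal_leI) (simp add: power_one_over)
        then show ?thesis using True by (simp add: w_def mult_right_mono)
      qed (auto simp: indicator_def)
      then have "(\<integral>\<^sup>+z. ?F z * indicator {z. s z \<le> s y} z \<partial>lebesgue)
         \<le> (\<integral>\<^sup>+z. ennreal (((1 + \<kappa>) / r i) ^ ?d) * (h z * indicator {z \<in> U i. s z \<le> s y} z) \<partial>lebesgue)"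
        by (intro nn_integral_mono)
      also have "\<dots> = ennreal (((1 + \<kappa>) / r i) ^ ?d) * (\<integral>\<^sup>+z\<in>{z \<in> U i. s z \<le> s y}. h z \<partial>lebesgue)"
        by (intro nn_integral_cmult) measurable
      also have "\<dots> \<le> ennreal (((1 + \<kappa>) / r i) ^ ?d) * ennreal (\<Lambda> * s y * r i ^ (?d - 1))"
        using g rpos by (intro mult_left_mono mass[OF i]) auto
      also have "\<dots> = ennreal (((1 + \<kappa>) / r i) ^ ?d * (\<Lambda> * s y * r i ^ (?d - 1)))"
        using \<kappa> rpos by (intro ennreal_mult'[symmetric]) auto
      also have "\<dots> \<le> ennreal (C * (s y / dist x y))"
      proof (rule ennreal_leI)
        have rd: "r i ^ ?d = r i * r i ^ (?d - 1)"
          using DIM_positive[where 'a='a] by (simp add: power_eq_if)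
        have "((1 + \<kappa>) / r i) ^ ?d * (\<Lambda> * s y * r i ^ (?d - 1)) = (1 + \<kappa>) ^ ?d * \<Lambda> * s y * (1 / r i)"
          using rpos by (simp add: power_divide rd)
        also have "\<dots> \<le> (1 + \<kappa>) ^ ?d * \<Lambda> * s y * ((1 + \<kappa>) / dist x y)"
        proof (intro mult_left_mono)
          have "dist x y \<le> (1 + \<kappa>) * r i" using g by (simp add: algebra_simps)
          then show "1 / r i \<le> (1 + \<kappa>) / dist x y" using rpos dpos by (simp add: field_simps)
        qed (use \<kappa> \<Lambda> g in auto)
        also have "\<dots> = C * (s y / dist x y)" by (simp add: C_def)
        finally show "((1 + \<kappa>) / r i) ^ ?d * (\<Lambda> * s y * r i ^ (?d - 1)) \<le> C * (s y / dist x y)" .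
      qed
      finally show ?thesis .
    qed
    have "(\<integral>\<^sup>+y. ?F y \<partial>lebesgue)\<^sup>2 \<le> 2 * (\<integral>\<^sup>+y. ?F y * (\<integral>\<^sup>+z. ?F z * indicator {z. s z \<le> s y} z \<partial>lebesgue) \<partial>lebesgue)"
      by (rule nn_integral_square_le[OF sigma_finite_lebesgue]) measurable
    also have "\<dots> \<le> 2 * (\<integral>\<^sup>+y. ennreal C * (ennreal (s y / dist x y / dist x y ^ ?d) * h y * indicator (U i) y) \<partial>lebesgue)"
    proof (intro mult_left_mono nn_integral_mono)
      fix y
      show "?F y * (\<integral>\<^sup>+z. ?F z * indicator {z. s z \<le> s y} z \<partial>lebesgue)
        \<le> ennreal C * (ennreal (s y / dist x y / dist x y ^ ?d) * h y * indicator (U i) y)"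
      proof (cases "y \<in> U i")
        case True
        have s0: "0 < s y" using geom[OF i True] by auto
        have "?F y * (\<integral>\<^sup>+z. ?F z * indicator {z. s z \<le> s y} z \<partial>lebesgue) \<le> w y * ennreal (C * (s y / dist x y))"
          using inner[OF True] True by (simp add: mult_left_mono)
        also have "\<dots> = ennreal (1 / dist x y ^ ?d * (C * (s y / dist x y))) * h y"
          unfolding w_def by (subst ennreal_mult') (auto simp: mult_ac)
        also have "1 / dist x y ^ ?d * (C * (s y / dist x y)) = C * (s y / dist x y / dist x y ^ ?d)"
          by simp
        also have "ennreal \<dots> = ennreal C * ennreal (s y / dist x y / dist x y ^ ?d)"
          using C0 by (rule ennreal_mult')
        finally show ?thesis using True by (simp add: mult_ac)
      qed simp
    qed auto
    also have "\<dots> = 2 * (ennreal C * (\<integral>\<^sup>+y\<in>U i. ennreal (s y / dist x y / dist x y ^ ?d) * h y \<partial>lebesgue))"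
      by (subst nn_integral_cmult) auto
    also have "\<dots> = ennreal (2 * C) * (\<integral>\<^sup>+y\<in>U i. ennreal (s y / dist x y / dist x y ^ ?d) * h y \<partial>lebesgue)"
      using C0 by (simp add: ennreal_mult' mult_ac)
    finally show ?thesis .
  qed
  let ?g = "\<lambda>y. ennreal (s y / dist x y / dist x y ^ ?d) * h y"
  have "(\<Sum>i<N. (\<integral>\<^sup>+y\<in>U i. w y \<partial>lebesgue)\<^sup>2) \<le> (\<Sum>i<N. ennreal (2 * C) * (\<integral>\<^sup>+y\<in>U i. ?g y \<partial>lebesgue))"
    by (intro sum_mono one) auto
  also have "\<dots> = ennreal (2 * C) * (\<Sum>i<N. emeasure (density lebesgue ?g) (U i))"
    unfolding sum_distrib_left by (intro sum.cong refl) (simp add: emeasure_density U)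
  also have "(\<Sum>i<N. emeasure (density lebesgue ?g) (U i)) = emeasure (density lebesgue ?g) (\<Union>i<N. U i)"
    using U disj by (intro sum_emeasure) (auto simp: image_subset_iff)
  also have "\<dots> = (\<integral>\<^sup>+y\<in>(\<Union>i<N. U i). ?g y \<partial>lebesgue)"
    using U by (intro emeasure_density sets.finite_UN) auto
  finally show ?thesis unfolding w_def C_def by (simp only: mult.assoc)
qed

subsection \<open>Variation of sums\<close>

text \<open>The difference of two consecutive truncation domains; the strict inequality in
  \<open>trunc_op\<close> dictates which sphere is included.\<close>

definition annulus :: "(nat \<Rightarrow> real) \<Rightarrow> 'a::euclidean_space \<Rightarrow> nat \<Rightarrow> 'a set" where
  "annulus e x i = {y. e (Suc i) < dist x y \<and> dist x y \<le> e i}"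

lemma annulus_sets [measurable]: "annulus e x i \<in> sets lebesgue"
proof -
  have "annulus e x i = {y. e (Suc i) < dist x y} \<inter> {y. dist x y \<le> e i}"
    by (auto simp: annulus_def)
  moreover have "open {y. e (Suc i) < dist x y}" "closed {y. dist x y \<le> e i}"
    by (intro open_Collect_less closed_Collect_le continuous_intros)+
  ultimately show ?thesis by (simp add: borel_open borel_closed sets.Int)
qed

lemma disjoint_annulus:
  assumes "e \<in> null_decr_seqs"
  shows "disjoint_family (annulus e (x::'a::euclidean_space))"
proof -
  have *: "annulus e x i \<inter> annulus e x j = {}" if "i < j" for i j
  proof -
    have "e j \<le> e (Suc i)" using assms that by (auto simp: null_decr_seqs_def decseq_def)
    then show ?thesis by (auto simp: annulus_def)
  qed
  then show ?thesis unfolding disjoint_family_on_def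
    by (metis inf_commute linorder_neqE_nat)
qed

text \<open>Common final step of both variation estimates: one absolutely summable part and two
  square summable parts, one for each boundary sphere or each side of a shift. The majorants are
  extended nonnegative integrals, so their finiteness is a consequence and not a
  prerequisite.\<close>

lemma lnorm_le_ennreal:
  assumes \<rho>: "2 \<le> \<rho>" and P: "0 \<le> P1" "0 \<le> P2" "0 \<le> P3"
    and le: "\<And>i. i < N \<Longrightarrow> ennreal \<bar>v i\<bar> \<le> \<alpha> i + \<beta> i + \<gamma> i"
    and 1: "(\<Sum>i<N. \<alpha> i) \<le> ennreal P1"
    and 2: "(\<Sum>i<N. (\<beta> i)\<^sup>2) \<le> ennreal (P2\<^sup>2)"
    and 3: "(\<Sum>i<N. (\<gamma> i)\<^sup>2) \<le> ennreal (P3\<^sup>2)"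
  shows "lnorm \<rho> N v \<le> P1 + P2 + P3"
proof -
  have fin1: "\<alpha> i < top" if "i < N" for i
  proof -
    have "\<alpha> i \<le> (\<Sum>i<N. \<alpha> i)" using that by (intro member_le_sum) auto
    then show ?thesis using 1 by (meson ennreal_less_top le_less_trans)
  qed
  have fin2: "f i < top" if "i < N" "(\<Sum>i<N. (f i)\<^sup>2) \<le> ennreal (P\<^sup>2)" for f :: "nat \<Rightarrow> ennreal" and P i
  proof -
    have "(f i)\<^sup>2 \<le> (\<Sum>i<N. (f i)\<^sup>2)" using that by (intro member_le_sum) auto
    then have "(f i)\<^sup>2 < top" using that by (meson ennreal_less_top le_less_trans)
    then show ?thesis by (auto simp: power2_eq_square ennreal_mult_less_top less_top)
  qed
  define a where "a i = enn2real (\<alpha> i)" for i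
  define b where "b i = enn2real (\<beta> i)" for i
  define c where "c i = enn2real (\<gamma> i)" for i
  have nn: "0 \<le> a i" "0 \<le> b i" "0 \<le> c i" for i by (simp_all add: a_def b_def c_def)
  have ea: "ennreal (a i) = \<alpha> i" if "i < N" for i using fin1[OF that] by (simp add: a_def)
  have eb: "ennreal (b i) = \<beta> i" if "i < N" for i using fin2[OF that 2] by (simp add: b_def)
  have ec: "ennreal (c i) = \<gamma> i" if "i < N" for i using fin2[OF that 3] by (simp add: c_def)
  have v: "\<bar>v i\<bar> \<le> a i + b i + c i" if "i < N" for i
  proof -
    have "ennreal \<bar>v i\<bar> \<le> ennreal (a i) + ennreal (b i) + ennreal (c i)"
      using le[OF that] by (simp add: ea eb ec that)
    also have "\<dots> = ennreal (a i + b i + c i)" using nn by (simp add: ennreal_plus)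
    finally show ?thesis using nn[of i] by (subst (asm) ennreal_le_iff) auto
  qed
  have "(\<Sum>i<N. \<bar>a i\<bar>) \<le> P1"
  proof -
    have "ennreal (\<Sum>i<N. a i) = (\<Sum>i<N. \<alpha> i)"
      using nn by (subst sum_ennreal[symmetric]) (auto simp: ea)
    then have "ennreal (\<Sum>i<N. a i) \<le> ennreal P1" using 1 by simp
    then show ?thesis using P nn by (simp add: ennreal_le_iff)
  qed
  then have A: "lnorm \<rho> N a \<le> P1" using lnorm_le_sum[of \<rho> N a] \<rho> by simp
  have sq: "(\<Sum>i<N. (f i)\<^sup>2) \<le> P\<^sup>2"
    if "\<And>i. 0 \<le> f i" "\<And>i. i < N \<Longrightarrow> ennreal (f i) = g i" "(\<Sum>i<N. (g i)\<^sup>2) \<le> ennreal (P\<^sup>2)"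
    for f g and P :: real
  proof -
    have "ennreal (\<Sum>i<N. (f i)\<^sup>2) = (\<Sum>i<N. ennreal ((f i)\<^sup>2))"
      by (subst sum_ennreal) auto
    also have "\<dots> = (\<Sum>i<N. (g i)\<^sup>2)"
      by (intro sum.cong refl) (simp add: that(1) that(2)[symmetric] ennreal_power)
    finally have "ennreal (\<Sum>i<N. (f i)\<^sup>2) \<le> ennreal (P\<^sup>2)" using that(3) by simp
    then show ?thesis by (simp add: ennreal_le_iff)
  qed
  have B: "lnorm \<rho> N b \<le> P2" using \<rho> P sq[OF nn(2) eb 2] by (intro lnorm_le_l2) auto
  have C: "lnorm \<rho> N c \<le> P3" using \<rho> P sq[OF nn(3) ec 3] by (intro lnorm_le_l2) auto
  have "lnorm \<rho> N v \<le> lnorm \<rho> N (\<lambda>i. (a i + b i) + c i)"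
    using \<rho> v nn by (intro lnorm_mono) (auto simp: abs_of_nonneg)
  also have "\<dots> \<le> lnorm \<rho> N a + lnorm \<rho> N b + lnorm \<rho> N c"
    using lnorm_triangle[of \<rho> N "\<lambda>i. a i + b i" c] lnorm_triangle[of \<rho> N a b] \<rho> by simp
  finally show ?thesis using A B C by simp
qed

text \<open>Cancellation takes place cube by cube, so the absolute value may enter only after
  integrating over one cube. Finite unions are summed, and the integral of \<open>k\<close> is
  continuous along their increasing limit.\<close>

lemma integral_Union_le:
  fixes k :: "'a \<Rightarrow> real" and G :: "'a \<Rightarrow> ennreal"
  assumes J: "countable J" "J \<subseteq> sets M" "disjoint J"
    and k: "integrable M k" "\<And>y. y \<notin> \<Union>J \<Longrightarrow> k y = 0"
    and [measurable]: "G \<in> borel_measurable M"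
    and le: "\<And>Q. Q \<in> J \<Longrightarrow> ennreal \<bar>LINT y:Q|M. k y\<bar> \<le> (\<integral>\<^sup>+y\<in>Q. G y \<partial>M)"
  shows "ennreal \<bar>LINT y|M. k y\<bar> \<le> (\<integral>\<^sup>+y\<in>\<Union>J. G y \<partial>M)"
proof -
  \<comment> \<open>An enumeration padded with empty sets, so that finite and infinite families are
    handled alike.\<close>
  define B where "B n = (if n \<in> to_nat_on J ` J then from_nat_into J n else {})" for n
  have BJ: "B n \<in> J" if "B n \<noteq> {}" for n
  proof -
    have "n \<in> to_nat_on J ` J" using that unfolding B_def by metis
    then show ?thesis using from_nat_into[of J n] unfolding B_def by auto
  qed
  have Bm [measurable]: "B n \<in> sets M" for n using BJ[of n] J(2) by (cases "B n = {}") auto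
  have UB: "(\<Union>n. B n) = \<Union>J"
  proof (intro equalityI subsetI)
    fix y assume "y \<in> (\<Union>n. B n)" then show "y \<in> \<Union>J" using BJ by blast
  next
    fix y assume "y \<in> \<Union>J"
    then obtain Q where "Q \<in> J" "y \<in> Q" by blast
    then have "y \<in> B (to_nat_on J Q)" using J(1) by (simp add: B_def)
    then show "y \<in> (\<Union>n. B n)" by blast
  qed
  have Bd: "disjoint_family B"
    unfolding disjoint_family_on_def
  proof (intro ballI impI)
    fix m n :: nat assume mn: "m \<noteq> n"
    show "B m \<inter> B n = {}"
    proof (cases "m \<in> to_nat_on J ` J \<and> n \<in> to_nat_on J ` J")
      case True
      then obtain P Q where PQ: "P \<in> J" "Q \<in> J" "m = to_nat_on J P" "n = to_nat_on J Q" by blast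
      then have "B m = P" "B n = Q" using J(1) by (auto simp: B_def)
      moreover have "P \<noteq> Q" using PQ mn by blast
      ultimately show ?thesis using J(3) PQ by (auto simp: disjoint_def)
    qed (auto simp: B_def)
  qed
  have leB: "ennreal \<bar>LINT y:B n|M. k y\<bar> \<le> (\<integral>\<^sup>+y\<in>B n. G y \<partial>M)" for n
    using le BJ[of n] by (cases "B n = {}") (auto simp: set_lebesgue_integral_def)
  have sk: "set_integrable M A k" if "A \<in> sets M" for A
    using k(1) that unfolding set_integrable_def by (rule integrable_mult_indicator[rotated])
  define S where "S m = (\<Union>n<m. B n)" for m
  have part: "ennreal \<bar>LINT y:S m|M. k y\<bar> \<le> (\<integral>\<^sup>+y\<in>\<Union>J. G y \<partial>M)" for m
  proof -
    have "(LINT y:S m|M. k y) = (\<Sum>n<m. LINT y:B n|M. k y)"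
      unfolding S_def using Bd sk by (intro set_integral_finite_Union) (auto simp: disjoint_family_on_def)
    then have "ennreal \<bar>LINT y:S m|M. k y\<bar> \<le> ennreal (\<Sum>n<m. \<bar>LINT y:B n|M. k y\<bar>)"
      by (simp add: ennreal_leI sum_abs)
    also have "\<dots> = (\<Sum>n<m. ennreal \<bar>LINT y:B n|M. k y\<bar>)" by (simp add: sum_ennreal)
    also have "\<dots> \<le> (\<Sum>n<m. emeasure (density M G) (B n))"
      using leB by (intro sum_mono) (simp add: emeasure_density)
    also have "\<dots> = emeasure (density M G) (S m)"
      unfolding S_def using Bd by (intro sum_emeasure) (auto simp: disjoint_family_on_def)
    also have "\<dots> \<le> emeasure (density M G) (\<Union>J)"
      using UB Bm by (intro emeasure_mono) (auto simp: S_def simp flip: UB)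
    also have "\<dots> = (\<integral>\<^sup>+y\<in>\<Union>J. G y \<partial>M)"
      by (subst emeasure_density) (auto simp flip: UB)
    finally show ?thesis .
  qed
  have "(\<lambda>m. LINT y:S m|M. k y) \<longlonglongrightarrow> (LINT y:(\<Union>m. S m)|M. k y)"
  proof (intro set_integral_cont_up sk)
    show "S m \<in> sets M" for m unfolding S_def by (intro sets.finite_UN) auto
    then show "(\<Union>m. S m) \<in> sets M" by (intro sets.countable_UN) auto
    show "incseq S" unfolding S_def by (intro monoI UN_mono) auto
  qed
  moreover have "(\<Union>m. S m) = \<Union>J" unfolding UB[symmetric] S_def by auto
  moreover have "(LINT y:\<Union>J|M. k y) = (LINT y|M. k y)"
    unfolding set_lebesgue_integral_def using k(2) by (intro Bochner_Integration.integral_cong) (auto simp: indicator_def)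
  ultimately have "(\<lambda>m. ennreal \<bar>LINT y:S m|M. k y\<bar>) \<longlonglongrightarrow> ennreal \<bar>LINT y|M. k y\<bar>"
    by (intro tendsto_ennrealI tendsto_rabs) simp
  then show ?thesis by (rule LIMSEQ_le_const2) (use part in auto)
qed

text \<open>The modulus is monotone on the whole real line, which also makes it measurable.
  \<open>\<eta>_ge\<close> lets the linear size ratios of the crossing terms be absorbed by \<eta>,
  and \<open>\<eta>_mult\<close> is subadditivity in the form in which dilations by d and by d + 1
  use it.\<close>

locale variation_kernel =
  fixes K :: "'a::euclidean_space \<Rightarrow> 'a \<Rightarrow> real" and \<eta> :: "real \<Rightarrow> real" and C \<rho> :: real
  assumes K_measurable [measurable]: "K x \<in> borel_measurable lebesgue"
    and C_pos: "0 < C"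
    and size: "x \<noteq> y \<Longrightarrow> \<bar>K x y\<bar> \<le> C / dist x y ^ DIM('a)"
    and smooth_left: "x \<noteq> y \<Longrightarrow> dist x x' \<le> dist x y / 2 \<Longrightarrow>
      \<bar>K x y - K x' y\<bar> \<le> C * \<eta> (dist x x' / dist x y) / dist x y ^ DIM('a)"
    and smooth_right: "x \<noteq> y \<Longrightarrow> dist x x' \<le> dist x y / 2 \<Longrightarrow>
      \<bar>K y x - K y x'\<bar> \<le> C * \<eta> (dist x x' / dist x y) / dist x y ^ DIM('a)"
    and \<eta>_mono: "s \<le> t \<Longrightarrow> \<eta> s \<le> \<eta> t"
    and \<eta>_nonneg: "0 \<le> \<eta> t"
    and \<eta>_ge: "t \<le> \<eta> t"
    and \<eta>_mult: "0 \<le> t \<Longrightarrow> \<eta> (real n * t) \<le> real n * \<eta> t"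
    and \<eta>_summable: "summable (\<lambda>k::nat. \<eta> (1 / 2 ^ k))"
    and \<rho>_ge: "2 \<le> \<rho>"
begin

abbreviation V where "V \<equiv> var_op K \<rho>"

lemma \<eta>_measurable [measurable]: "\<eta> \<in> borel_measurable borel"
  by (rule borel_measurable_mono) (auto simp: mono_def \<eta>_mono)

lemma K_integrable_outside:
  assumes "0 < e" and h: "integrable lebesgue h"
  shows "set_integrable lebesgue {y. e < dist x y} (\<lambda>y. K x y * h y)"
  unfolding set_integrable_def
proof (rule Bochner_Integration.integrable_bound)
  have [measurable]: "h \<in> borel_measurable lebesgue" using h by simp
  have "open {y. e < dist x y}" by (intro open_Collect_less continuous_intros)
  then have [measurable]: "{y. e < dist x y} \<in> sets lebesgue" by (simp add: borel_open)
  show "integrable lebesgue (\<lambda>y. C / e ^ DIM('a) * h y)" using h by simp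
  show "(\<lambda>y. indicat_real {y. e < dist x y} y *\<^sub>R (K x y * h y)) \<in> borel_measurable lebesgue"
    by measurable
  show "AE y in lebesgue. norm (indicat_real {y. e < dist x y} y *\<^sub>R (K x y * h y)) \<le> norm (C / e ^ DIM('a) * h y)"
  proof (intro AE_I2)
    fix y
    have "\<bar>K x y\<bar> \<le> C / e ^ DIM('a)" if "e < dist x y"
    proof -
      have "\<bar>K x y\<bar> \<le> C / dist x y ^ DIM('a)" using that assms by (intro size) auto
      also have "\<dots> \<le> C / e ^ DIM('a)" using that assms C_pos by (intro divide_left_mono power_mono mult_pos_pos zero_less_power) auto
      finally show ?thesis .
    qed
    then have "\<bar>K x y\<bar> * \<bar>h y\<bar> \<le> C / e ^ DIM('a) * \<bar>h y\<bar>" if "e < dist x y"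
      using that by (intro mult_right_mono) auto
    then show "norm (indicat_real {y. e < dist x y} y *\<^sub>R (K x y * h y)) \<le> norm (C / e ^ DIM('a) * h y)"
      using assms C_pos by (auto simp: indicator_def abs_mult)
  qed
qed

lemma K_integrable_annulus:
  assumes e: "e \<in> null_decr_seqs" and h: "integrable lebesgue h" and A: "A \<in> sets lebesgue" "A \<subseteq> annulus e x i"
  shows "set_integrable lebesgue A (\<lambda>y. K x y * h y)"
proof (rule set_integrable_subset)
  show "set_integrable lebesgue {y. e (Suc i) < dist x y} (\<lambda>y. K x y * h y)"
    using e h by (intro K_integrable_outside) (auto simp: null_decr_seqs_def)
qed (use A in \<open>auto simp: annulus_def\<close>)

lemma incr_eq:
  assumes e: "e \<in> null_decr_seqs" and h: "integrable lebesgue h"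
  shows "incr K e h x i = (LINT y:annulus e x i|lebesgue. K x y * h y)"
proof -
  have le: "e (Suc i) \<le> e i" "0 < e i" using e by (auto simp: null_decr_seqs_def decseq_def)
  have un: "{y. e (Suc i) < dist x y} = annulus e x i \<union> {y. e i < dist x y}"
    using le by (auto simp: annulus_def)
  have "trunc_op K (e (Suc i)) h x = (LINT y:annulus e x i|lebesgue. K x y * h y) + trunc_op K (e i) h x"
    unfolding trunc_op_def un
    using e h le by (intro set_integral_Un K_integrable_annulus K_integrable_outside) (auto simp: annulus_def)
  then show ?thesis by (simp add: incr_def)
qed

lemma trunc_op_add:
  assumes "0 < e" "integrable lebesgue f" "integrable lebesgue g"
  shows "trunc_op K e (\<lambda>y. f y + g y) x = trunc_op K e f x + trunc_op K e g x"
  unfolding trunc_op_def distrib_left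
  using assms by (intro set_integral_add K_integrable_outside)

lemma var_op_minus: "V (\<lambda>y. - f y) x = V f x"
proof -
  have "trunc_op K e (\<lambda>y. - f y) x = - trunc_op K e f x" for e
    by (simp add: trunc_op_def set_lebesgue_integral_def)
  then show ?thesis by (simp add: var_op_def abs_minus_commute)
qed

lemma var_op_add_le:
  assumes f: "integrable lebesgue f" and g: "integrable lebesgue g"
  shows "V (\<lambda>y. f y + g y) x \<le> V f x + V g x"
proof (rule var_op_leI)
  fix e N assume e: "e \<in> null_decr_seqs"
  then have "0 < e i" for i by (simp add: null_decr_seqs_def)
  then have "incr K e (\<lambda>y. f y + g y) x = (\<lambda>i. incr K e f x i + incr K e g x i)"
    using f g by (auto simp: incr_def trunc_op_add)
  then have "lnorm \<rho> N (incr K e (\<lambda>y. f y + g y) x) \<le> lnorm \<rho> N (incr K e f x) + lnorm \<rho> N (incr K e g x)"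
    using lnorm_triangle[of \<rho> N "incr K e f x" "incr K e g x"] \<rho>_ge by simp
  then have "ereal (lnorm \<rho> N (incr K e (\<lambda>y. f y + g y) x)) \<le> ereal (lnorm \<rho> N (incr K e f x)) + ereal (lnorm \<rho> N (incr K e g x))"
    by simp
  also have "\<dots> \<le> V f x + V g x"
    by (intro add_mono lnorm_le_var_op e)
  finally show "ereal (lnorm \<rho> N (incr K e (\<lambda>y. f y + g y) x)) \<le> V f x + V g x" .
qed

text \<open>Finiteness of \<open>V f x\<close>, with that of \<open>V\<close> of the difference,
  forces \<open>V g x\<close> to be finite, so no difference of infinities arises.\<close>

lemma var_op_diff_le:
  assumes f: "integrable lebesgue f" and g: "integrable lebesgue g"
    and fin: "V f x \<noteq> \<infinity>" and B: "V (\<lambda>y. f y - g y) x \<le> ereal B"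
  shows "\<bar>V f x - V g x\<bar> \<le> ereal B"
proof -
  let ?h = "\<lambda>y. f y - g y"
  have h: "integrable lebesgue ?h" using f g by simp
  have 1: "V f x \<le> V g x + V ?h x" using var_op_add_le[OF g h, of x] by simp
  have "V g x \<le> V f x + V (\<lambda>y. - ?h y) x"
    using var_op_add_le[of f "\<lambda>y. - ?h y" x] f g by simp
  then have 2: "V g x \<le> V f x + V ?h x" by (simp only: var_op_minus)
  obtain u where u: "V f x = ereal u" using fin var_op_nonneg[of K \<rho> f x] by (cases "V f x") auto
  obtain w where w: "V ?h x = ereal w" "w \<le> B"
    using B var_op_nonneg[of K \<rho> ?h x] by (cases "V ?h x") auto
  obtain v where v: "V g x = ereal v" using 2 var_op_nonneg[of K \<rho> g x] u w by (cases "V g x") auto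
  show ?thesis using 1 2 u v w by auto
qed

end

lemma ennreal_square_sum_le: "(a + b)\<^sup>2 \<le> 4 * a\<^sup>2 + 4 * (b :: ennreal)\<^sup>2"
proof -
  have "(a + b)\<^sup>2 \<le> (2 * max a b)\<^sup>2"
    by (intro power_mono) (auto simp: mult_2 add_mono)
  also have "\<dots> = 4 * (max a b)\<^sup>2" by (simp add: power_mult_distrib)
  also have "\<dots> \<le> 4 * a\<^sup>2 + 4 * b\<^sup>2" by (auto simp: max_def)
  finally show ?thesis .
qed

lemma add_indicator_le: "(a + b + c) * indicator S y \<le> a * indicator S y + b + (c :: ennreal)"
  by (auto simp: indicator_def)

lemma annulus_sum_le:
  fixes N :: nat
  assumes e: "e \<in> null_decr_seqs" and [measurable]: "h \<in> borel_measurable lebesgue"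
  shows "(\<Sum>i<N. \<integral>\<^sup>+y\<in>annulus e x i. h y \<partial>lebesgue) \<le> (\<integral>\<^sup>+y. h y \<partial>lebesgue)"
proof -
  have "(\<Sum>i<N. \<integral>\<^sup>+y\<in>annulus e x i. h y \<partial>lebesgue) = (\<Sum>i<N. emeasure (density lebesgue h) (annulus e x i))"
    by (simp add: emeasure_density)
  also have "\<dots> = emeasure (density lebesgue h) (\<Union>i<N. annulus e x i)"
    using disjoint_annulus[OF e, of x] by (intro sum_emeasure) (auto simp: disjoint_family_on_def)
  also have "\<dots> \<le> emeasure (density lebesgue h) (space (density lebesgue h))"
    by (rule emeasure_space)
  also have "\<dots> = (\<integral>\<^sup>+y. h y \<partial>lebesgue)" by (subst emeasure_density) auto
  finally show ?thesis .
qed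

context variation_kernel
begin

subsection \<open>Sums of atoms\<close>

text \<open>2^d C is the price of evaluating the kernel at a reference point of the atom instead of
  at \<open>y\<close>; the square root undoes the squares in the crossing estimate.\<close>

definition atom_const :: real where
  "atom_const = 2 ^ DIM('a) * C * sqrt (2 ^ (DIM('a) + 3) * shell_const DIM('a) 2)"

lemma atom_const_nonneg: "0 \<le> atom_const"
  using C_pos by (simp add: atom_const_def shell_const_nonneg)

text \<open>\<open>b\<close> is a sum of atoms with mean zero. By \<open>diam\<close> and
  \<open>far\<close> the smoothness of the kernel applies between any two points of one atom.
  \<Lambda> bounds the mean of \<bar>b\<bar> on each atom and \<open>P\<close> the potential at
  \<open>x\<close>.\<close>

context
  fixes J :: "'a set set" and b :: "'a \<Rightarrow> real" and s :: "'a \<Rightarrow> real" and x :: 'a and \<Lambda> P :: real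
  assumes J: "countable J" "J \<subseteq> sets lebesgue" "disjoint J"
    and b: "integrable lebesgue b" "\<And>y. y \<notin> \<Union>J \<Longrightarrow> b y = 0"
    and s_meas [measurable]: "s \<in> borel_measurable lebesgue"
    and s_pos: "\<And>y. y \<in> \<Union>J \<Longrightarrow> 0 < s y"
    and s_const: "\<And>Q y z. Q \<in> J \<Longrightarrow> y \<in> Q \<Longrightarrow> z \<in> Q \<Longrightarrow> s y = s z"
    and diam: "\<And>Q y z. Q \<in> J \<Longrightarrow> y \<in> Q \<Longrightarrow> z \<in> Q \<Longrightarrow> dist y z \<le> s y / 2"
    and far: "\<And>y. y \<in> \<Union>J \<Longrightarrow> s y \<le> dist x y"
    and cancel: "\<And>Q. Q \<in> J \<Longrightarrow> (LINT y:Q|lebesgue. b y) = 0"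
    and mass: "\<And>Q. Q \<in> J \<Longrightarrow> (\<integral>\<^sup>+y\<in>Q. ennreal \<bar>b y\<bar> \<partial>lebesgue) \<le> ennreal \<Lambda> * emeasure lebesgue Q"
    and \<Lambda>: "0 \<le> \<Lambda>" and P: "0 \<le> P"
    and \<Phi>: "(\<integral>\<^sup>+y\<in>\<Union>J. ennreal (\<eta> (s y / dist x y) / dist x y ^ DIM('a) * \<bar>b y\<bar>) \<partial>lebesgue) \<le> ennreal P"
begin

lemma atoms_sum_measurable [measurable]: "b \<in> borel_measurable lebesgue"
  using b by simp

lemma atoms_Union_sets [measurable]: "\<Union>J \<in> sets lebesgue"
  using J by (intro sets.countable_Union) auto

text \<open>A measurable set that catches the points of an annulus whose atom is cut by the sphere
  of radius \<open>r\<close>. The condition \<open>s y \<le> r\<close>, together with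
  \<open>far\<close>, keeps \<open>r\<close> and the distance comparable.\<close>

definition crossing :: "(nat \<Rightarrow> real) \<Rightarrow> real \<Rightarrow> nat \<Rightarrow> 'a set" where
  "crossing e r i = annulus e x i \<inter> \<Union>J \<inter> {y \<in> space lebesgue. \<bar>dist x y - r\<bar> \<le> s y \<and> s y \<le> r}"

lemma crossing_sets [measurable]: "crossing e r i \<in> sets lebesgue"
  unfolding crossing_def by measurable

text \<open>Passing to whole atoms: those of size at most \<open>t\<close> that meet the region stay
  in a shell of half-width \<open>2 * t\<close>, and on each of them the mean of \<bar>b\<bar> is at
  most \<Lambda>.\<close>

lemma crossing_mass:
  assumes r: "0 < r" and t: "0 < t" "t \<le> r"
  shows "(\<integral>\<^sup>+y\<in>{y \<in> crossing e r i. s y \<le> t}. ennreal \<bar>b y\<bar> \<partial>lebesgue)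
    \<le> ennreal (2 * \<Lambda> * shell_const DIM('a) 2 * t * r ^ (DIM('a) - 1))"
proof -
  let ?S = "{y \<in> crossing e r i. s y \<le> t}"
  define J' where "J' = {Q \<in> J. Q \<inter> ?S \<noteq> {}}"
  have J': "countable J'" "J' \<subseteq> sets lebesgue" "disjoint J'"
    using J by (auto simp: J'_def disjoint_def intro: countable_subset)
  have UJ': "\<Union>J' \<in> sets lebesgue" using J' by (intro sets.countable_Union) auto
  have sub: "\<Union>J' \<subseteq> {z. \<bar>dist x z - r\<bar> \<le> 2 * t}"
  proof
    fix z assume "z \<in> \<Union>J'"
    then obtain Q y where Q: "Q \<in> J" "z \<in> Q" "y \<in> Q" "y \<in> ?S" by (auto simp: J'_def)
    then have "\<bar>dist x y - r\<bar> \<le> t" "dist y z \<le> t" using diam[OF Q(1,3,2)] t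
      by (auto simp: crossing_def)
    moreover have "\<bar>dist x z - dist x y\<bar> \<le> dist y z"
      by (metis abs_dist_diff_le dist_commute)
    ultimately show "z \<in> {z. \<bar>dist x z - r\<bar> \<le> 2 * t}" by auto
  qed
  have "(\<integral>\<^sup>+y\<in>?S. ennreal \<bar>b y\<bar> \<partial>lebesgue) \<le> (\<integral>\<^sup>+y\<in>\<Union>J'. ennreal \<bar>b y\<bar> \<partial>lebesgue)"
    by (intro nn_integral_mono) (auto simp: J'_def indicator_def crossing_def)
  also have "\<dots> \<le> (\<integral>\<^sup>+y\<in>\<Union>J'. ennreal \<Lambda> \<partial>lebesgue)"
  proof (intro nn_integral_Union_mono J')
    fix Q assume "Q \<in> J'"
    then have "Q \<in> J" by (simp add: J'_def)
    then show "(\<integral>\<^sup>+y\<in>Q. ennreal \<bar>b y\<bar> \<partial>lebesgue) \<le> (\<integral>\<^sup>+y\<in>Q. ennreal \<Lambda> \<partial>lebesgue)"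
      using mass[of Q] J by (auto simp: nn_integral_cmult_indicator)
  qed auto
  also have "\<dots> = ennreal \<Lambda> * emeasure lebesgue (\<Union>J')"
    using UJ' by (rule nn_integral_cmult_indicator)
  also have "\<dots> \<le> ennreal \<Lambda> * emeasure lebesgue {z. \<bar>dist x z - r\<bar> \<le> 2 * t}"
  proof (intro mult_left_mono emeasure_mono sub)
    have "closed {z. \<bar>dist x z - r\<bar> \<le> 2 * t}" by (intro closed_Collect_le continuous_intros)
    then show "{z. \<bar>dist x z - r\<bar> \<le> 2 * t} \<in> sets lebesgue" by (simp add: borel_closed)
  qed auto
  also have "\<dots> \<le> ennreal \<Lambda> * ennreal (shell_const DIM('a) 2 * (2 * t) * r ^ (DIM('a) - 1))"
    using r t by (intro mult_left_mono emeasure_shell_le) auto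
  also have "\<dots> = ennreal (2 * \<Lambda> * shell_const DIM('a) 2 * t * r ^ (DIM('a) - 1))"
    using \<Lambda> by (simp add: ennreal_mult'[symmetric] mult_ac)
  finally show ?thesis .
qed

text \<open>\<open>sphere_crossing\<close> with \<kappa> = 1. The ratio
  \<open>s y / dist x y\<close> that it produces is at most its \<eta>, so the right-hand integral
  is part of the potential.\<close>

lemma crossing_sum:
  fixes N :: nat
  assumes e: "e \<in> null_decr_seqs"
  shows "(\<Sum>i<N. (\<integral>\<^sup>+y\<in>crossing e (r i) i. ennreal (1 / dist x y ^ DIM('a)) * ennreal \<bar>b y\<bar> \<partial>lebesgue)\<^sup>2)
    \<le> ennreal (2 ^ (DIM('a) + 3) * shell_const DIM('a) 2 * \<Lambda> * P)"
proof -
  have "(\<Sum>i<N. (\<integral>\<^sup>+y\<in>crossing e (r i) i. ennreal (1 / dist x y ^ DIM('a)) * ennreal \<bar>b y\<bar> \<partial>lebesgue)\<^sup>2)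
     \<le> ennreal (2 * (1 + 1) ^ Suc DIM('a) * (2 * \<Lambda> * shell_const DIM('a) 2)) *
        (\<integral>\<^sup>+y\<in>(\<Union>i<N. crossing e (r i) i). ennreal (s y / dist x y / dist x y ^ DIM('a)) * ennreal \<bar>b y\<bar> \<partial>lebesgue)"
  proof (rule sphere_crossing)
    show "disjoint_family_on (\<lambda>i. crossing e (r i) i) {..<N}"
      using disjoint_annulus[OF e, of x] unfolding disjoint_family_on_def crossing_def by blast
    show "0 \<le> 2 * \<Lambda> * shell_const DIM('a) 2" using \<Lambda> by (simp add: shell_const_nonneg)
    fix i y assume "y \<in> crossing e (r i) i"
    then show "0 < s y \<and> \<bar>dist x y - r i\<bar> \<le> s y \<and> s y \<le> 1 * r i \<and> s y \<le> 1 * dist x y"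
      using s_pos[of y] far[of y] by (simp add: crossing_def)
  next
    fix i t assume "0 < r i" "0 < t" "t \<le> 1 * r i"
    then show "(\<integral>\<^sup>+y\<in>{y \<in> crossing e (r i) i. s y \<le> t}. ennreal \<bar>b y\<bar> \<partial>lebesgue)
        \<le> ennreal (2 * \<Lambda> * shell_const DIM('a) 2 * t * r i ^ (DIM('a) - 1))"
      by (intro crossing_mass) auto
  qed (auto simp: crossing_sets)
  also have "(\<integral>\<^sup>+y\<in>(\<Union>i<N. crossing e (r i) i). ennreal (s y / dist x y / dist x y ^ DIM('a)) * ennreal \<bar>b y\<bar> \<partial>lebesgue)
     \<le> (\<integral>\<^sup>+y\<in>\<Union>J. ennreal (\<eta> (s y / dist x y) / dist x y ^ DIM('a) * \<bar>b y\<bar>) \<partial>lebesgue)"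
  proof (intro nn_integral_mono)
    fix y
    have "s y / dist x y / dist x y ^ DIM('a) * \<bar>b y\<bar> \<le> \<eta> (s y / dist x y) / dist x y ^ DIM('a) * \<bar>b y\<bar>"
      by (intro mult_right_mono divide_right_mono \<eta>_ge) auto
    then have "ennreal (s y / dist x y / dist x y ^ DIM('a)) * ennreal \<bar>b y\<bar> \<le> ennreal (\<eta> (s y / dist x y) / dist x y ^ DIM('a) * \<bar>b y\<bar>)"
      by (subst ennreal_mult''[symmetric]) (auto intro: ennreal_leI)
    then show "ennreal (s y / dist x y / dist x y ^ DIM('a)) * ennreal \<bar>b y\<bar> * indicator (\<Union>i<N. crossing e (r i) i) y
      \<le> ennreal (\<eta> (s y / dist x y) / dist x y ^ DIM('a) * \<bar>b y\<bar>) * indicator (\<Union>J) y"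
      by (auto simp: indicator_def crossing_def)
  qed
  also note \<Phi>
  also have "ennreal (2 * (1 + 1) ^ Suc DIM('a) * (2 * \<Lambda> * shell_const DIM('a) 2)) * ennreal P
      = ennreal (2 ^ (DIM('a) + 3) * shell_const DIM('a) 2 * \<Lambda> * P)"
    using P by (subst ennreal_mult''[symmetric]) (auto simp: power_add mult_ac)
  finally show ?thesis by (simp add: mult_left_mono)
qed

text \<open>With a point \<open>c\<close> of the atom, K x y is split into K x y - K x c and K x c.
  Smoothness controls the first part. The second integrates to zero when the atom lies inside the
  annulus, so it survives only for atoms that are cut by the outer or the inner sphere.\<close>

lemma atom_increment:
  assumes e: "e \<in> null_decr_seqs" and Q: "Q \<in> J"
  shows "ennreal \<bar>LINT y:Q|lebesgue. indicator (annulus e x i) y * (K x y * b y)\<bar>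
    \<le> (\<integral>\<^sup>+y\<in>Q. ennreal C * (ennreal (\<eta> (s y / dist x y) / dist x y ^ DIM('a) * \<bar>b y\<bar>) * indicator (annulus e x i) y)
        + ennreal (2 ^ DIM('a) * C) * (ennreal (1 / dist x y ^ DIM('a)) * ennreal \<bar>b y\<bar> * indicator (crossing e (e i) i) y)
        + ennreal (2 ^ DIM('a) * C) * (ennreal (1 / dist x y ^ DIM('a)) * ennreal \<bar>b y\<bar> * indicator (crossing e (e (Suc i)) i) y) \<partial>lebesgue)"
    (is "_ \<le> (\<integral>\<^sup>+y\<in>Q. ?G1 y + ?G2 y + ?G3 y \<partial>lebesgue)")
proof (cases "Q = {}")
  case False
  then obtain c where c: "c \<in> Q" by blast
  have Qm [measurable]: "Q \<in> sets lebesgue" using Q J by auto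
  let ?A = "annulus e x i"
  let ?d = "DIM('a)"
  define k1 where "k1 y = indicator (Q \<inter> ?A) y * ((K x y - K x c) * b y)" for y
  define k2 where "k2 y = K x c * (indicator (Q \<inter> ?A) y * b y)" for y
  have QA: "Q \<inter> ?A \<in> sets lebesgue" by simp
  have i2: "integrable lebesgue k2"
    unfolding k2_def using integrable_mult_indicator[OF QA b(1)] by (simp add: real_scaleR_def)
  have i0: "integrable lebesgue (\<lambda>y. indicator (Q \<inter> ?A) y * (K x y * b y))"
    using K_integrable_annulus[OF e b(1) QA, of x i] by (simp add: set_integrable_def)
  have i1: "integrable lebesgue k1"
  proof -
    have "k1 = (\<lambda>y. indicator (Q \<inter> ?A) y * (K x y * b y) - k2 y)"
      by (auto simp: k1_def k2_def algebra_simps)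
    then show ?thesis using i0 i2 by simp
  qed
  have "(LINT y:Q|lebesgue. indicator ?A y * (K x y * b y)) = (LINT y|lebesgue. k1 y + k2 y)"
    unfolding set_lebesgue_integral_def
    by (intro Bochner_Integration.integral_cong) (auto simp: k1_def k2_def indicator_def algebra_simps)
  also have "\<dots> = (LINT y|lebesgue. k1 y) + (LINT y|lebesgue. k2 y)"
    using i1 i2 by simp
  finally have split: "ennreal \<bar>LINT y:Q|lebesgue. indicator ?A y * (K x y * b y)\<bar>
      \<le> ennreal \<bar>LINT y|lebesgue. k1 y\<bar> + ennreal \<bar>LINT y|lebesgue. k2 y\<bar>"
    by (simp add: ennreal_plus[symmetric] ennreal_leI del: ennreal_plus)
  have pos: "0 < dist x y" if "y \<in> Q" for y
    using far[of y] s_pos[of y] that Q by fastforce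
  have k1_le: "ennreal \<bar>k1 y\<bar> \<le> ?G1 y * indicator Q y" for y
  proof (cases "y \<in> Q \<inter> ?A")
    case True
    then have y: "y \<in> Q" "y \<noteq> x" using pos[of y] by auto
    have dc: "dist y c \<le> s y / 2" using diam[OF Q y(1) c] .
    have sd: "s y \<le> dist x y" using far[of y] y Q by blast
    have "\<bar>K x y - K x c\<bar> \<le> C * \<eta> (dist y c / dist y x) / dist y x ^ ?d"
      using y dc sd by (intro smooth_right) (auto simp: dist_commute)
    also have "\<dots> \<le> C * \<eta> (s y / dist x y) / dist x y ^ ?d"
    proof -
      have "0 < s y" using s_pos[of y] y Q by blast
      then have "dist y c / dist y x \<le> s y / dist x y"
        using dc pos[OF y(1)] by (simp add: dist_commute divide_right_mono)
      then show ?thesis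
        using C_pos by (simp add: dist_commute divide_right_mono mult_left_mono \<eta>_mono)
    qed
    finally have "\<bar>K x y - K x c\<bar> * \<bar>b y\<bar> \<le> C * \<eta> (s y / dist x y) / dist x y ^ ?d * \<bar>b y\<bar>"
      by (rule mult_right_mono) simp
    then have "\<bar>k1 y\<bar> \<le> C * \<eta> (s y / dist x y) / dist x y ^ ?d * \<bar>b y\<bar>"
      using True by (simp add: k1_def abs_mult)
    then have "ennreal \<bar>k1 y\<bar> \<le> ennreal (C * (\<eta> (s y / dist x y) / dist x y ^ ?d * \<bar>b y\<bar>))"
      by (intro ennreal_leI) simp
    also have "\<dots> = ennreal C * ennreal (\<eta> (s y / dist x y) / dist x y ^ ?d * \<bar>b y\<bar>)"
      using C_pos by (intro ennreal_mult') simp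
    finally show ?thesis using True by simp
  qed (auto simp: k1_def)
  have "ennreal \<bar>LINT y|lebesgue. k1 y\<bar> \<le> (\<integral>\<^sup>+y. ennreal (norm (k1 y)) \<partial>lebesgue)"
    using integral_norm_bound_ennreal[OF i1] by simp
  also have "\<dots> \<le> (\<integral>\<^sup>+y\<in>Q. ?G1 y \<partial>lebesgue)"
    using k1_le by (intro nn_integral_mono) simp
  finally have 1: "ennreal \<bar>LINT y|lebesgue. k1 y\<bar> \<le> (\<integral>\<^sup>+y\<in>Q. ?G1 y \<partial>lebesgue)" .
  have 2: "ennreal \<bar>LINT y|lebesgue. k2 y\<bar> \<le> (\<integral>\<^sup>+y\<in>Q. ?G2 y + ?G3 y \<partial>lebesgue)"
  proof (cases "Q \<subseteq> ?A")
    case True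
    then have "Q \<inter> ?A = Q" by blast
    then have "(LINT y|lebesgue. k2 y) = 0"
      using cancel[OF Q] by (simp add: k2_def set_lebesgue_integral_def)
    then show ?thesis by simp
  next
    case False
    then obtain z where z: "z \<in> Q" "z \<notin> ?A" by blast
    have k2_le: "ennreal \<bar>k2 y\<bar> \<le> (?G2 y + ?G3 y) * indicator Q y" for y
    proof (cases "y \<in> Q \<inter> ?A")
      case True
      then have y: "y \<in> Q" "e (Suc i) < dist x y" "dist x y \<le> e i" by (auto simp: annulus_def)
      have sd: "s y \<le> dist x y" "s y \<le> dist x z" "0 < s y"
        using far[of y] far[of z] s_const[OF Q y(1) z(1)] s_pos[of y] y z Q by auto
      have dz: "dist y z \<le> s y / 2" using diam[OF Q y(1) z(1)] .
      have tri: "dist x y \<le> dist x z + dist y z" "dist x z \<le> dist x y + dist y z"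
        using dist_triangle[of x y z] dist_triangle[of x z y] by (auto simp: dist_commute)
      have "y \<in> crossing e (e i) i \<or> y \<in> crossing e (e (Suc i)) i"
      \<comment> \<open>The position of \<open>z\<close> tells which sphere cuts the atom. For the
        inner sphere, \<open>s y\<close> is at most its radius because \<open>z\<close> too is at
        distance at least \<open>s y\<close> from \<open>x\<close>.\<close>
      proof (cases "dist x z \<le> e (Suc i)")
        case True
        then have "y \<in> crossing e (e (Suc i)) i"
          using y sd dz tri Q \<open>y \<in> Q \<inter> ?A\<close> by (auto simp: crossing_def)
        then show ?thesis ..
      next
        case False
        then have "e i < dist x z" using z by (auto simp: annulus_def)
        then have "y \<in> crossing e (e i) i"
          using y sd dz tri Q \<open>y \<in> Q \<inter> ?A\<close> by (auto simp: crossing_def)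
        then show ?thesis ..
      qed
      then have G: "ennreal (2 ^ ?d * C) * (ennreal (1 / dist x y ^ ?d) * ennreal \<bar>b y\<bar>) \<le> ?G2 y + ?G3 y"
        by (auto simp: indicator_def)
      have xc: "0 < dist x c" "dist x y / 2 \<le> dist x c"
      proof -
        show "0 < dist x c" by (rule pos[OF c])
        have "dist x y \<le> dist x c + dist y c" using dist_triangle[of x y c] by (simp add: dist_commute)
        then show "dist x y / 2 \<le> dist x c" using diam[OF Q y(1) c] sd by simp
      qed
      have "\<bar>K x c\<bar> \<le> C / dist x c ^ ?d" using xc by (intro size) auto
      also have "\<dots> \<le> C / (dist x y / 2) ^ ?d"
        using xc pos[OF y(1)] C_pos by (intro divide_left_mono power_mono mult_pos_pos zero_less_power) auto
      also have "\<dots> = 2 ^ ?d * C * (1 / dist x y ^ ?d)" by (simp add: power_divide)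
      finally have "\<bar>K x c\<bar> * \<bar>b y\<bar> \<le> 2 ^ ?d * C * (1 / dist x y ^ ?d) * \<bar>b y\<bar>"
        by (rule mult_right_mono) simp
      then have "\<bar>k2 y\<bar> \<le> 2 ^ ?d * C * (1 / dist x y ^ ?d) * \<bar>b y\<bar>"
        using True by (simp add: k2_def abs_mult)
      then have "ennreal \<bar>k2 y\<bar> \<le> ennreal (2 ^ ?d * C * (1 / dist x y ^ ?d * \<bar>b y\<bar>))"
        by (intro ennreal_leI) simp
      also have "\<dots> = ennreal (2 ^ ?d * C) * (ennreal (1 / dist x y ^ ?d) * ennreal \<bar>b y\<bar>)"
        using C_pos by (simp add: ennreal_mult'[symmetric] ennreal_mult''[symmetric])
      finally show ?thesis using G True by simp
    qed (auto simp: k2_def)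
    have "ennreal \<bar>LINT y|lebesgue. k2 y\<bar> \<le> (\<integral>\<^sup>+y. ennreal (norm (k2 y)) \<partial>lebesgue)"
      using integral_norm_bound_ennreal[OF i2] by simp
    also have "\<dots> \<le> (\<integral>\<^sup>+y\<in>Q. ?G2 y + ?G3 y \<partial>lebesgue)"
      using k2_le by (intro nn_integral_mono) simp
    finally show ?thesis .
  qed
  have "(\<integral>\<^sup>+y\<in>Q. ?G1 y + ?G2 y + ?G3 y \<partial>lebesgue) = (\<integral>\<^sup>+y. ?G1 y * indicator Q y + (?G2 y + ?G3 y) * indicator Q y \<partial>lebesgue)"
    by (simp add: algebra_simps)
  also have "\<dots> = (\<integral>\<^sup>+y\<in>Q. ?G1 y \<partial>lebesgue) + (\<integral>\<^sup>+y\<in>Q. ?G2 y + ?G3 y \<partial>lebesgue)"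
    by (intro nn_integral_add) measurable
  finally have eq: "(\<integral>\<^sup>+y\<in>Q. ?G1 y + ?G2 y + ?G3 y \<partial>lebesgue)
    = (\<integral>\<^sup>+y\<in>Q. ?G1 y \<partial>lebesgue) + (\<integral>\<^sup>+y\<in>Q. ?G2 y + ?G3 y \<partial>lebesgue)" .
  show ?thesis unfolding eq by (rule order_trans[OF split add_mono[OF 1 2]])
qed (simp add: set_lebesgue_integral_def)

text \<open>The smooth parts sum to at most \<open>C * P\<close> as the annuli are disjoint. Each of
  the two spheres contributes a square summable part of the order of the geometric mean of \<Lambda>
  and \<open>P\<close>.\<close>

lemma var_op_atoms: "V b x \<le> ereal (C * P + 2 * (atom_const * sqrt (\<Lambda> * P)))"
proof (rule var_op_leI)
  fix e N assume e: "e \<in> null_decr_seqs"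
  let ?d = "DIM('a)"
  let ?G1 = "\<lambda>i y. ennreal C * (ennreal (\<eta> (s y / dist x y) / dist x y ^ ?d * \<bar>b y\<bar>) * indicator (annulus e x i) y)"
  let ?H = "\<lambda>r i y. ennreal (1 / dist x y ^ ?d) * ennreal \<bar>b y\<bar> * indicator (crossing e (r i) i) y"
  let ?G2 = "\<lambda>r i y. ennreal (2 ^ ?d * C) * ?H r i y"
  \<comment> \<open>The shifted sequence allows the inner spheres to be treated by the estimate for
    the outer ones.\<close>
  define e' where "e' i = e (Suc i)" for i
  define \<alpha> where "\<alpha> i = (\<integral>\<^sup>+y\<in>\<Union>J. ?G1 i y \<partial>lebesgue)" for i
  define \<beta> where "\<beta> r i = ennreal (2 ^ ?d * C) * (\<integral>\<^sup>+y. ?H r i y \<partial>lebesgue)" for r i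
  have inc: "ennreal \<bar>incr K e b x i\<bar> \<le> \<alpha> i + \<beta> e i + \<beta> e' i" for i
  proof -
    let ?k = "\<lambda>y. indicator (annulus e x i) y * (K x y * b y)"
    have "incr K e b x i = (LINT y|lebesgue. ?k y)"
      using incr_eq[OF e b(1), of x i] by (simp add: set_lebesgue_integral_def)
    then have le1: "ennreal \<bar>incr K e b x i\<bar> = ennreal \<bar>LINT y|lebesgue. ?k y\<bar>" by (rule arg_cong)
    have le2: "ennreal \<bar>LINT y|lebesgue. ?k y\<bar> \<le> (\<integral>\<^sup>+y\<in>\<Union>J. ?G1 i y + ?G2 e i y + ?G2 e' i y \<partial>lebesgue)"
    proof (rule integral_Union_le[OF J])
      show "integrable lebesgue ?k"
        using K_integrable_annulus[OF e b(1) _ order_refl, of x i] by (simp add: set_integrable_def)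
      show "?k y = 0" if "y \<notin> \<Union>J" for y using b(2)[OF that] by simp
      show "ennreal \<bar>LINT y:Q|lebesgue. ?k y\<bar> \<le> (\<integral>\<^sup>+y\<in>Q. ?G1 i y + ?G2 e i y + ?G2 e' i y \<partial>lebesgue)" if "Q \<in> J" for Q
        unfolding e'_def by (rule atom_increment[OF e that])
      show "(\<lambda>y. ?G1 i y + ?G2 e i y + ?G2 e' i y) \<in> borel_measurable lebesgue"
        by measurable
    qed
    have le3: "(\<integral>\<^sup>+y\<in>\<Union>J. ?G1 i y + ?G2 e i y + ?G2 e' i y \<partial>lebesgue)
        \<le> (\<integral>\<^sup>+y. ?G1 i y * indicator (\<Union>J) y + ?G2 e i y + ?G2 e' i y \<partial>lebesgue)"
      by (intro nn_integral_mono add_indicator_le)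
    have eq1: "(\<integral>\<^sup>+y. ?G1 i y * indicator (\<Union>J) y + ?G2 e i y + ?G2 e' i y \<partial>lebesgue)
        = (\<integral>\<^sup>+y. ?G1 i y * indicator (\<Union>J) y \<partial>lebesgue) + (\<integral>\<^sup>+y. ?G2 e i y \<partial>lebesgue)
          + (\<integral>\<^sup>+y. ?G2 e' i y \<partial>lebesgue)"
    proof -
      have m: "(\<lambda>y. ?G1 i y * indicator (\<Union>J) y) \<in> borel_measurable lebesgue"
        "?G2 e i \<in> borel_measurable lebesgue" "?G2 e' i \<in> borel_measurable lebesgue"
        by measurable
      show ?thesis by (simp only: nn_integral_add m borel_measurable_add)
    qed
    have eq2: "(\<integral>\<^sup>+y. ?G1 i y * indicator (\<Union>J) y \<partial>lebesgue) + (\<integral>\<^sup>+y. ?G2 e i y \<partial>lebesgue)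
          + (\<integral>\<^sup>+y. ?G2 e' i y \<partial>lebesgue) = \<alpha> i + \<beta> e i + \<beta> e' i"
    proof -
      have "?H e i \<in> borel_measurable lebesgue" "?H e' i \<in> borel_measurable lebesgue"
        by measurable
      then show ?thesis unfolding \<alpha>_def \<beta>_def by (simp only: nn_integral_cmult)
    qed
    show ?thesis unfolding le1 using order_trans[OF le2 le3] unfolding eq1 eq2 .
  qed
  have A: "(\<Sum>i<N. \<alpha> i) \<le> ennreal (C * P)"
  proof -
    let ?g = "\<lambda>y. ennreal (\<eta> (s y / dist x y) / dist x y ^ ?d * \<bar>b y\<bar>)"
    let ?f = "\<lambda>y. ?g y * indicator (\<Union>J) y"
    have "\<alpha> i = ennreal C * (\<integral>\<^sup>+y\<in>annulus e x i. ?f y \<partial>lebesgue)" for i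
    proof -
      have "\<alpha> i = (\<integral>\<^sup>+y. ennreal C * (?f y * indicator (annulus e x i) y) \<partial>lebesgue)"
        unfolding \<alpha>_def by (simp only: mult_ac)
      also have "\<dots> = ennreal C * (\<integral>\<^sup>+y\<in>annulus e x i. ?f y \<partial>lebesgue)"
        by (rule nn_integral_cmult) measurable
      finally show ?thesis .
    qed
    then have "(\<Sum>i<N. \<alpha> i) = ennreal C * (\<Sum>i<N. \<integral>\<^sup>+y\<in>annulus e x i. ?f y \<partial>lebesgue)"
      by (simp only: sum_distrib_left)
    also have "(\<Sum>i<N. \<integral>\<^sup>+y\<in>annulus e x i. ?f y \<partial>lebesgue) \<le> (\<integral>\<^sup>+y. ?f y \<partial>lebesgue)"
      by (rule annulus_sum_le[OF e]) measurable
    also note \<Phi>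
    also have "ennreal C * ennreal P = ennreal (C * P)" using C_pos by (simp add: ennreal_mult')
    finally show ?thesis by (simp add: mult_left_mono)
  qed
  have B: "(\<Sum>i<N. (\<beta> r i)\<^sup>2) \<le> ennreal ((atom_const * sqrt (\<Lambda> * P))\<^sup>2)" for r
  proof -
    have "(\<Sum>i<N. (\<beta> r i)\<^sup>2) = ennreal ((2 ^ ?d * C)\<^sup>2) * (\<Sum>i<N. (\<integral>\<^sup>+y. ?H r i y \<partial>lebesgue)\<^sup>2)"
      using C_pos by (simp add: \<beta>_def sum_distrib_left power_mult_distrib ennreal_power del: power_mult_distrib[where 'a=real])
    also have "\<dots> \<le> ennreal ((2 ^ ?d * C)\<^sup>2) * ennreal (2 ^ (?d + 3) * shell_const ?d 2 * \<Lambda> * P)"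
      using crossing_sum[OF e, where r=r and N=N] by (intro mult_left_mono) auto
    also have "\<dots> = ennreal ((2 ^ ?d * C)\<^sup>2 * (2 ^ (?d + 3) * shell_const ?d 2 * \<Lambda> * P))"
      by (simp add: ennreal_mult')
    also have "(2 ^ ?d * C)\<^sup>2 * (2 ^ (?d + 3) * shell_const ?d 2 * \<Lambda> * P) = (atom_const * sqrt (\<Lambda> * P))\<^sup>2"
      using \<Lambda> P by (simp add: atom_const_def power_mult_distrib shell_const_nonneg mult_ac)
    finally show ?thesis .
  qed
  have "lnorm \<rho> N (incr K e b x) \<le> C * P + atom_const * sqrt (\<Lambda> * P) + atom_const * sqrt (\<Lambda> * P)"
    using \<rho>_ge C_pos P \<Lambda> atom_const_nonneg by (intro lnorm_le_ennreal[OF _ _ _ _ inc A B B]) auto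
  then show "ereal (lnorm \<rho> N (incr K e b x)) \<le> ereal (C * P + 2 * (atom_const * sqrt (\<Lambda> * P)))"
    by simp
qed

end

subsection \<open>Comparing the variation at two points\<close>

definition radial_const :: real where
  "radial_const = 2 ^ DIM('a) * unit_ball_vol (real DIM('a)) * (\<Sum>k. \<eta> (1 / 2 ^ k))"

lemma radial_const_nonneg: "0 \<le> radial_const"
  unfolding radial_const_def by (intro mult_nonneg_nonneg suminf_nonneg \<eta>_summable) (auto simp: \<eta>_nonneg)

lemma radial_bound:
  fixes c :: 'a
  assumes "0 < L"
  shows "(\<integral>\<^sup>+x\<in>{x. L \<le> dist x c}. ennreal (\<eta> (L / dist x c) / dist x c ^ DIM('a)) \<partial>lebesgue) \<le> ennreal radial_const"
  unfolding radial_const_def using assms \<eta>_mono \<eta>_nonneg \<eta>_summable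
  by (intro nn_integral_radial_le[where \<eta>=\<eta>])

lemma radial_bound_mult:
  fixes x :: 'a
  assumes "0 < L"
  shows "(\<integral>\<^sup>+y\<in>{y. L \<le> dist x y}. ennreal (\<eta> (real n * L / dist x y) / dist x y ^ DIM('a)) \<partial>lebesgue)
    \<le> ennreal (real n * radial_const)"
proof -
  have pt: "ennreal (\<eta> (real n * L / dist x y) / dist x y ^ DIM('a)) \<le> ennreal (real n) * ennreal (\<eta> (L / dist y x) / dist y x ^ DIM('a))" for y
  proof -
    have "\<eta> (real n * (L / dist x y)) \<le> real n * \<eta> (L / dist x y)"
      using assms by (intro \<eta>_mult) auto
    then have "\<eta> (real n * L / dist x y) / dist x y ^ DIM('a) \<le> real n * \<eta> (L / dist x y) / dist x y ^ DIM('a)"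
      by (intro divide_right_mono) auto
    then show ?thesis by (simp add: ennreal_mult'[symmetric] ennreal_leI dist_commute)
  qed
  have "(\<integral>\<^sup>+y\<in>{y. L \<le> dist x y}. ennreal (\<eta> (real n * L / dist x y) / dist x y ^ DIM('a)) \<partial>lebesgue)
    \<le> (\<integral>\<^sup>+y. ennreal (real n) * (ennreal (\<eta> (L / dist y x) / dist y x ^ DIM('a)) * indicator {y. L \<le> dist y x} y) \<partial>lebesgue)"
    using pt by (intro nn_integral_mono) (simp add: indicator_def dist_commute)
  also have "\<dots> = ennreal (real n) * (\<integral>\<^sup>+y\<in>{y. L \<le> dist y x}. ennreal (\<eta> (L / dist y x) / dist y x ^ DIM('a)) \<partial>lebesgue)"
  proof (rule nn_integral_cmult)
    have "closed {y. L \<le> dist y x}" by (intro closed_Collect_le continuous_intros)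
    then have [measurable]: "{y. L \<le> dist y x} \<in> sets lebesgue" by (simp add: borel_closed)
    show "(\<lambda>y. ennreal (\<eta> (L / dist y x) / dist y x ^ DIM('a)) * indicator {y. L \<le> dist y x} y) \<in> borel_measurable lebesgue"
      by measurable
  qed
  also have "\<dots> \<le> ennreal (real n) * ennreal radial_const"
    by (intro mult_left_mono radial_bound assms) auto
  finally show ?thesis by (simp add: ennreal_mult'[symmetric])
qed

definition smooth_const :: real where
  "smooth_const = 2 * C * (1 + (1 + real DIM('a)) ^ DIM('a))"

lemma smooth_const_ge: "C \<le> smooth_const"
  using C_pos by (auto simp: smooth_const_def algebra_simps intro: add_increasing2)

text \<open>When \<open>x'\<close> is too far from \<open>x\<close> for smoothness, the ratio d L /
  dist x y is at least 1/2, hence so is its \<eta>, and the plain size bound already has the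
  required form.\<close>

lemma kernel_difference_le:
  assumes L: "0 < L" and xx': "dist x x' \<le> real DIM('a) * L" and y: "L \<le> dist x y" "L \<le> dist x' y"
  shows "\<bar>K x y - K x' y\<bar> \<le> smooth_const * (\<eta> (real DIM('a) * L / dist x y) / dist x y ^ DIM('a))"
proof -
  let ?d = "DIM('a)"
  have pos: "0 < dist x y" "0 < dist x' y" using L y by linarith+
  have ne: "x \<noteq> y" "x' \<noteq> y" using pos by auto
  show ?thesis
  proof (cases "dist x x' \<le> dist x y / 2")
    case True
    then have "\<bar>K x y - K x' y\<bar> \<le> C * \<eta> (dist x x' / dist x y) / dist x y ^ ?d"
      by (intro smooth_left ne)
    also have "\<dots> \<le> smooth_const * \<eta> (real ?d * L / dist x y) / dist x y ^ ?d"
      using smooth_const_ge C_pos xx' pos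
      by (intro divide_right_mono mult_mono \<eta>_mono) (auto simp: \<eta>_nonneg intro: divide_right_mono)
    finally show ?thesis by simp
  next
    case False
    have "1 / 2 \<le> real ?d * L / dist x y" using False xx' pos by (simp add: field_simps)
    then have \<eta>2: "1 \<le> 2 * \<eta> (real ?d * L / dist x y)" using \<eta>_ge[of "real ?d * L / dist x y"] by linarith
    have "dist x y \<le> dist x' y + real ?d * L" using dist_triangle[of x y x'] xx' by simp
    also have "\<dots> \<le> dist x' y + real ?d * dist x' y" using y by (intro add_left_mono mult_left_mono) auto
    finally have far: "dist x y \<le> (1 + real ?d) * dist x' y" by (simp add: algebra_simps)
    have "\<bar>K x' y\<bar> \<le> C / dist x' y ^ ?d" by (intro size ne)
    also have "\<dots> \<le> C * (1 + real ?d) ^ ?d / dist x y ^ ?d"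
    proof -
      have "dist x y ^ ?d \<le> ((1 + real ?d) * dist x' y) ^ ?d" using far by (intro power_mono) auto
      then have "C * dist x y ^ ?d \<le> C * (1 + real ?d) ^ ?d * dist x' y ^ ?d"
        using C_pos by (simp add: power_mult_distrib)
      then show ?thesis using pos by (simp add: frac_le_eq divide_le_eq pos_le_divide_eq mult.commute field_simps)
    qed
    finally have 2: "\<bar>K x' y\<bar> \<le> C * (1 + real ?d) ^ ?d / dist x y ^ ?d" .
    have 1: "\<bar>K x y\<bar> \<le> C / dist x y ^ ?d" by (intro size ne)
    have "\<bar>K x y - K x' y\<bar> \<le> C * (1 + (1 + real ?d) ^ ?d) / dist x y ^ ?d"
      using 1 2 by (simp add: add_divide_distrib distrib_left)
    also have "\<dots> \<le> (C * (1 + (1 + real ?d) ^ ?d) * (2 * \<eta> (real ?d * L / dist x y))) / dist x y ^ ?d"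
    proof (intro divide_right_mono)
      have "C * (1 + (1 + real ?d) ^ ?d) * 1 \<le> C * (1 + (1 + real ?d) ^ ?d) * (2 * \<eta> (real ?d * L / dist x y))"
        using C_pos \<eta>2 by (intro mult_left_mono) auto
      then show "C * (1 + (1 + real ?d) ^ ?d) \<le> C * (1 + (1 + real ?d) ^ ?d) * (2 * \<eta> (real ?d * L / dist x y))" by simp
    qed auto
    also have "\<dots> = smooth_const * (\<eta> (real ?d * L / dist x y) / dist x y ^ ?d)"
      by (simp add: smooth_const_def)
    finally show ?thesis .
  qed
qed

text \<open>16 = 2 * 4 * 2, from \<open>sphere_crossing\<close>, from
  \<open>ennreal_square_sum_le\<close>, and from the two spheres that bound an annulus.\<close>

definition diff_const :: real where
  "diff_const = 16 * (1 + real DIM('a)) ^ Suc DIM('a) * shell_const DIM('a) (real DIM('a)) * (real DIM('a) * radial_const)"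

lemma diff_const_nonneg: "0 \<le> diff_const"
  by (simp add: diff_const_def shell_const_nonneg radial_const_nonneg)

text \<open>A point that leaves the annulus when the centre moves is within d L of one of its two
  spheres. This is again a crossing problem, now with the constant size d L and with a mass of
  density at most \<Gamma>.\<close>

lemma annulus_difference_sum:
  fixes x x' :: 'a and N :: nat
  assumes e: "e \<in> null_decr_seqs" and L: "0 < L" and xx': "dist x x' \<le> real DIM('a) * L"
    and [measurable]: "g \<in> borel_measurable lebesgue"
    and \<Gamma>: "\<And>y. \<bar>g y\<bar> \<le> \<Gamma>" and supp: "\<And>y. g y \<noteq> 0 \<Longrightarrow> L \<le> dist x y \<and> L \<le> dist x' y"
  shows "(\<Sum>i<N. (\<integral>\<^sup>+y\<in>annulus e x i - annulus e x' i. ennreal (1 / dist x y ^ DIM('a)) * ennreal \<bar>g y\<bar> \<partial>lebesgue)\<^sup>2)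
     \<le> ennreal (diff_const * \<Gamma>\<^sup>2)"
proof -
  let ?d = "DIM('a)" and ?D = "real DIM('a)"
  let ?w = "\<lambda>y. ennreal (1 / dist x y ^ ?d) * ennreal \<bar>g y\<bar>"
  have \<Gamma>0: "0 \<le> \<Gamma>" using \<Gamma>[of undefined] by linarith
  have D1: "1 \<le> ?D" using DIM_positive[where 'a='a] by (simp add: Suc_leI)
  define U where "U r i = annulus e x i \<inter> {y \<in> space lebesgue. g y \<noteq> 0 \<and> \<bar>dist x y - r\<bar> \<le> ?D * L \<and> L \<le> r}" for r i
  have [measurable]: "U r i \<in> sets lebesgue" for r i unfolding U_def by measurable
  define M where "M = 2 * (1 + ?D) ^ Suc ?d * (\<Gamma> * shell_const ?d ?D) * (\<Gamma> * (?D * radial_const))"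
  have one: "(\<Sum>i<N. (\<integral>\<^sup>+y\<in>U (r i) i. ?w y \<partial>lebesgue)\<^sup>2) \<le> ennreal M" for r
  proof -
    have "(\<Sum>i<N. (\<integral>\<^sup>+y\<in>U (r i) i. ?w y \<partial>lebesgue)\<^sup>2)
       \<le> ennreal (2 * (1 + ?D) ^ Suc ?d * (\<Gamma> * shell_const ?d ?D)) *
        (\<integral>\<^sup>+y\<in>(\<Union>i<N. U (r i) i). ennreal (?D * L / dist x y / dist x y ^ ?d) * ennreal \<bar>g y\<bar> \<partial>lebesgue)"
    proof (rule sphere_crossing)
      show "disjoint_family_on (\<lambda>i. U (r i) i) {..<N}"
        using disjoint_annulus[OF e, of x] unfolding disjoint_family_on_def U_def by blast
      show "0 \<le> \<Gamma> * shell_const ?d ?D" using \<Gamma>0 by (simp add: shell_const_nonneg)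
      fix i y assume "y \<in> U (r i) i"
      then show "0 < ?D * L \<and> \<bar>dist x y - r i\<bar> \<le> ?D * L \<and> ?D * L \<le> ?D * r i \<and> ?D * L \<le> ?D * dist x y"
        using L supp[of y] by (auto simp: U_def)
    next
      fix i t assume r: "0 < r i" and t: "0 < t" "t \<le> ?D * r i"
      show "(\<integral>\<^sup>+y\<in>{y \<in> U (r i) i. ?D * L \<le> t}. ennreal \<bar>g y\<bar> \<partial>lebesgue)
          \<le> ennreal (\<Gamma> * shell_const ?d ?D * t * r i ^ (?d - 1))"
      proof (cases "?D * L \<le> t")
        case True
        let ?S = "{y. \<bar>dist x y - r i\<bar> \<le> t}"
        have "closed ?S" by (intro closed_Collect_le continuous_intros)
        then have S: "?S \<in> sets lebesgue" by (simp add: borel_closed)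
        have "(\<integral>\<^sup>+y\<in>{y \<in> U (r i) i. ?D * L \<le> t}. ennreal \<bar>g y\<bar> \<partial>lebesgue) \<le> (\<integral>\<^sup>+y\<in>?S. ennreal \<Gamma> \<partial>lebesgue)"
          using True \<Gamma> by (intro nn_integral_mono) (auto simp: indicator_def U_def intro: ennreal_leI)
        also have "\<dots> = ennreal \<Gamma> * emeasure lebesgue ?S"
          using S by (rule nn_integral_cmult_indicator)
        also have "\<dots> \<le> ennreal \<Gamma> * ennreal (shell_const ?d ?D * t * r i ^ (?d - 1))"
          using r t by (intro mult_left_mono emeasure_shell_le) auto
        also have "\<dots> = ennreal (\<Gamma> * shell_const ?d ?D * t * r i ^ (?d - 1))"
          using \<Gamma>0 by (simp add: ennreal_mult'[symmetric] mult_ac)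
        finally show ?thesis .
      qed auto
    qed auto
    also have "(\<integral>\<^sup>+y\<in>(\<Union>i<N. U (r i) i). ennreal (?D * L / dist x y / dist x y ^ ?d) * ennreal \<bar>g y\<bar> \<partial>lebesgue)
       \<le> (\<integral>\<^sup>+y. ennreal \<Gamma> * (ennreal (\<eta> (?D * L / dist x y) / dist x y ^ ?d) * indicator {y \<in> space lebesgue. L \<le> dist x y} y) \<partial>lebesgue)"
    proof (intro nn_integral_mono)
      fix y
      show "ennreal (?D * L / dist x y / dist x y ^ ?d) * ennreal \<bar>g y\<bar> * indicator (\<Union>i<N. U (r i) i) y
         \<le> ennreal \<Gamma> * (ennreal (\<eta> (?D * L / dist x y) / dist x y ^ ?d) * indicator {y \<in> space lebesgue. L \<le> dist x y} y)"
      proof (cases "y \<in> (\<Union>i<N. U (r i) i)")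
        case True
        then have "L \<le> dist x y" using supp[of y] by (auto simp: U_def)
        moreover have "ennreal (?D * L / dist x y / dist x y ^ ?d) * ennreal \<bar>g y\<bar> \<le> ennreal (\<eta> (?D * L / dist x y) / dist x y ^ ?d) * ennreal \<Gamma>"
          using \<Gamma> by (intro mult_mono ennreal_leI divide_right_mono \<eta>_ge) auto
        ultimately show ?thesis using True by (simp add: mult.commute)
      qed simp
    qed
    also have "\<dots> = ennreal \<Gamma> * (\<integral>\<^sup>+y. (ennreal (\<eta> (?D * L / dist x y) / dist x y ^ ?d) * indicator {y \<in> space lebesgue. L \<le> dist x y} y) \<partial>lebesgue)"
      by (intro nn_integral_cmult) measurable
    also have "\<dots> \<le> ennreal \<Gamma> * ennreal (?D * radial_const)"
      using radial_bound_mult[OF L, of ?d x] by (intro mult_left_mono) auto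
    also have "\<dots> = ennreal (\<Gamma> * (?D * radial_const))"
      using \<Gamma>0 by (simp add: ennreal_mult')
    also have "ennreal (2 * (1 + ?D) ^ Suc ?d * (\<Gamma> * shell_const ?d ?D)) * ennreal (\<Gamma> * (?D * radial_const)) = ennreal M"
      unfolding M_def using \<Gamma>0 radial_const_nonneg by (intro ennreal_mult''[symmetric]) auto
    finally show ?thesis by (simp add: mult_left_mono)
  qed
  have sub: "?w y * indicator (annulus e x i - annulus e x' i) y \<le> ?w y * indicator (U (e i) i) y + ?w y * indicator (U (e (Suc i)) i) y" for i y
  proof (cases "y \<in> annulus e x i - annulus e x' i \<and> g y \<noteq> 0")
    case True
    then have y: "e (Suc i) < dist x y" "dist x y \<le> e i" "g y \<noteq> 0" "y \<in> annulus e x i" by (auto simp: annulus_def)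
    have y': "\<not> (e (Suc i) < dist x' y \<and> dist x' y \<le> e i)" using True by (auto simp: annulus_def)
    have tri: "dist x y \<le> dist x' y + ?D * L" "dist x' y \<le> dist x y + ?D * L"
      using dist_triangle[of x y x'] dist_triangle[of x' y x] xx' by (auto simp: dist_commute)
    have "y \<in> U (e i) i \<or> y \<in> U (e (Suc i)) i"
    \<comment> \<open>The requirement L \<le> r follows from L \<le> dist x' y at the inner sphere
      and from L \<le> dist x y at the outer one.\<close>
    proof (cases "dist x' y \<le> e (Suc i)")
      case True
      then have "y \<in> U (e (Suc i)) i" using y tri supp[of y] by (auto simp: U_def)
      then show ?thesis ..
    next
      case False
      then have "y \<in> U (e i) i" using y y' tri supp[of y] by (auto simp: U_def)
      then show ?thesis ..
    qed
    then show ?thesis using True by (auto simp: indicator_def)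
  next
    case False
    then show ?thesis by (cases "g y = 0") (simp_all only: abs_zero ennreal_0 mult_zero_right mult_zero_left zero_le indicator_simps simp_thms)
  qed
  have each: "(\<integral>\<^sup>+y\<in>annulus e x i - annulus e x' i. ?w y \<partial>lebesgue)\<^sup>2
    \<le> 4 * (\<integral>\<^sup>+y\<in>U (e i) i. ?w y \<partial>lebesgue)\<^sup>2 + 4 * (\<integral>\<^sup>+y\<in>U (e (Suc i)) i. ?w y \<partial>lebesgue)\<^sup>2" for i
  proof -
    have "(\<integral>\<^sup>+y\<in>annulus e x i - annulus e x' i. ?w y \<partial>lebesgue)
       \<le> (\<integral>\<^sup>+y. ?w y * indicator (U (e i) i) y + ?w y * indicator (U (e (Suc i)) i) y \<partial>lebesgue)"
      by (intro nn_integral_mono sub)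
    also have "\<dots> = (\<integral>\<^sup>+y\<in>U (e i) i. ?w y \<partial>lebesgue) + (\<integral>\<^sup>+y\<in>U (e (Suc i)) i. ?w y \<partial>lebesgue)"
      by (intro nn_integral_add) measurable
    finally have "(\<integral>\<^sup>+y\<in>annulus e x i - annulus e x' i. ?w y \<partial>lebesgue)\<^sup>2
      \<le> ((\<integral>\<^sup>+y\<in>U (e i) i. ?w y \<partial>lebesgue) + (\<integral>\<^sup>+y\<in>U (e (Suc i)) i. ?w y \<partial>lebesgue))\<^sup>2"
      by (intro power_mono) auto
    then show ?thesis using ennreal_square_sum_le order_trans by blast
  qed
  have "(\<Sum>i<N. (\<integral>\<^sup>+y\<in>annulus e x i - annulus e x' i. ?w y \<partial>lebesgue)\<^sup>2)
    \<le> (\<Sum>i<N. 4 * (\<integral>\<^sup>+y\<in>U (e i) i. ?w y \<partial>lebesgue)\<^sup>2 + 4 * (\<integral>\<^sup>+y\<in>U (e (Suc i)) i. ?w y \<partial>lebesgue)\<^sup>2)"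
    by (intro sum_mono each)
  also have "\<dots> = 4 * (\<Sum>i<N. (\<integral>\<^sup>+y\<in>U (e i) i. ?w y \<partial>lebesgue)\<^sup>2) + 4 * (\<Sum>i<N. (\<integral>\<^sup>+y\<in>U (e (Suc i)) i. ?w y \<partial>lebesgue)\<^sup>2)"
    by (simp only: sum.distrib sum_distrib_left)
  also have "\<dots> \<le> 4 * ennreal M + 4 * ennreal M"
    using one[of e] one[of "\<lambda>i. e (Suc i)"] by (intro add_mono mult_left_mono) auto
  also have "\<dots> = 8 * ennreal M" by (simp flip: distrib_right)
  also have "\<dots> = ennreal (8 * M)" by (simp add: ennreal_mult')
  also have "8 * M = diff_const * \<Gamma>\<^sup>2" by (simp add: M_def diff_const_def power2_eq_square)
  finally show ?thesis .
qed

definition comparison_const :: real where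
  "comparison_const = smooth_const * (real DIM('a) * radial_const) + 2 * (C * (1 + real DIM('a)) ^ DIM('a) * sqrt diff_const)"

text \<open>The difference of two increments consists of the kernel difference over the annulus
  about \<open>x\<close>, which is absolutely summable, and of \<open>K x'\<close> over the two
  one-sided differences of the annuli, which are square summable.\<close>

lemma var_op_smooth:
  fixes x x' :: 'a
  assumes L: "0 < L" and xx': "dist x x' \<le> real DIM('a) * L"
    and g: "integrable lebesgue g"
    and \<Gamma>: "\<And>y. \<bar>g y\<bar> \<le> \<Gamma>" and supp: "\<And>y. g y \<noteq> 0 \<Longrightarrow> L \<le> dist x y \<and> L \<le> dist x' y"
  shows "V g x \<le> V g x' + ereal (comparison_const * \<Gamma>)"
proof (rule var_op_leI)
  fix e N assume e: "e \<in> null_decr_seqs"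
  let ?d = "DIM('a)" and ?D = "real DIM('a)"
  have gm [measurable]: "g \<in> borel_measurable lebesgue" using g by simp
  have \<Gamma>0: "0 \<le> \<Gamma>" using \<Gamma>[of undefined] by linarith
  have sc0: "0 \<le> smooth_const" using smooth_const_ge C_pos by linarith
  define C' where "C' = C * (1 + ?D) ^ ?d"
  have C': "C \<le> C'" "0 \<le> C'" using C_pos by (auto simp: C'_def)
  let ?A = "annulus e x" and ?B = "annulus e x'"
  let ?h = "\<lambda>y. ennreal smooth_const * (ennreal (\<eta> (?D * L / dist x y) / dist x y ^ ?d) * ennreal \<bar>g y\<bar>)"
  define \<alpha> where "\<alpha> i = (\<integral>\<^sup>+y\<in>?A i. ?h y \<partial>lebesgue)" for i
  define \<beta> where "\<beta> i = ennreal C' * (\<integral>\<^sup>+y\<in>?A i - ?B i. ennreal (1 / dist x y ^ ?d) * ennreal \<bar>g y\<bar> \<partial>lebesgue)" for i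
  define \<gamma> where "\<gamma> i = ennreal C' * (\<integral>\<^sup>+y\<in>?B i - ?A i. ennreal (1 / dist x' y ^ ?d) * ennreal \<bar>g y\<bar> \<partial>lebesgue)" for i
  define v where "v i = incr K e g x i - incr K e g x' i" for i
  have Kint: "integrable lebesgue (\<lambda>y. K z y * g y)" if "\<And>y. g y \<noteq> 0 \<Longrightarrow> L \<le> dist z y" for z
  proof -
    have "set_integrable lebesgue {y. L / 2 < dist z y} (\<lambda>y. K z y * g y)"
      using L g by (intro K_integrable_outside) auto
    moreover have "(\<lambda>y. indicat_real {y. L / 2 < dist z y} y *\<^sub>R (K z y * g y)) = (\<lambda>y. K z y * g y)"
      using that L by (force simp: indicator_def)
    ultimately show ?thesis unfolding set_integrable_def by simp
  qed
  have Kx: "integrable lebesgue (\<lambda>y. K x y * g y)" and Kx': "integrable lebesgue (\<lambda>y. K x' y * g y)"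
    using supp by (auto intro!: Kint)
  \<comment> \<open>The kernel always sits at \<open>x'\<close>, but the one-sided differences
    belong to annuli about \<open>x\<close> and about \<open>x'\<close> respectively; hence weights
    with both centres.\<close>
  have supp': "\<bar>K x' y\<bar> * \<bar>g y\<bar> \<le> C' * (1 / dist x y ^ ?d * \<bar>g y\<bar>)" "\<bar>K x' y\<bar> * \<bar>g y\<bar> \<le> C' * (1 / dist x' y ^ ?d * \<bar>g y\<bar>)" for y
  proof -
    have *: "\<bar>K x' y\<bar> \<le> C' / dist x y ^ ?d \<and> \<bar>K x' y\<bar> \<le> C' / dist x' y ^ ?d" if "g y \<noteq> 0"
    proof -
      have y: "L \<le> dist x y" "L \<le> dist x' y" using supp[OF that] by auto
      then have pos: "0 < dist x y" "0 < dist x' y" using L by linarith+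
      have "dist x y \<le> dist x' y + ?D * L" using dist_triangle[of x y x'] xx' by simp
      also have "\<dots> \<le> dist x' y + ?D * dist x' y" using y by (intro add_left_mono mult_left_mono) auto
      finally have far: "dist x y \<le> (1 + ?D) * dist x' y" by (simp add: algebra_simps)
      have Ks: "\<bar>K x' y\<bar> \<le> C / dist x' y ^ ?d" using pos by (intro size) auto
      have "C / dist x' y ^ ?d \<le> C' / dist x y ^ ?d"
      proof -
        have "dist x y ^ ?d \<le> ((1 + ?D) * dist x' y) ^ ?d" using far by (intro power_mono) auto
        then have "C * dist x y ^ ?d \<le> C' * dist x' y ^ ?d"
          using C_pos by (simp add: power_mult_distrib C'_def)
        then show ?thesis using pos by (simp add: field_simps)
      qed
      moreover have "C / dist x' y ^ ?d \<le> C' / dist x' y ^ ?d" using C' by (intro divide_right_mono) auto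
      ultimately show ?thesis using Ks by linarith
    qed
    show "\<bar>K x' y\<bar> * \<bar>g y\<bar> \<le> C' * (1 / dist x y ^ ?d * \<bar>g y\<bar>)"
      using * mult_right_mono[of "\<bar>K x' y\<bar>" "C' / dist x y ^ ?d" "\<bar>g y\<bar>"] by (cases "g y = 0") auto
    show "\<bar>K x' y\<bar> * \<bar>g y\<bar> \<le> C' * (1 / dist x' y ^ ?d * \<bar>g y\<bar>)"
      using * mult_right_mono[of "\<bar>K x' y\<bar>" "C' / dist x' y ^ ?d" "\<bar>g y\<bar>"] by (cases "g y = 0") auto
  qed
  have indint: "integrable lebesgue (\<lambda>y. indicator S y * k y)" if "S \<in> sets lebesgue" "integrable lebesgue k"
    for S and k :: "'a \<Rightarrow> real"
    using integrable_mult_indicator[OF that] by simp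
  have inc: "ennreal \<bar>v i\<bar> \<le> \<alpha> i + \<beta> i + \<gamma> i" for i
  proof -
    define k1 where "k1 y = indicator (?A i) y * (K x y * g y - K x' y * g y)" for y
    define k2 where "k2 y = indicator (?A i - ?B i) y * (K x' y * g y)" for y
    define k3 where "k3 y = indicator (?B i - ?A i) y * (K x' y * g y)" for y
    have int: "integrable lebesgue k1" "integrable lebesgue k2" "integrable lebesgue k3"
      unfolding k1_def k2_def k3_def using Kx Kx' by (auto intro!: indint)
    have "v i = (LINT y|lebesgue. indicator (?A i) y * (K x y * g y)) - (LINT y|lebesgue. indicator (?B i) y * (K x' y * g y))"
      by (simp add: v_def incr_eq[OF e g] set_lebesgue_integral_def)
    also have "\<dots> = (LINT y|lebesgue. indicator (?A i) y * (K x y * g y) - indicator (?B i) y * (K x' y * g y))"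
      using Kx Kx' by (intro Bochner_Integration.integral_diff[symmetric] indint) auto
    also have "\<dots> = (LINT y|lebesgue. k1 y + k2 y - k3 y)"
      by (intro Bochner_Integration.integral_cong) (auto simp: k1_def k2_def k3_def indicator_def)
    also have "\<dots> = (LINT y|lebesgue. k1 y) + (LINT y|lebesgue. k2 y) - (LINT y|lebesgue. k3 y)"
      using int by simp
    finally have "\<bar>v i\<bar> \<le> \<bar>LINT y|lebesgue. k1 y\<bar> + \<bar>LINT y|lebesgue. k2 y\<bar> + \<bar>LINT y|lebesgue. k3 y\<bar>" by linarith
    then have "ennreal \<bar>v i\<bar> \<le> ennreal \<bar>LINT y|lebesgue. k1 y\<bar> + ennreal \<bar>LINT y|lebesgue. k2 y\<bar> + ennreal \<bar>LINT y|lebesgue. k3 y\<bar>"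
      by (simp add: ennreal_plus[symmetric] ennreal_leI del: ennreal_plus)
    moreover have "ennreal \<bar>LINT y|lebesgue. k1 y\<bar> \<le> \<alpha> i"
    proof -
      have "ennreal \<bar>LINT y|lebesgue. k1 y\<bar> \<le> (\<integral>\<^sup>+y. ennreal (norm (k1 y)) \<partial>lebesgue)"
        using integral_norm_bound_ennreal[OF int(1)] by simp
      also have "\<dots> \<le> \<alpha> i"
        unfolding \<alpha>_def
      proof (intro nn_integral_mono)
        fix y
        show "ennreal (norm (k1 y)) \<le> ?h y * indicator (?A i) y"
        proof (cases "y \<in> ?A i \<and> g y \<noteq> 0")
          case True
          then have "\<bar>K x y - K x' y\<bar> \<le> smooth_const * (\<eta> (?D * L / dist x y) / dist x y ^ ?d)"
            using supp[of y] by (intro kernel_difference_le L xx') auto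
          then have "\<bar>K x y - K x' y\<bar> * \<bar>g y\<bar> \<le> smooth_const * (\<eta> (?D * L / dist x y) / dist x y ^ ?d) * \<bar>g y\<bar>"
            by (rule mult_right_mono) simp
          then have "ennreal (norm (k1 y)) \<le> ennreal (smooth_const * ((\<eta> (?D * L / dist x y) / dist x y ^ ?d) * \<bar>g y\<bar>))"
            using True by (intro ennreal_leI) (simp add: k1_def abs_mult left_diff_distrib[symmetric])
          also have "\<dots> = ?h y"
            using sc0 by (simp add: ennreal_mult'[symmetric] ennreal_mult''[symmetric])
          finally show ?thesis using True by simp
        qed (auto simp: k1_def)
      qed
      finally show ?thesis .
    qed
    moreover have "ennreal \<bar>LINT y|lebesgue. k2 y\<bar> \<le> \<beta> i"
    proof -
      have "ennreal \<bar>LINT y|lebesgue. k2 y\<bar> \<le> (\<integral>\<^sup>+y. ennreal (norm (k2 y)) \<partial>lebesgue)"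
        using integral_norm_bound_ennreal[OF int(2)] by simp
      also have "\<dots> \<le> (\<integral>\<^sup>+y. ennreal C' * (ennreal (1 / dist x y ^ ?d) * ennreal \<bar>g y\<bar> * indicator (?A i - ?B i) y) \<partial>lebesgue)"
      proof (intro nn_integral_mono)
        fix y
        have "ennreal (\<bar>K x' y\<bar> * \<bar>g y\<bar>) \<le> ennreal (C' * (1 / dist x y ^ ?d * \<bar>g y\<bar>))"
          by (intro ennreal_leI supp')
        also have "\<dots> = ennreal C' * (ennreal (1 / dist x y ^ ?d) * ennreal \<bar>g y\<bar>)"
          using C' by (simp add: ennreal_mult'[symmetric] ennreal_mult''[symmetric])
        finally show "ennreal (norm (k2 y)) \<le> ennreal C' * (ennreal (1 / dist x y ^ ?d) * ennreal \<bar>g y\<bar> * indicator (?A i - ?B i) y)"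
          by (cases "y \<in> ?A i - ?B i") (auto simp: k2_def abs_mult)
      qed
      also have "\<dots> = \<beta> i" unfolding \<beta>_def by (intro nn_integral_cmult) measurable
      finally show ?thesis .
    qed
    moreover have "ennreal \<bar>LINT y|lebesgue. k3 y\<bar> \<le> \<gamma> i"
    proof -
      have "ennreal \<bar>LINT y|lebesgue. k3 y\<bar> \<le> (\<integral>\<^sup>+y. ennreal (norm (k3 y)) \<partial>lebesgue)"
        using integral_norm_bound_ennreal[OF int(3)] by simp
      also have "\<dots> \<le> (\<integral>\<^sup>+y. ennreal C' * (ennreal (1 / dist x' y ^ ?d) * ennreal \<bar>g y\<bar> * indicator (?B i - ?A i) y) \<partial>lebesgue)"
      proof (intro nn_integral_mono)
        fix y
        have "ennreal (\<bar>K x' y\<bar> * \<bar>g y\<bar>) \<le> ennreal (C' * (1 / dist x' y ^ ?d * \<bar>g y\<bar>))"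
          by (intro ennreal_leI supp')
        also have "\<dots> = ennreal C' * (ennreal (1 / dist x' y ^ ?d) * ennreal \<bar>g y\<bar>)"
          using C' by (simp add: ennreal_mult'[symmetric] ennreal_mult''[symmetric])
        finally show "ennreal (norm (k3 y)) \<le> ennreal C' * (ennreal (1 / dist x' y ^ ?d) * ennreal \<bar>g y\<bar> * indicator (?B i - ?A i) y)"
          by (cases "y \<in> ?B i - ?A i") (auto simp: k3_def abs_mult)
      qed
      also have "\<dots> = \<gamma> i" unfolding \<gamma>_def by (intro nn_integral_cmult) measurable
      finally show ?thesis .
    qed
    ultimately show ?thesis by (meson add_mono order_trans)
  qed
  have A: "(\<Sum>i<N. \<alpha> i) \<le> ennreal (smooth_const * (\<Gamma> * (?D * radial_const)))"
  proof -
    have "(\<Sum>i<N. \<alpha> i) \<le> (\<integral>\<^sup>+y. ?h y \<partial>lebesgue)"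
      unfolding \<alpha>_def by (intro annulus_sum_le e) measurable
    also have "\<dots> \<le> (\<integral>\<^sup>+y. ennreal smooth_const * (ennreal \<Gamma> * (ennreal (\<eta> (?D * L / dist x y) / dist x y ^ ?d) * indicator {y \<in> space lebesgue. L \<le> dist x y} y)) \<partial>lebesgue)"
    proof (intro nn_integral_mono mult_left_mono)
      fix y
      show "ennreal (\<eta> (?D * L / dist x y) / dist x y ^ ?d) * ennreal \<bar>g y\<bar>
        \<le> ennreal \<Gamma> * (ennreal (\<eta> (?D * L / dist x y) / dist x y ^ ?d) * indicator {y \<in> space lebesgue. L \<le> dist x y} y)"
      proof (cases "g y = 0")
        case False
        have "ennreal (\<eta> (?D * L / dist x y) / dist x y ^ ?d) * ennreal \<bar>g y\<bar> \<le> ennreal (\<eta> (?D * L / dist x y) / dist x y ^ ?d) * ennreal \<Gamma>"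
          by (intro mult_left_mono ennreal_leI \<Gamma>) auto
        then show ?thesis using supp[OF False] by (simp add: mult.commute)
      qed simp
    qed auto
    also have "\<dots> = ennreal smooth_const * (ennreal \<Gamma> * (\<integral>\<^sup>+y. (ennreal (\<eta> (?D * L / dist x y) / dist x y ^ ?d) * indicator {y \<in> space lebesgue. L \<le> dist x y} y) \<partial>lebesgue))"
      by (simp add: nn_integral_cmult)
    also have "\<dots> \<le> ennreal smooth_const * (ennreal \<Gamma> * ennreal (?D * radial_const))"
      using radial_bound_mult[OF L, of ?d x] by (intro mult_left_mono) auto
    also have "\<dots> = ennreal (smooth_const * (\<Gamma> * (?D * radial_const)))"
      using \<Gamma>0 sc0 by (simp add: ennreal_mult'[symmetric])
    finally show ?thesis .
  qed
  have sq: "(\<Sum>i<N. (ennreal C' * f i)\<^sup>2) \<le> ennreal ((C' * sqrt diff_const * \<Gamma>)\<^sup>2)"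
    if "(\<Sum>i<N. (f i)\<^sup>2) \<le> ennreal (diff_const * \<Gamma>\<^sup>2)" for f
  proof -
    have "(\<Sum>i<N. (ennreal C' * f i)\<^sup>2) = (ennreal C')\<^sup>2 * (\<Sum>i<N. (f i)\<^sup>2)"
      by (simp add: sum_distrib_left power_mult_distrib)
    also have "\<dots> \<le> (ennreal C')\<^sup>2 * ennreal (diff_const * \<Gamma>\<^sup>2)" using that by (intro mult_left_mono) auto
    also have "\<dots> = ennreal (C'\<^sup>2 * (diff_const * \<Gamma>\<^sup>2))"
      using C' by (simp add: ennreal_power ennreal_mult')
    also have "C'\<^sup>2 * (diff_const * \<Gamma>\<^sup>2) = (C' * sqrt diff_const * \<Gamma>)\<^sup>2"
      using diff_const_nonneg by (simp add: power_mult_distrib)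
    finally show ?thesis .
  qed
  have B: "(\<Sum>i<N. (\<beta> i)\<^sup>2) \<le> ennreal ((C' * sqrt diff_const * \<Gamma>)\<^sup>2)"
    unfolding \<beta>_def by (rule sq[OF annulus_difference_sum[OF e L xx' gm \<Gamma> supp]])
  have xx'': "dist x' x \<le> real DIM('a) * L" using xx' by (simp add: dist_commute)
  \<comment> \<open>The estimate for \<open>B\<close> with the two centres exchanged.\<close>
  have G: "(\<Sum>i<N. (\<gamma> i)\<^sup>2) \<le> ennreal ((C' * sqrt diff_const * \<Gamma>)\<^sup>2)"
    unfolding \<gamma>_def by (rule sq[OF annulus_difference_sum[OF e L xx'' gm \<Gamma>]]) (use supp in auto)
  have "lnorm \<rho> N v \<le> smooth_const * (\<Gamma> * (?D * radial_const)) + C' * sqrt diff_const * \<Gamma> + C' * sqrt diff_const * \<Gamma>"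
    using \<rho>_ge \<Gamma>0 sc0 C' radial_const_nonneg diff_const_nonneg by (intro lnorm_le_ennreal[OF _ _ _ _ inc A B G]) auto
  also have "\<dots> = comparison_const * \<Gamma>"
    by (simp add: comparison_const_def C'_def algebra_simps)
  finally have v: "lnorm \<rho> N v \<le> comparison_const * \<Gamma>" .
  have "lnorm \<rho> N (incr K e g x) \<le> lnorm \<rho> N (incr K e g x') + lnorm \<rho> N v"
    using lnorm_triangle[of \<rho> N "incr K e g x'" v] \<rho>_ge by (simp add: v_def)
  then have "ereal (lnorm \<rho> N (incr K e g x)) \<le> ereal (lnorm \<rho> N (incr K e g x')) + ereal (comparison_const * \<Gamma>)"
    using v by simp
  also have "\<dots> \<le> V g x' + ereal (comparison_const * \<Gamma>)"
    by (intro add_right_mono lnorm_le_var_op e)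
  finally show "ereal (lnorm \<rho> N (incr K e g x)) \<le> V g x' + ereal (comparison_const * \<Gamma>)" .
qed

end

subsection \<open>Families of cubes\<close>

definition cube_radius :: "'a::euclidean_space set \<Rightarrow> real" where
  "cube_radius Q = (THE r. \<exists>c. 0 < r \<and> Q = hcube c r)"

definition cube_center :: "'a::euclidean_space set \<Rightarrow> 'a" where
  "cube_center Q = (THE c. \<exists>r. 0 < r \<and> Q = hcube c r)"

lemma cube_radius_hcube:
  assumes "0 < r" shows "cube_radius (hcube c r) = r"
  unfolding cube_radius_def
proof (rule the_equality)
  show "\<exists>ca. 0 < r \<and> hcube c r = hcube ca r" using assms by blast
  fix r' assume "\<exists>c'. 0 < r' \<and> hcube c r = hcube c' r'"
  then obtain c' where "0 < r'" "hcube c r = hcube c' r'" by blast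
  then show "r' = r" using hcube_inject(2)[of r r' c c'] assms by simp
qed

lemma cube_center_hcube:
  assumes "0 < r" shows "cube_center (hcube c r) = c"
  unfolding cube_center_def
proof (rule the_equality)
  show "\<exists>ra. 0 < ra \<and> hcube c r = hcube c ra" using assms by blast
  fix c' assume "\<exists>r'. 0 < r' \<and> hcube c r = hcube c' r'"
  then obtain r' where "0 < r'" "hcube c r = hcube c' r'" by blast
  then show "c' = c" using hcube_inject(1)[of r r' c c'] assms by simp
qed

lemma dyadic_subE:
  assumes "0 < r" "Q \<in> dyadic_sub c r"
  obtains k z where "z \<in> hcube c r" "Q = dcell c r k z" "cube_radius Q = r / 2 ^ k"
    "Q = hcube (cube_center Q) (cube_radius Q)" "0 < cube_radius Q"
proof -
  obtain k z where kz: "z \<in> hcube c r" "Q = dcell c r k z" using assms by (auto simp: dyadic_sub_eq)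
  have "0 < r / 2 ^ k" using assms by simp
  then show ?thesis
    using that[OF kz] dcell_hcube[OF assms(1), of c k z] kz
    by (simp add: cube_radius_hcube cube_center_hcube)
qed

lemma dyadic_sub_subset: "0 < r \<Longrightarrow> Q \<in> dyadic_sub c r \<Longrightarrow> Q \<subseteq> hcube c r"
proof -
  assume r: "0 < r" and "Q \<in> dyadic_sub c r"
  then obtain k z where "z \<in> hcube c r" "Q = dcell c r k z" by (rule dyadic_subE)
  then show ?thesis using dcell_subset_hcube[OF r] by simp
qed

text \<open>A triple is a union of cells of its own generation, so no cell of that or a later
  generation can straddle its boundary.\<close>

lemma dcell_triple_cases:
  assumes "0 < r" "k \<le> k'"
  shows "dcell c r k' w \<subseteq> dilate 3 (dcell c r k z) \<or> dcell c r k' w \<inter> dilate 3 (dcell c r k z) = {}"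
proof -
  have eq: "dindex c r k y i = dindex c r k w i" if "y \<in> dcell c r k' w" "i \<in> Basis" for y i
    using dcell_mono[OF assms(2), of c r w] that by (auto simp: dcell_def)
  have "y \<in> dilate 3 (dcell c r k z) \<longleftrightarrow> (\<forall>i\<in>Basis. \<bar>dindex c r k w i - dindex c r k z i\<bar> \<le> 1)"
    if "y \<in> dcell c r k' w" for y
    using eq[OF that] unfolding dcell_triple[OF assms(1)] by simp
  then show ?thesis by blast
qed

definition piecewise :: "'a set set \<Rightarrow> ('a set \<Rightarrow> real) \<Rightarrow> 'a \<Rightarrow> real" where
  "piecewise J p y = (if y \<in> \<Union>J then p (SOME Q. Q \<in> J \<and> y \<in> Q) else 0)"

lemma piecewise_eq:
  assumes "disjoint J" "Q \<in> J" "y \<in> Q"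
  shows "piecewise J p y = p Q"
proof -
  have "(SOME Q. Q \<in> J \<and> y \<in> Q) = Q"
    using assms by (intro some_equality) (auto simp: disjoint_def)
  then show ?thesis using assms by (auto simp: piecewise_def)
qed

lemma piecewise_measurable:
  assumes J: "countable J" "J \<subseteq> sets M" "disjoint J"
  shows "piecewise J p \<in> borel_measurable M"
  unfolding borel_measurable_iff_greater
proof
  fix a
  have U: "\<Union>J \<in> sets M" using J by (intro sets.countable_Union) auto
  have "{w \<in> space M. a < piecewise J p w} = \<Union>{Q \<in> J. a < p Q} \<union> (if a < 0 then space M - \<Union>J else {})"
  proof (intro set_eqI)
    fix w
    show "w \<in> {w \<in> space M. a < piecewise J p w} \<longleftrightarrow> w \<in> \<Union>{Q \<in> J. a < p Q} \<union> (if a < 0 then space M - \<Union>J else {})"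
    proof (cases "w \<in> \<Union>J")
      case True
      then obtain Q where Q: "Q \<in> J" "w \<in> Q" by blast
      have "w \<in> space M" using Q J(2) sets.sets_into_space by blast
      moreover have "w \<in> \<Union>{Q \<in> J. a < p Q} \<longleftrightarrow> a < p Q"
      proof -
        have "Q' = Q" if "Q' \<in> J" "w \<in> Q'" for Q'
          using Q J(3) that by (auto simp: disjoint_def)
        then show ?thesis using Q by blast
      qed
      ultimately show ?thesis using True piecewise_eq[OF J(3) Q, of p] by auto
    next
      case False
      then show ?thesis by (auto simp: piecewise_def)
    qed
  qed
  also have "\<dots> \<in> sets M"
    using J U by (intro sets.Un sets.countable_Union) (auto intro: countable_subset)
  finally show "{w \<in> space M. a < piecewise J p w} \<in> sets M" .
qed

section \<open>Measures of unions and integrability of bounded functions\<close>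

lemma emeasure_UN_le_count_space:
  assumes "countable J" "\<And>Q. Q \<in> J \<Longrightarrow> T Q \<in> sets M"
  shows "emeasure M (\<Union>Q\<in>J. T Q) \<le> (\<integral>\<^sup>+Q. emeasure M (T Q) \<partial>count_space J)"
proof -
  have U: "(\<Union>Q\<in>J. T Q) \<in> sets M" using assms by (intro sets.countable_UN') auto
  have "emeasure M (\<Union>Q\<in>J. T Q) = (\<integral>\<^sup>+x. indicator (\<Union>Q\<in>J. T Q) x \<partial>M)"
    using U by simp
  also have "\<dots> \<le> (\<integral>\<^sup>+x. (\<integral>\<^sup>+Q. indicator (T Q) x \<partial>count_space J) \<partial>M)"
  proof (intro nn_integral_mono)
    fix x
    show "indicator (\<Union>Q\<in>J. T Q) x \<le> (\<integral>\<^sup>+Q. (indicator (T Q) x :: ennreal) \<partial>count_space J)"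
    proof (cases "x \<in> (\<Union>Q\<in>J. T Q)")
      case True
      then obtain Q where Q: "Q \<in> J" "x \<in> T Q" by blast
      have "(1::ennreal) = indicator (T Q) x" using Q by simp
      also have "\<dots> \<le> (\<integral>\<^sup>+Q. indicator (T Q) x \<partial>count_space J)"
        using Q(1) by (rule nn_integral_ge_point)
      finally show ?thesis using True by simp
    qed simp
  qed
  also have "\<dots> = (\<integral>\<^sup>+Q. (\<integral>\<^sup>+x. indicator (T Q) x \<partial>M) \<partial>count_space J)"
    using assms by (intro nn_integral_count_space_nn_integral) auto
  also have "\<dots> = (\<integral>\<^sup>+Q. emeasure M (T Q) \<partial>count_space J)"
    using assms by (intro nn_integral_cong) auto
  finally show ?thesis .
qed

lemma infsum_emeasure_le:
  assumes "F \<subseteq> sets M" "disjoint F" "\<Union>F \<in> sets M"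
  shows "(\<Sum>\<^sub>\<infinity>Q\<in>F. emeasure M Q) \<le> emeasure M (\<Union>F)"
proof (rule infsum_le_finite_sums)
  show "(\<lambda>Q. emeasure M Q) summable_on F" by (rule nonneg_summable_on_complete) simp
  fix H assume H: "finite H" "H \<subseteq> F"
  have "(\<Sum>Q\<in>H. emeasure M Q) = emeasure M (\<Union>Q\<in>H. Q)"
    using assms H by (intro sum_emeasure) (auto simp: disjoint_family_on_def disjoint_def subset_eq)
  also have "\<dots> \<le> emeasure M (\<Union>F)"
    using assms H by (intro emeasure_mono) auto
  finally show "(\<Sum>Q\<in>H. emeasure M Q) \<le> emeasure M (\<Union>F)" .
qed

lemma lmeasurable_finite: "S \<in> lmeasurable \<Longrightarrow> emeasure lebesgue S < \<infinity>"
  using fmeasurableD2[of S lebesgue] by (simp only: infinity_ennreal_def less_top)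

lemma bounded_support_integrable:
  fixes h :: "'a::euclidean_space \<Rightarrow> real"
  assumes "h \<in> borel_measurable lebesgue" "\<And>x. \<bar>h x\<bar> \<le> M" "\<And>x. x \<notin> S \<Longrightarrow> h x = 0" "S \<in> lmeasurable"
  shows "integrable lebesgue h"
proof (rule Bochner_Integration.integrable_bound)
  show "integrable lebesgue (\<lambda>x. M * indicat_real S x)"
    using assms(4) by (intro integrable_mult_right integrable_real_indicator fmeasurableD lmeasurable_finite)
  show "AE x in lebesgue. norm (h x) \<le> norm (M * indicat_real S x)"
  proof (intro AE_I2)
    fix x
    show "norm (h x) \<le> norm (M * indicat_real S x)"
      using assms(2)[of x] assms(3)[of x] by (cases "x \<in> S") auto
  qed
qed (use assms in auto)

lemma hcube_lmeasurable: "0 < r \<Longrightarrow> hcube c r \<in> lmeasurable"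
proof (rule fmeasurableI)
  assume "0 < r"
  then show "emeasure lebesgue (hcube c r) < \<infinity>" by (subst emeasure_hcube) auto
qed (rule hcube_lebesgue)

subsection \<open>The weak-type bound\<close>

text \<open>Chebyshev's inequality for the L^q bound, with the norm of a function bounded by
  \<Gamma> on \<open>S\<close> evaluated. The same \<open>B\<close> serves all functions, sets and
  heights, so it can be fixed before \<open>f\<close> and the cubes are given.\<close>

lemma var_bounded_Lq_weak:
  fixes K :: "'a::euclidean_space \<Rightarrow> 'a \<Rightarrow> real"
  assumes q: "1 < q" and bd: "var_bounded_Lq K \<rho> q"
  obtains B where "0 \<le> B"
    "\<And>h S \<Gamma> t. \<lbrakk>h \<in> borel_measurable lebesgue; \<And>x. \<bar>h x\<bar> \<le> \<Gamma>; \<And>x. x \<notin> S \<Longrightarrow> h x = 0; S \<in> lmeasurable; 0 < t\<rbrakk> \<Longrightarrow>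
      (AE x in lebesgue. var_op K \<rho> h x \<noteq> \<infinity>) \<and>
      (\<exists>Z\<in>sets lebesgue. (AE x in lebesgue. x \<notin> Z \<longrightarrow> var_op K \<rho> h x \<le> ereal t) \<and>
         emeasure lebesgue Z \<le> ennreal ((B * \<Gamma> / t) powr q) * emeasure lebesgue S)"
proof -
  obtain B0 where B0: "\<And>f. memLp q f \<Longrightarrow>
        (AE x in lebesgue. var_op K \<rho> f x \<noteq> \<infinity>) \<and>
        memLp q (\<lambda>x. real_of_ereal (var_op K \<rho> f x)) \<and>
        Lp_norm q (\<lambda>x. real_of_ereal (var_op K \<rho> f x)) \<le> B0 * Lp_norm q f"
    using bd unfolding var_bounded_Lq_def by blast
  \<comment> \<open>\<open>B0\<close> may be negative, whereas raising to the power q needs a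
    nonnegative base.\<close>
  define B where "B = max B0 0"
  show ?thesis
  proof (rule that)
    show "0 \<le> B" by (simp add: B_def)
    fix h :: "'a \<Rightarrow> real" and S \<Gamma> t
    assume h: "h \<in> borel_measurable lebesgue" and \<Gamma>: "\<And>x. \<bar>h x\<bar> \<le> \<Gamma>" and S: "\<And>x. x \<notin> S \<Longrightarrow> h x = 0" "S \<in> lmeasurable"
      and t: "0 < (t::real)"
    have \<Gamma>0: "0 \<le> \<Gamma>" using \<Gamma>[of undefined] by linarith
    have pw: "\<bar>h x\<bar> powr q \<le> \<Gamma> powr q * indicat_real S x" for x
      using S(1)[of x] \<Gamma>[of x] q by (cases "x \<in> S") (auto intro!: powr_mono2)
    have iS: "integrable lebesgue (\<lambda>x. \<Gamma> powr q * indicat_real S x)"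
      using S(2) by (intro integrable_mult_right integrable_real_indicator fmeasurableD lmeasurable_finite)
    have int: "integrable lebesgue (\<lambda>x. \<bar>h x\<bar> powr q)"
      by (rule Bochner_Integration.integrable_bound[OF iS]) (use h pw in auto)
    then have mem: "memLp q h" using h by (simp add: memLp_def)
    define v where "v x = real_of_ereal (var_op K \<rho> h x)" for x
    have fin: "AE x in lebesgue. var_op K \<rho> h x \<noteq> \<infinity>" and vm: "memLp q v" and le: "Lp_norm q v \<le> B0 * Lp_norm q h"
      using B0[OF mem] unfolding v_def by auto
    have [measurable]: "v \<in> borel_measurable lebesgue" and vi: "integrable lebesgue (\<lambda>x. \<bar>v x\<bar> powr q)"
      using vm by (auto simp: memLp_def)
    define Z where "Z = {x \<in> space lebesgue. t < v x}"
    have Zm: "Z \<in> sets lebesgue" unfolding Z_def by measurable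
    have AEZ: "AE x in lebesgue. x \<notin> Z \<longrightarrow> var_op K \<rho> h x \<le> ereal t"
      using fin
    proof eventually_elim
      case (elim x)
      then have "var_op K \<rho> h x = ereal (v x)"
        using var_op_nonneg[of K \<rho> h x] unfolding v_def by (cases "var_op K \<rho> h x") auto
      then show ?case by (auto simp: Z_def)
    qed
    have "Lp_norm q v \<le> B * Lp_norm q h"
      using le by (rule order_trans) (auto simp: B_def Lp_norm_def intro!: mult_right_mono)
    then have "Lp_norm q v powr q \<le> (B * Lp_norm q h) powr q"
      using q by (intro powr_mono2) (auto simp: Lp_norm_def)
    then have I: "(\<integral>x. \<bar>v x\<bar> powr q \<partial>lebesgue) \<le> B powr q * (\<integral>x. \<bar>h x\<bar> powr q \<partial>lebesgue)"
      using q by (simp add: Lp_norm_def powr_mult powr_powr B_def)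
    have "(\<integral>x. \<bar>h x\<bar> powr q \<partial>lebesgue) \<le> (\<integral>x. \<Gamma> powr q * indicat_real S x \<partial>lebesgue)"
      using int iS pw by (intro integral_mono) auto
    also have "\<dots> = \<Gamma> powr q * measure lebesgue S"
      using S(2) by simp
    finally have "B powr q * (\<integral>x. \<bar>h x\<bar> powr q \<partial>lebesgue) \<le> B powr q * (\<Gamma> powr q * measure lebesgue S)"
      by (intro mult_left_mono) auto
    with I have I2: "(\<integral>x. \<bar>v x\<bar> powr q \<partial>lebesgue) \<le> B powr q * (\<Gamma> powr q * measure lebesgue S)" by linarith
    have "ennreal (t powr q) * emeasure lebesgue Z = (\<integral>\<^sup>+x. ennreal (t powr q) * indicator Z x \<partial>lebesgue)"
      using Zm by (rule nn_integral_cmult_indicator[symmetric])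
    also have "\<dots> \<le> (\<integral>\<^sup>+x. ennreal (\<bar>v x\<bar> powr q) \<partial>lebesgue)"
    proof (intro nn_integral_mono)
      fix x
      show "ennreal (t powr q) * indicator Z x \<le> ennreal (\<bar>v x\<bar> powr q)"
        using t q by (cases "x \<in> Z") (auto simp: Z_def intro!: ennreal_leI powr_mono2)
    qed
    also have "\<dots> = ennreal (\<integral>x. \<bar>v x\<bar> powr q \<partial>lebesgue)"
      using vi by (intro nn_integral_eq_integral) auto
    also have "\<dots> \<le> ennreal (B powr q * (\<Gamma> powr q * measure lebesgue S))"
      by (intro ennreal_leI I2)
    finally have tz: "ennreal (t powr q) * emeasure lebesgue Z \<le> ennreal (B powr q * (\<Gamma> powr q * measure lebesgue S))" .
    have "emeasure lebesgue Z = ennreal (1 / t powr q) * (ennreal (t powr q) * emeasure lebesgue Z)"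
      using t by (simp add: mult.assoc[symmetric] ennreal_mult'[symmetric])
    also have "\<dots> \<le> ennreal (1 / t powr q) * ennreal (B powr q * (\<Gamma> powr q * measure lebesgue S))"
      by (intro mult_left_mono tz) auto
    also have "\<dots> = ennreal ((B * \<Gamma> / t) powr q * measure lebesgue S)"
      using t \<Gamma>0 by (simp add: ennreal_mult'[symmetric] powr_mult powr_divide B_def)
    also have "\<dots> = ennreal ((B * \<Gamma> / t) powr q) * emeasure lebesgue S"
      using S(2) by (simp add: ennreal_mult' emeasure_eq_measure2)
    finally show "(AE x in lebesgue. var_op K \<rho> h x \<noteq> \<infinity>) \<and>
      (\<exists>Z\<in>sets lebesgue. (AE x in lebesgue. x \<notin> Z \<longrightarrow> var_op K \<rho> h x \<le> ereal t) \<and>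
         emeasure lebesgue Z \<le> ennreal ((B * \<Gamma> / t) powr q) * emeasure lebesgue S)"
      using fin Zm AEZ by blast
  qed
qed

subsection \<open>The Calderon--Zygmund decomposition\<close>

text \<open>\<open>cz_size\<close> is twice the bound \<open>2 d r\<close> for the diameter of a cube of half side \<open>r\<close>, so that the
  smoothness of the kernel applies to two points of the cube as soon as \<open>cz_size J y \<le> dist x y\<close>.\<close>

definition cz_size :: "'a::euclidean_space set set \<Rightarrow> 'a \<Rightarrow> real" where
  "cz_size J = piecewise J (\<lambda>Q. 4 * real DIM('a) * cube_radius Q)"

definition cz_good :: "'a::euclidean_space set set \<Rightarrow> ('a \<Rightarrow> real) \<Rightarrow> 'a \<Rightarrow> real" where
  "cz_good J f y = (if y \<in> \<Union>J then piecewise J (\<lambda>Q. (LINT z:Q|lebesgue. f z) / measure lebesgue Q) y else f y)"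

definition cz_bad :: "'a::euclidean_space set set \<Rightarrow> ('a \<Rightarrow> real) \<Rightarrow> 'a \<Rightarrow> real" where
  "cz_bad J f y = f y - cz_good J f y"

text \<open>Off the cube dilated by \<open>expansion\<close> the distance to the cube is at least \<open>(1 + d)\<close> times its
  \<open>cz_size\<close>; the factor \<open>1 + d\<close> is lost when the point is moved inside a cube \<open>R\<close> with \<open>3R\<close> disjoint
  from the bad cube.\<close>

definition expansion :: "'a::euclidean_space itself \<Rightarrow> real" where
  "expansion _ = 1 + 4 * real DIM('a) * (1 + real DIM('a))"

definition cz_exceptional :: "'a::euclidean_space set set \<Rightarrow> 'a set" where
  "cz_exceptional J = (\<Union>Q\<in>J. hcube (cube_center Q) (expansion TYPE('a) * cube_radius Q))"

lemma DIM_ge_1: "1 \<le> real DIM('a::euclidean_space)"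
  using DIM_positive[where 'a='a] by (simp add: Suc_leI)

lemma expansion_ge: "9 \<le> expansion TYPE('a::euclidean_space)"
proof -
  have "1 * 2 \<le> real DIM('a) * (1 + real DIM('a))"
    using DIM_ge_1[where 'a='a] by (intro mult_mono) auto
  then show ?thesis by (simp add: expansion_def)
qed

context variation_kernel
begin

text \<open>The cut-off keeps \<open>x\<close>, for fixed \<open>y\<close>, at distance at least the
  size of the cube of \<open>y\<close>, so that the integral in \<open>x\<close> is a radial Dini
  integral with a bound independent of the cube.\<close>

definition cz_potential :: "'a set set \<Rightarrow> ('a \<Rightarrow> real) \<Rightarrow> 'a \<Rightarrow> ennreal" where
  "cz_potential J f x = (\<integral>\<^sup>+y. ennreal (\<eta> (cz_size J y / dist x y) / dist x y ^ DIM('a) * \<bar>cz_bad J f y\<bar>)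
      * indicator {y. y \<in> \<Union>J \<and> cz_size J y \<le> dist x y} y \<partial>lebesgue)"

text \<open>Decomposition data at height \<tau>. The bound \<open>small\<close> is required at every
  point; the almost everywhere version from the stopping lemma is brought to this form by changing
  the function on a null set.\<close>

context
  fixes c0 :: 'a and r0 \<tau> M :: real and J :: "'a set set" and f :: "'a \<Rightarrow> real"
  assumes r0: "0 < r0" and lam: "0 < \<tau>"
    and fm [measurable]: "f \<in> borel_measurable lebesgue" and fM: "\<And>x. \<bar>f x\<bar> \<le> M"
    and fsupp: "\<And>x. x \<notin> hcube c0 r0 \<Longrightarrow> f x = 0"
    and JD: "J \<subseteq> dyadic_sub c0 r0" and Jd: "disjoint J"
    and low: "\<And>Q. Q \<in> J \<Longrightarrow> ennreal \<tau> * emeasure lebesgue Q \<le> (\<integral>\<^sup>+x\<in>Q. ennreal \<bar>f x\<bar> \<partial>lebesgue)"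
    and up: "\<And>Q. Q \<in> J \<Longrightarrow> (\<integral>\<^sup>+x\<in>Q. ennreal \<bar>f x\<bar> \<partial>lebesgue) \<le> 2 ^ DIM('a) * ennreal \<tau> * emeasure lebesgue Q"
    and small: "\<And>x. x \<notin> \<Union>J \<Longrightarrow> \<bar>f x\<bar> \<le> \<tau>"
begin

abbreviation "s \<equiv> cz_size J"
abbreviation "g \<equiv> cz_good J f"
abbreviation "b \<equiv> cz_bad J f"
abbreviation "\<Omega> \<equiv> cz_exceptional J"
abbreviation "\<Phi> \<equiv> cz_potential J f"

section \<open>Bad cubes, good part and bad part\<close>

lemma J_countable: "countable J"
  by (rule countable_subset[OF JD countable_dyadic_sub])

lemma J_sets: "J \<subseteq> sets lebesgue"
  by (rule subsetI) (rule dyadic_sub_lebesgue[OF subsetD[OF JD]])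

lemma cz_Union_sets [measurable]: "\<Union>J \<in> sets lebesgue"
  by (rule sets.countable_Union[OF J_countable J_sets])

lemma UJ_subset: "\<Union>J \<subseteq> hcube c0 r0"
  using JD dyadic_sub_subset[OF r0] by blast

lemma J_cube:
  assumes "Q \<in> J"
  shows "Q = hcube (cube_center Q) (cube_radius Q)" "0 < cube_radius Q"
proof -
  have "Q \<in> dyadic_sub c0 r0" using assms JD by blast
  then show "Q = hcube (cube_center Q) (cube_radius Q)" by (rule dyadic_subE[OF r0])
  show "0 < cube_radius Q" using \<open>Q \<in> dyadic_sub c0 r0\<close> by (rule dyadic_subE[OF r0])
qed

lemma J_mem: "Q \<in> J \<Longrightarrow> y \<in> Q \<Longrightarrow> y \<in> hcube (cube_center Q) (cube_radius Q)"
  using equalityD1[OF J_cube(1)] by (rule subsetD)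

lemma J_emeasure:
  assumes "Q \<in> J" shows "emeasure lebesgue Q = ennreal ((2 * cube_radius Q) ^ DIM('a))"
  using J_cube(2)[OF assms]
  by (intro trans[OF arg_cong[OF J_cube(1)[OF assms], of "emeasure lebesgue"] emeasure_hcube]) simp

lemma J_measure:
  assumes "Q \<in> J"
  shows "Q \<in> lmeasurable" "0 < measure lebesgue Q" "emeasure lebesgue Q = ennreal (measure lebesgue Q)"
proof -
  obtain c r where cr: "Q = hcube c r" "0 < r" using J_cube[OF assms] by (rule that)
  show l: "Q \<in> lmeasurable" unfolding cr(1) by (rule hcube_lmeasurable[OF cr(2)])
  show e: "emeasure lebesgue Q = ennreal (measure lebesgue Q)"
    using l by (rule emeasure_eq_measure2)
  have "measure lebesgue Q = (2 * cube_radius Q) ^ DIM('a)"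
    using J_emeasure[OF assms] J_cube(2)[OF assms] by (simp add: measure_def del: emeasure_completion)
  then show "0 < measure lebesgue Q"
    using J_cube(2)[OF assms] by simp
qed

lemma s_measurable [measurable]: "s \<in> borel_measurable lebesgue"
  unfolding cz_size_def using J_countable J_sets Jd by (rule piecewise_measurable)

lemma s_eq: "Q \<in> J \<Longrightarrow> y \<in> Q \<Longrightarrow> s y = 4 * real DIM('a) * cube_radius Q"
  unfolding cz_size_def using Jd by (rule piecewise_eq)

lemma s_pos: "y \<in> \<Union>J \<Longrightarrow> 0 < s y"
  using s_eq J_cube(2) DIM_ge_1[where 'a='a] by fastforce

lemma g_measurable [measurable]: "g \<in> borel_measurable lebesgue"
proof -
  note [measurable] = piecewise_measurable[OF J_countable J_sets Jd]
  show ?thesis unfolding cz_good_def[abs_def] by measurable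
qed

lemma g_eq: "Q \<in> J \<Longrightarrow> y \<in> Q \<Longrightarrow> g y = (LINT z:Q|lebesgue. f z) / measure lebesgue Q"
  using piecewise_eq[OF Jd, of Q y] by (auto simp: cz_good_def)

lemma f_integrable: "integrable lebesgue f"
  by (rule bounded_support_integrable[OF fm fM fsupp hcube_lmeasurable[OF r0]])

lemma f_set_integrable: "A \<in> sets lebesgue \<Longrightarrow> set_integrable lebesgue A f"
  unfolding set_integrable_def using f_integrable by (rule integrable_mult_indicator[rotated])

lemma g_bound: "\<bar>g y\<bar> \<le> 2 ^ DIM('a) * \<tau>"
proof (cases "y \<in> \<Union>J")
  case True
  then obtain Q where Q: "Q \<in> J" "y \<in> Q" by blast
  have "ennreal \<bar>LINT z:Q|lebesgue. f z\<bar> \<le> (\<integral>\<^sup>+z. ennreal (norm (indicat_real Q z *\<^sub>R f z)) \<partial>lebesgue)"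
    unfolding set_lebesgue_integral_def
    using integral_norm_bound_ennreal[of lebesgue "\<lambda>z. indicat_real Q z *\<^sub>R f z"] f_set_integrable[of Q] Q J_sets
    by (auto simp: set_integrable_def)
  also have "\<dots> = (\<integral>\<^sup>+z\<in>Q. ennreal \<bar>f z\<bar> \<partial>lebesgue)"
    by (intro nn_integral_cong) (auto simp: indicator_def)
  also note up[OF Q(1)]
  also have "2 ^ DIM('a) * ennreal \<tau> * emeasure lebesgue Q = ennreal (2 ^ DIM('a) * \<tau> * measure lebesgue Q)"
    unfolding J_measure(3)[OF Q(1)] using lam by (simp add: ennreal_mult' ennreal_power[symmetric])
  finally have "\<bar>LINT z:Q|lebesgue. f z\<bar> \<le> 2 ^ DIM('a) * \<tau> * measure lebesgue Q"
    using lam by (simp add: ennreal_le_iff)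
  then show ?thesis unfolding g_eq[OF Q] using J_measure(2)[OF Q(1)] by (simp add: abs_divide pos_divide_le_eq)
next
  case False
  have "1 * \<tau> \<le> 2 ^ DIM('a) * \<tau>" using lam by (intro mult_right_mono) auto
  then show ?thesis using small[OF False] False by (simp add: cz_good_def)
qed

lemma g_supp: "y \<notin> hcube c0 r0 \<Longrightarrow> g y = 0"
  using UJ_subset fsupp by (auto simp: cz_good_def)

lemma g_integrable: "integrable lebesgue g"
  by (rule bounded_support_integrable[OF g_measurable g_bound g_supp hcube_lmeasurable[OF r0]])

lemma b_measurable [measurable]: "b \<in> borel_measurable lebesgue"
  unfolding cz_bad_def[abs_def] by measurable

lemma b_integrable: "integrable lebesgue b"
  unfolding cz_bad_def[abs_def] using f_integrable g_integrable by simp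

lemma b_supp: "y \<notin> \<Union>J \<Longrightarrow> b y = 0"
  by (simp add: cz_bad_def cz_good_def)

lemma b_cancel:
  assumes "Q \<in> J"
  shows "(LINT y:Q|lebesgue. b y) = 0"
proof -
  let ?a = "(LINT z:Q|lebesgue. f z) / measure lebesgue Q"
  have Q: "Q \<in> sets lebesgue" using assms J_sets by blast
  have "(LINT y:Q|lebesgue. b y) = (LINT y:Q|lebesgue. f y - ?a)"
    using Q g_eq[OF assms] by (intro set_lebesgue_integral_cong) (auto simp: cz_bad_def)
  also have "\<dots> = (LINT y:Q|lebesgue. f y) - (LINT y:Q|lebesgue. ?a)"
    using f_set_integrable[OF Q] lmeasurable_finite[OF J_measure(1)[OF assms]] Q
    by (intro set_integral_diff) (auto simp: set_integrable_def intro!: integrable_real_mult_indicator integrable_mult_left integrable_real_indicator)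
  also have "(LINT y:Q|lebesgue. ?a) = ?a * measure lebesgue Q"
    using J_measure(1)[OF assms] by (simp add: set_lebesgue_integral_def)
  also have "\<dots> = (LINT y:Q|lebesgue. f y)" using J_measure(2)[OF assms] by simp
  finally show ?thesis by simp
qed

lemma b_mass:
  assumes "Q \<in> J"
  shows "(\<integral>\<^sup>+y\<in>Q. ennreal \<bar>b y\<bar> \<partial>lebesgue) \<le> ennreal (2 ^ Suc DIM('a) * \<tau>) * emeasure lebesgue Q"
proof -
  have [measurable]: "Q \<in> sets lebesgue" using assms J_sets by blast
  have "(\<integral>\<^sup>+y\<in>Q. ennreal \<bar>b y\<bar> \<partial>lebesgue)
      \<le> (\<integral>\<^sup>+y. ennreal \<bar>f y\<bar> * indicator Q y + ennreal (2 ^ DIM('a) * \<tau>) * indicator Q y \<partial>lebesgue)"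
  proof (intro nn_integral_mono)
    fix y
    have "\<bar>b y\<bar> \<le> \<bar>f y\<bar> + 2 ^ DIM('a) * \<tau>" using g_bound[of y] by (simp add: cz_bad_def)
    then have "ennreal \<bar>b y\<bar> \<le> ennreal \<bar>f y\<bar> + ennreal (2 ^ DIM('a) * \<tau>)"
      using lam by (simp add: ennreal_plus[symmetric] ennreal_leI del: ennreal_plus)
    then show "ennreal \<bar>b y\<bar> * indicator Q y \<le> ennreal \<bar>f y\<bar> * indicator Q y + ennreal (2 ^ DIM('a) * \<tau>) * indicator Q y"
      by (simp add: indicator_def)
  qed
  also have "\<dots> = (\<integral>\<^sup>+y\<in>Q. ennreal \<bar>f y\<bar> \<partial>lebesgue) + ennreal (2 ^ DIM('a) * \<tau>) * emeasure lebesgue Q"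
    by (subst nn_integral_add) (auto simp: nn_integral_cmult_indicator)
  also have "\<dots> \<le> 2 ^ DIM('a) * ennreal \<tau> * emeasure lebesgue Q + ennreal (2 ^ DIM('a) * \<tau>) * emeasure lebesgue Q"
    using up[OF assms] by (intro add_right_mono)
  also have "2 ^ DIM('a) * ennreal \<tau> = ennreal (2 ^ DIM('a) * \<tau>)"
    by (simp add: ennreal_mult' ennreal_power[symmetric])
  also have "ennreal (2 ^ DIM('a) * \<tau>) * emeasure lebesgue Q + ennreal (2 ^ DIM('a) * \<tau>) * emeasure lebesgue Q
      = ennreal (2 ^ Suc DIM('a) * \<tau>) * emeasure lebesgue Q"
    using lam by (simp add: distrib_right[symmetric] ennreal_plus[symmetric] del: ennreal_plus)
  finally show ?thesis .
qed

lemma UJ_mass: "ennreal \<tau> * emeasure lebesgue (\<Union>J) \<le> (\<integral>\<^sup>+x. ennreal \<bar>f x\<bar> \<partial>lebesgue)"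
proof -
  have "(\<integral>\<^sup>+x\<in>\<Union>J. ennreal \<tau> \<partial>lebesgue) \<le> (\<integral>\<^sup>+x\<in>\<Union>J. ennreal \<bar>f x\<bar> \<partial>lebesgue)"
  proof (rule nn_integral_Union_mono[OF J_countable J_sets Jd])
    fix Q assume Q: "Q \<in> J"
    then have "(\<integral>\<^sup>+x\<in>Q. ennreal \<tau> \<partial>lebesgue) = ennreal \<tau> * emeasure lebesgue Q"
      using J_sets by (intro nn_integral_cmult_indicator) blast
    then show "(\<integral>\<^sup>+x\<in>Q. ennreal \<tau> \<partial>lebesgue) \<le> (\<integral>\<^sup>+x\<in>Q. ennreal \<bar>f x\<bar> \<partial>lebesgue)"
      using low[OF Q] by simp
  qed auto
  also have "\<dots> \<le> (\<integral>\<^sup>+x. ennreal \<bar>f x\<bar> \<partial>lebesgue)"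
    by (intro nn_integral_mono) (auto simp: indicator_def)
  finally show ?thesis by (simp add: nn_integral_cmult_indicator del: emeasure_completion)
qed

lemma b_total: "(\<integral>\<^sup>+x. ennreal \<bar>b x\<bar> \<partial>lebesgue) \<le> 2 ^ Suc DIM('a) * (\<integral>\<^sup>+x. ennreal \<bar>f x\<bar> \<partial>lebesgue)"
proof -
  have "(\<integral>\<^sup>+x. ennreal \<bar>b x\<bar> \<partial>lebesgue) = (\<integral>\<^sup>+x\<in>\<Union>J. ennreal \<bar>b x\<bar> \<partial>lebesgue)"
    by (intro nn_integral_cong) (use b_supp in \<open>auto simp: indicator_def\<close>)
  also have "\<dots> \<le> (\<integral>\<^sup>+x\<in>\<Union>J. ennreal (2 ^ Suc DIM('a) * \<tau>) \<partial>lebesgue)"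
  proof (rule nn_integral_Union_mono[OF J_countable J_sets Jd])
    fix Q assume Q: "Q \<in> J"
    then have "(\<integral>\<^sup>+x\<in>Q. ennreal (2 ^ Suc DIM('a) * \<tau>) \<partial>lebesgue) = ennreal (2 ^ Suc DIM('a) * \<tau>) * emeasure lebesgue Q"
      using J_sets by (intro nn_integral_cmult_indicator) blast
    then show "(\<integral>\<^sup>+x\<in>Q. ennreal \<bar>b x\<bar> \<partial>lebesgue) \<le> (\<integral>\<^sup>+x\<in>Q. ennreal (2 ^ Suc DIM('a) * \<tau>) \<partial>lebesgue)"
      using b_mass[OF Q] by simp
  qed auto
  also have "\<dots> = ennreal (2 ^ Suc DIM('a) * \<tau>) * emeasure lebesgue (\<Union>J)"
    by (rule nn_integral_cmult_indicator) measurable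
  also have "\<dots> = 2 ^ Suc DIM('a) * (ennreal \<tau> * emeasure lebesgue (\<Union>J))"
  proof -
    have "ennreal (2 ^ Suc DIM('a) * \<tau>) = 2 ^ Suc DIM('a) * ennreal \<tau>"
      by (simp add: ennreal_mult' ennreal_power[symmetric] del: power_Suc)
    then show ?thesis by (simp only: mult.assoc)
  qed
  also have "\<dots> \<le> 2 ^ Suc DIM('a) * (\<integral>\<^sup>+x. ennreal \<bar>f x\<bar> \<partial>lebesgue)"
    by (intro mult_left_mono UJ_mass) auto
  finally show ?thesis .
qed

section \<open>Size of the exceptional set\<close>

lemma exceptional_sets [measurable]: "\<Omega> \<in> sets lebesgue"
  unfolding cz_exceptional_def using J_countable by (intro sets.countable_UN') (auto simp: hcube_lebesgue simp del: sets_completionI_sets)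

lemma exceptional_measure:
  "ennreal \<tau> * emeasure lebesgue \<Omega> \<le> ennreal (expansion TYPE('a) ^ DIM('a)) * (\<integral>\<^sup>+x. ennreal \<bar>f x\<bar> \<partial>lebesgue)"
proof -
  let ?N = "expansion TYPE('a)"
  have "emeasure lebesgue \<Omega> \<le> (\<integral>\<^sup>+Q. emeasure lebesgue (hcube (cube_center Q) (?N * cube_radius Q)) \<partial>count_space J)"
    unfolding cz_exceptional_def using J_countable hcube_lebesgue by (rule emeasure_UN_le_count_space)
  also have "\<dots> = (\<integral>\<^sup>+Q. ennreal (?N ^ DIM('a)) * emeasure lebesgue Q \<partial>count_space J)"
  proof (intro nn_integral_cong)
    fix Q assume "Q \<in> space (count_space J)"
    then have Q: "Q \<in> J" by simp
    note J_emeasure[OF Q]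
    moreover have "emeasure lebesgue (hcube (cube_center Q) (?N * cube_radius Q)) = ennreal ((2 * (?N * cube_radius Q)) ^ DIM('a))"
      using J_cube(2)[OF Q] expansion_ge[where 'a='a] by (intro emeasure_hcube) auto
    moreover have "(2 * (?N * cube_radius Q)) ^ DIM('a) = ?N ^ DIM('a) * (2 * cube_radius Q) ^ DIM('a)"
      by (simp add: power_mult_distrib mult_ac)
    ultimately show "emeasure lebesgue (hcube (cube_center Q) (?N * cube_radius Q)) = ennreal (?N ^ DIM('a)) * emeasure lebesgue Q"
      using expansion_ge[where 'a='a] by (simp only: ennreal_mult'[OF zero_le_power[OF order_trans[OF zero_le_numeral expansion_ge]]])
  qed
  also have "\<dots> = ennreal (?N ^ DIM('a)) * emeasure lebesgue (\<Union>J)"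
    using emeasure_disjoint_Union[OF J_countable J_sets Jd] by (simp add: nn_integral_cmult del: emeasure_completion)
  finally have "ennreal \<tau> * emeasure lebesgue \<Omega> \<le> ennreal \<tau> * (ennreal (?N ^ DIM('a)) * emeasure lebesgue (\<Union>J))"
    by (intro mult_left_mono) auto
  also have "\<dots> = ennreal (?N ^ DIM('a)) * (ennreal \<tau> * emeasure lebesgue (\<Union>J))"
    by (simp only: mult_ac)
  also have "\<dots> \<le> ennreal (?N ^ DIM('a)) * (\<integral>\<^sup>+x. ennreal \<bar>f x\<bar> \<partial>lebesgue)"
    by (intro mult_left_mono UJ_mass) auto
  finally show ?thesis .
qed

section \<open>Measurability and total mass of the potential\<close>

lemma potential_pair_measurable:
  "(\<lambda>(x, y). ennreal (\<eta> (s y / dist x y) / dist x y ^ DIM('a) * \<bar>b y\<bar>)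
      * indicator {y. y \<in> \<Union>J \<and> s y \<le> dist x y} y) \<in> borel_measurable (lebesgue \<Otimes>\<^sub>M lebesgue)"
proof -
  have [measurable]: "(\<lambda>p. s (snd p)) \<in> borel_measurable (lebesgue \<Otimes>\<^sub>M lebesgue)"
    "(\<lambda>p. b (snd p)) \<in> borel_measurable (lebesgue \<Otimes>\<^sub>M lebesgue)"
    "(\<lambda>p. indicator (\<Union>J) (snd p) :: ennreal) \<in> borel_measurable (lebesgue \<Otimes>\<^sub>M lebesgue)"
    by (rule measurable_compose[OF measurable_snd]; measurable)+
  have "(\<lambda>p::'a \<times> 'a. ennreal (\<eta> (s (snd p) / dist (fst p) (snd p)) / dist (fst p) (snd p) ^ DIM('a) * \<bar>b (snd p)\<bar>)
      * (indicator (\<Union>J) (snd p) * (if s (snd p) \<le> dist (fst p) (snd p) then 1 else 0)))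
      \<in> borel_measurable (lebesgue \<Otimes>\<^sub>M lebesgue)"
    by measurable
  also have "(\<lambda>p::'a \<times> 'a. ennreal (\<eta> (s (snd p) / dist (fst p) (snd p)) / dist (fst p) (snd p) ^ DIM('a) * \<bar>b (snd p)\<bar>)
      * (indicator (\<Union>J) (snd p) * (if s (snd p) \<le> dist (fst p) (snd p) then 1 else 0)))
    = (\<lambda>(x, y). ennreal (\<eta> (s y / dist x y) / dist x y ^ DIM('a) * \<bar>b y\<bar>)
      * indicator {y. y \<in> \<Union>J \<and> s y \<le> dist x y} y)"
    by (rule ext) (simp add: indicator_def split_beta)
  finally show ?thesis .
qed

lemma potential_measurable [measurable]: "\<Phi> \<in> borel_measurable lebesgue"
  unfolding cz_potential_def[abs_def]
  by (rule sigma_finite_measure.borel_measurable_nn_integral[OF sigma_finite_lebesgue potential_pair_measurable])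

text \<open>Tonelli: for each fixed \<open>y\<close> the integral in \<open>x\<close> is bounded by
  \<open>radial_const\<close>, whatever the size of the cube of \<open>y\<close>.\<close>

lemma potential_total: "(\<integral>\<^sup>+x. \<Phi> x \<partial>lebesgue) \<le> ennreal radial_const * (\<integral>\<^sup>+y. ennreal \<bar>b y\<bar> \<partial>lebesgue)"
proof -
  let ?F = "\<lambda>x y. ennreal (\<eta> (s y / dist x y) / dist x y ^ DIM('a) * \<bar>b y\<bar>) * indicator {y. y \<in> \<Union>J \<and> s y \<le> dist x y} y"
  have "(\<integral>\<^sup>+x. \<Phi> x \<partial>lebesgue) = (\<integral>\<^sup>+x. (\<integral>\<^sup>+y. ?F x y \<partial>lebesgue) \<partial>lebesgue)"
    unfolding cz_potential_def ..
  also have "\<dots> = (\<integral>\<^sup>+y. (\<integral>\<^sup>+x. ?F x y \<partial>lebesgue) \<partial>lebesgue)"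
    by (rule lebesgue_pair.Fubini'[OF potential_pair_measurable, symmetric])
  also have "\<dots> \<le> (\<integral>\<^sup>+y. ennreal radial_const * ennreal \<bar>b y\<bar> \<partial>lebesgue)"
  proof (intro nn_integral_mono)
    fix y
    show "(\<integral>\<^sup>+x. ?F x y \<partial>lebesgue) \<le> ennreal radial_const * ennreal \<bar>b y\<bar>"
    proof (cases "y \<in> \<Union>J")
      case True
      have "closed {x. s y \<le> dist x y}" by (intro closed_Collect_le continuous_intros)
      then have [measurable]: "{x. s y \<le> dist x y} \<in> sets lebesgue" by (simp add: borel_closed)
      have "?F x y = ennreal \<bar>b y\<bar> * (ennreal (\<eta> (s y / dist x y) / dist x y ^ DIM('a)) * indicator {x. s y \<le> dist x y} x)" for x
        using True by (subst ennreal_mult'') (auto simp: indicator_def mult_ac)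
      then have "(\<integral>\<^sup>+x. ?F x y \<partial>lebesgue)
          = (\<integral>\<^sup>+x. ennreal \<bar>b y\<bar> * (ennreal (\<eta> (s y / dist x y) / dist x y ^ DIM('a)) * indicator {x. s y \<le> dist x y} x) \<partial>lebesgue)"
        by simp
      also have "\<dots> = ennreal \<bar>b y\<bar> * (\<integral>\<^sup>+x\<in>{x. s y \<le> dist x y}. ennreal (\<eta> (s y / dist x y) / dist x y ^ DIM('a)) \<partial>lebesgue)"
        by (intro nn_integral_cmult) measurable
      also have "\<dots> \<le> ennreal \<bar>b y\<bar> * ennreal radial_const"
        using s_pos[OF True] by (intro mult_left_mono radial_bound) auto
      finally show ?thesis by (simp add: mult.commute)
    qed simp
  qed
  also have "\<dots> = ennreal radial_const * (\<integral>\<^sup>+y. ennreal \<bar>b y\<bar> \<partial>lebesgue)"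
    by (rule nn_integral_cmult) measurable
  finally show ?thesis .
qed

section \<open>Pointwise bounds for the variation\<close>

lemma outside_exceptional:
  assumes "x \<notin> \<Omega>" "y \<in> \<Union>J"
  shows "(1 + real DIM('a)) * s y \<le> dist x y"
proof -
  obtain Q where Q: "Q \<in> J" "y \<in> Q" using assms by blast
  have "x \<notin> hcube (cube_center Q) (expansion TYPE('a) * cube_radius Q)"
    using assms(1) Q by (auto simp: cz_exceptional_def)
  then have "expansion TYPE('a) * cube_radius Q - cube_radius Q \<le> dist y x"
    by (rule dist_hcube_ge[OF J_mem[OF Q]])
  then show ?thesis
    unfolding s_eq[OF Q] by (simp add: expansion_def dist_commute algebra_simps)
qed

text \<open>Stated for subfamilies because, for a point inside a cube \<open>R\<close>, only the bad
  cubes off 3R are known to be far away.\<close>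

lemma bad_part_bound:
  assumes J': "J' \<subseteq> J" and far: "\<And>y. y \<in> \<Union>J' \<Longrightarrow> s y \<le> dist x y" and P: "0 \<le> P"
    and \<Phi>: "(\<integral>\<^sup>+y\<in>\<Union>J'. ennreal (\<eta> (s y / dist x y) / dist x y ^ DIM('a) * \<bar>b y\<bar>) \<partial>lebesgue) \<le> ennreal P"
  shows "V (\<lambda>y. b y * indicator (\<Union>J') y) x \<le> ereal (C * P + 2 * (atom_const * sqrt (2 ^ Suc DIM('a) * \<tau> * P)))"
proof (rule var_op_atoms[where J=J' and s=s])
  show c: "countable J'" using J' J_countable countable_subset by blast
  show s: "J' \<subseteq> sets lebesgue" using J' J_sets by blast
  show "disjoint J'" using Jd J' by (auto simp: disjoint_def)
  have U: "\<Union>J' \<in> sets lebesgue" using c s by (intro sets.countable_Union)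
  show "integrable lebesgue (\<lambda>y. b y * indicator (\<Union>J') y)"
    using U b_integrable by (rule integrable_real_mult_indicator)
  show "0 < s y" if "y \<in> \<Union>J'" for y using that J' s_pos by blast
  show "s y = s z" if "Q \<in> J'" "y \<in> Q" "z \<in> Q" for Q y z using that J' s_eq by (metis subsetD)
  show "dist y z \<le> s y / 2" if "Q \<in> J'" "y \<in> Q" "z \<in> Q" for Q y z
  proof -
    have Q: "Q \<in> J" using that J' by blast
    have "dist y z \<le> 2 * real DIM('a) * cube_radius Q"
      by (rule dist_hcube_le[OF J_mem[OF Q that(2)] J_mem[OF Q that(3)]])
    then show ?thesis unfolding s_eq[OF Q that(2)] by linarith
  qed
  have cong: "b y * indicator (\<Union>J') y = b y" if "Q \<in> J'" "y \<in> Q" for Q y using that by (auto simp: indicator_def)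
  show "(LINT y:Q|lebesgue. b y * indicator (\<Union>J') y) = 0" if "Q \<in> J'" for Q
  proof -
    have "(LINT y:Q|lebesgue. b y * indicator (\<Union>J') y) = (LINT y:Q|lebesgue. b y)"
      using that s cong[OF that] by (intro set_lebesgue_integral_cong) auto
    then show ?thesis using b_cancel that J' by auto
  qed
  show "(\<integral>\<^sup>+y\<in>Q. ennreal \<bar>b y * indicator (\<Union>J') y\<bar> \<partial>lebesgue) \<le> ennreal (2 ^ Suc DIM('a) * \<tau>) * emeasure lebesgue Q" if "Q \<in> J'" for Q
  proof -
    have "(\<integral>\<^sup>+y\<in>Q. ennreal \<bar>b y * indicator (\<Union>J') y\<bar> \<partial>lebesgue) \<le> (\<integral>\<^sup>+y\<in>Q. ennreal \<bar>b y\<bar> \<partial>lebesgue)"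
      by (intro nn_integral_mono) (auto simp: indicator_def)
    also have "\<dots> \<le> ennreal (2 ^ Suc DIM('a) * \<tau>) * emeasure lebesgue Q"
      using that J' by (intro b_mass) auto
    finally show ?thesis .
  qed
  have "(\<integral>\<^sup>+y\<in>\<Union>J'. ennreal (\<eta> (s y / dist x y) / dist x y ^ DIM('a) * \<bar>b y * indicator (\<Union>J') y\<bar>) \<partial>lebesgue)
    = (\<integral>\<^sup>+y\<in>\<Union>J'. ennreal (\<eta> (s y / dist x y) / dist x y ^ DIM('a) * \<bar>b y\<bar>) \<partial>lebesgue)"
    by (intro nn_integral_cong) (auto simp: indicator_def)
  then show "(\<integral>\<^sup>+y\<in>\<Union>J'. ennreal (\<eta> (s y / dist x y) / dist x y ^ DIM('a) * \<bar>b y * indicator (\<Union>J') y\<bar>) \<partial>lebesgue) \<le> ennreal P"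
    using \<Phi> by simp
  show "s y \<le> dist x y" if "y \<in> \<Union>J'" for y using that by (rule far)
qed (use lam P in auto)

definition bad_const :: "real \<Rightarrow> real" where
  "bad_const P = C * P + 2 * (atom_const * sqrt (2 ^ Suc DIM('a) * P))"

text \<open>The potential and the mass density are both multiples of \<tau>, so the root of their
  product is linear in \<tau>.\<close>

lemma bad_const_scale: "0 \<le> P \<Longrightarrow> C * (P * \<tau>) + 2 * (atom_const * sqrt (2 ^ Suc DIM('a) * \<tau> * (P * \<tau>))) = bad_const P * \<tau>"
proof -
  have "2 ^ Suc DIM('a) * \<tau> * (P * \<tau>) = 2 ^ Suc DIM('a) * P * \<tau>\<^sup>2" by (simp add: power2_eq_square)
  then have "sqrt (2 ^ Suc DIM('a) * \<tau> * (P * \<tau>)) = sqrt (2 ^ Suc DIM('a) * P) * \<tau>"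
    using lam by (simp only: real_sqrt_mult) (simp add: real_sqrt_mult)
  then show ?thesis by (simp add: bad_const_def algebra_simps)
qed

lemma variation_off_exceptional:
  assumes x: "x \<notin> \<Omega>" and pot: "\<Phi> x \<le> ennreal (P * \<tau>)" and P: "0 \<le> P" and good: "V g x \<le> ereal (A * \<tau>)"
  shows "V f x \<le> ereal ((A + bad_const P) * \<tau>)"
proof -
  have far: "s y \<le> dist x y" if "y \<in> \<Union>J" for y
  proof -
    have "1 * s y \<le> (1 + real DIM('a)) * s y" using s_pos[OF that] by (intro mult_right_mono) auto
    then show ?thesis using outside_exceptional[OF x that] by simp
  qed
  have "(\<integral>\<^sup>+y\<in>\<Union>J. ennreal (\<eta> (s y / dist x y) / dist x y ^ DIM('a) * \<bar>b y\<bar>) \<partial>lebesgue) = \<Phi> x"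
    unfolding cz_potential_def using far by (intro nn_integral_cong) (auto simp: indicator_def)
  then have "V (\<lambda>y. b y * indicator (\<Union>J) y) x \<le> ereal (C * (P * \<tau>) + 2 * (atom_const * sqrt (2 ^ Suc DIM('a) * \<tau> * (P * \<tau>))))"
    using pot P lam far by (intro bad_part_bound) auto
  moreover have "(\<lambda>y. b y * indicator (\<Union>J) y) = b"
  proof (rule ext)
    fix y show "b y * indicator (\<Union>J) y = b y"
    proof (cases "y \<in> \<Union>J")
      case False
      from b_supp[OF this] show ?thesis by simp
    qed simp
  qed
  ultimately have bad: "V b x \<le> ereal (bad_const P * \<tau>)" by (simp only: bad_const_scale[OF P])
  have "V f x = V (\<lambda>y. g y + b y) x" by (simp add: cz_bad_def)
  also have "\<dots> \<le> V g x + V b x" by (rule var_op_add_le[OF g_integrable b_integrable])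
  also have "\<dots> \<le> ereal (A * \<tau>) + ereal (bad_const P * \<tau>)" by (intro add_mono good bad)
  finally show ?thesis by (simp add: algebra_simps)
qed

text \<open>\<open>2 * A\<close> bounds the good part off 3R at the good point, the middle term
  moves that bound to another point of the cube for a function bounded by 2^d \<tau>, and the last
  term is the bad part with the potential enlarged by the same move.\<close>

definition cube_const :: "real \<Rightarrow> real \<Rightarrow> real" where
  "cube_const A P = 2 * A + comparison_const * 2 ^ DIM('a) + bad_const ((1 + real DIM('a)) ^ Suc DIM('a) * P)"

text \<open>One good point controls the whole cube: two points of \<open>R\<close> are at most 2 d u
  apart, while everything off 3R is at distance at least 2 u from \<open>R\<close>. Distances from
  the two points to anything off 3R therefore agree up to the factor 1 + d.\<close>

lemma variation_on_cube:
  assumes R: "R \<in> dyadic_sub c0 r0" and x: "x \<in> R" and x': "x' \<in> R" "x' \<notin> \<Omega>"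
    and pot: "\<Phi> x' \<le> ennreal (P * \<tau>)" and P: "0 \<le> P"
    and good: "V g x' \<le> ereal (A * \<tau>)"
    and good3: "V (\<lambda>y. g y * indicator (dilate 3 R) y) x' \<le> ereal (A * \<tau>)"
  shows "V (\<lambda>y. f y - f y * indicator (dilate 3 R) y) x \<le> ereal (cube_const A P * \<tau>)"
proof -
  let ?d = "DIM('a)" and ?D = "real DIM('a)" and ?T = "dilate 3 R"
  obtain k z where kz: "z \<in> hcube c0 r0" "R = dcell c0 r0 k z" "cube_radius R = r0 / 2 ^ k"
    and Rc: "R = hcube (cube_center R) (cube_radius R)" "0 < cube_radius R"
    using R by (rule dyadic_subE[OF r0])
  obtain cR u where cRu: "cube_center R = cR" "cube_radius R = u" by blast
  have u: "0 < u" "R = hcube cR u" "u = r0 / 2 ^ k"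
    using Rc(2) Rc(1)[unfolded cRu] kz(3) unfolding cRu by (simp_all only:)
  have T: "?T = hcube cR (3 * u)" unfolding u(2) by (rule dilate_hcube[OF u(1)])
  have Tm [measurable]: "?T \<in> sets lebesgue" unfolding T by (rule hcube_lebesgue)
  have out: "2 * u \<le> dist w y" if "w \<in> R" "y \<notin> ?T" for w y
    using dist_hcube_ge[of w cR u y "3 * u"] that(1)[unfolded u(2)] that(2)[unfolded T] by simp
  have dxx': "dist x x' \<le> ?D * (2 * u)"
    using dist_hcube_le[OF x[unfolded u(2)] x'(1)[unfolded u(2)]] by (simp add: mult_ac)
  \<comment> \<open>For cubes no larger than \<open>R\<close> this is the grid structure. A larger
    bad cube has half side at least \<open>2 * u\<close>; if it met 3R, the coordinates of
    \<open>x'\<close> would differ by at most two of its half sides from those of one of its points,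
    so its dilate would contain \<open>x'\<close>, which lies outside the exceptional set.\<close>
  have dich: "Q \<subseteq> ?T \<or> Q \<inter> ?T = {}" if Q: "Q \<in> J" for Q
  proof -
    have "Q \<in> dyadic_sub c0 r0" using Q JD by blast
    then obtain k' w where Qk: "w \<in> hcube c0 r0" "Q = dcell c0 r0 k' w" "cube_radius Q = r0 / 2 ^ k'"
      by (rule dyadic_subE[OF r0])
    have Qr: "0 < cube_radius Q" by (rule J_cube(2)[OF Q])
    show ?thesis
    proof (cases "k \<le> k'")
      case True
      then show ?thesis unfolding Qk(2) kz(2) by (rule dcell_triple_cases[OF r0])
    next
      case False
      have "Q \<inter> ?T = {}"
      proof (rule ccontr)
        assume "Q \<inter> ?T \<noteq> {}"
        then obtain y where y: "y \<in> Q" "y \<in> ?T" by blast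
        have "(2::real) ^ Suc k' \<le> 2 ^ k" using False by (intro power_increasing) auto
        then have "r0 / 2 ^ k \<le> r0 / 2 ^ Suc k'" using r0 by (intro divide_left_mono) auto
        then have ur: "2 * u \<le> cube_radius Q" unfolding u(3) Qk(3) by (simp add: field_simps)
        have "x' \<in> hcube (cube_center Q) (expansion TYPE('a) * cube_radius Q)"
          unfolding hcube_def
        proof (intro CollectI ballI)
          fix i :: 'a assume i: "i \<in> Basis"
          have "x' \<in> hcube cR u" "y \<in> hcube cR (3 * u)" "y \<in> hcube (cube_center Q) (cube_radius Q)"
            using x'(1)[unfolded u(2)] y(2)[unfolded T] J_mem[OF Q y(1)] by (simp_all only:)
          then have "cR \<bullet> i - u \<le> x' \<bullet> i" "x' \<bullet> i < cR \<bullet> i + u"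
            "cR \<bullet> i - 3 * u \<le> y \<bullet> i" "y \<bullet> i < cR \<bullet> i + 3 * u"
            "cube_center Q \<bullet> i - cube_radius Q \<le> y \<bullet> i" "y \<bullet> i < cube_center Q \<bullet> i + cube_radius Q"
            using i by (auto simp: hcube_def)
          moreover have "9 * cube_radius Q \<le> expansion TYPE('a) * cube_radius Q"
            using expansion_ge Qr by (intro mult_right_mono) auto
          ultimately show "cube_center Q \<bullet> i - expansion TYPE('a) * cube_radius Q \<le> x' \<bullet> i \<and> x' \<bullet> i < cube_center Q \<bullet> i + expansion TYPE('a) * cube_radius Q"
            using ur Qr by linarith
        qed
        then show False using x'(2) Q by (auto simp: cz_exceptional_def)
      qed
      then show ?thesis ..
    qed
  qed
  define J' where "J' = {Q \<in> J. Q \<inter> ?T = {}}"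
  have J'J: "J' \<subseteq> J" by (auto simp: J'_def)
  have notT: "y \<notin> ?T" if "y \<in> \<Union>J'" for y using that by (auto simp: J'_def)
  \<comment> \<open>By the dichotomy, cutting \<open>b\<close> off at 3R keeps or removes whole
    cubes, so the kept atoms still have mean zero.\<close>
  have beq: "b y * indicator (\<Union>J') y = b y * indicator (- ?T) y" for y
  proof (cases "y \<in> \<Union>J")
    case True
    then obtain Q where Q: "Q \<in> J" "y \<in> Q" by blast
    have "y \<in> \<Union>J' \<longleftrightarrow> y \<notin> ?T" using dich[OF Q(1)] Q notT by (auto simp: J'_def)
    then show ?thesis by (simp add: indicator_def)
  qed (simp add: b_supp)
  \<comment> \<open>Moving from \<open>x'\<close> to \<open>x\<close> shrinks the distance by at
    most 1 + d. This costs 1 + d in \<eta> and (1 + d)^d in the kernel weight, and the margin 1 + d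
    at \<open>x'\<close> leaves \<open>s y \<le> dist x y\<close>.\<close>
  have cmp: "s y \<le> dist x y \<and> s y \<le> dist x' y \<and> \<eta> (s y / dist x y) / dist x y ^ ?d \<le> (1 + ?D) ^ Suc ?d * (\<eta> (s y / dist x' y) / dist x' y ^ ?d)"
    if y: "y \<in> \<Union>J'" for y
  proof -
    have yJ: "y \<in> \<Union>J" using y J'J by blast
    have sp: "0 < s y" by (rule s_pos[OF yJ])
    have f': "(1 + ?D) * s y \<le> dist x' y" by (rule outside_exceptional[OF x'(2) yJ])
    have "dist x' y \<le> dist x x' + dist x y" using dist_triangle[of x' y x] by (simp add: dist_commute)
    also have "\<dots> \<le> ?D * dist x y + dist x y"
    proof -
      have "?D * (2 * u) \<le> ?D * dist x y" using out[OF x notT[OF y]] by (intro mult_left_mono) auto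
      then show ?thesis using dxx' by linarith
    qed
    finally have cd: "dist x' y \<le> (1 + ?D) * dist x y" by (simp add: algebra_simps)
    have D0: "0 < 1 + ?D" by simp
    have cd': "dist x' y / (1 + ?D) \<le> dist x y" using cd D0 by (simp add: pos_divide_le_eq mult.commute)
    have "(1 + ?D) * s y \<le> (1 + ?D) * dist x y" using f' cd by linarith
    then have sd: "s y \<le> dist x y" using D0 by (simp only: mult_le_cancel_left_pos)
    have "1 * s y \<le> (1 + ?D) * s y" using sp by (intro mult_right_mono) auto
    then have sd': "s y \<le> dist x' y" using f' by simp
    have pos: "0 < dist x y" "0 < dist x' y" using sp sd sd' by linarith+
    have "s y / dist x y \<le> (1 + ?D) * (s y / dist x' y)"
    proof -
      have "s y / dist x y \<le> s y / (dist x' y / (1 + ?D))"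
        using cd' pos sp D0 by (intro divide_left_mono) (auto intro: divide_pos_pos)
      then show ?thesis by (simp add: mult.commute)
    qed
    then have "\<eta> (s y / dist x y) \<le> \<eta> (real (Suc ?d) * (s y / dist x' y))"
      by (intro \<eta>_mono) simp
    also have "\<dots> \<le> (1 + ?D) * \<eta> (s y / dist x' y)"
      using \<eta>_mult[of "s y / dist x' y" "Suc ?d"] sp by simp
    finally have e1: "\<eta> (s y / dist x y) \<le> (1 + ?D) * \<eta> (s y / dist x' y)" .
    have "(dist x' y / (1 + ?D)) ^ ?d \<le> dist x y ^ ?d" using cd' D0 by (intro power_mono) auto
    then have "1 / dist x y ^ ?d \<le> 1 / (dist x' y / (1 + ?D)) ^ ?d"
      using pos D0 by (intro divide_left_mono) (auto intro!: divide_pos_pos mult_pos_pos zero_less_power)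
    then have "1 / dist x y ^ ?d \<le> (1 + ?D) ^ ?d / dist x' y ^ ?d"
      by (simp add: power_divide)
    then have "\<eta> (s y / dist x y) * (1 / dist x y ^ ?d) \<le> ((1 + ?D) * \<eta> (s y / dist x' y)) * ((1 + ?D) ^ ?d / dist x' y ^ ?d)"
      using e1 by (intro mult_mono) (auto simp: \<eta>_nonneg)
    then have "\<eta> (s y / dist x y) / dist x y ^ ?d \<le> (1 + ?D) ^ Suc ?d * (\<eta> (s y / dist x' y) / dist x' y ^ ?d)"
      by (simp add: mult_ac)
    then show ?thesis using sd sd' by blast
  qed
  let ?c = "(1 + ?D) ^ Suc ?d"
  have "(\<integral>\<^sup>+y\<in>\<Union>J'. ennreal (\<eta> (s y / dist x y) / dist x y ^ ?d * \<bar>b y\<bar>) \<partial>lebesgue)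
     \<le> (\<integral>\<^sup>+y. ennreal ?c * (ennreal (\<eta> (s y / dist x' y) / dist x' y ^ ?d * \<bar>b y\<bar>) * indicator {y. y \<in> \<Union>J \<and> s y \<le> dist x' y} y) \<partial>lebesgue)"
  proof (intro nn_integral_mono)
    fix y
    show "ennreal (\<eta> (s y / dist x y) / dist x y ^ ?d * \<bar>b y\<bar>) * indicator (\<Union>J') y
      \<le> ennreal ?c * (ennreal (\<eta> (s y / dist x' y) / dist x' y ^ ?d * \<bar>b y\<bar>) * indicator {y. y \<in> \<Union>J \<and> s y \<le> dist x' y} y)"
    proof (cases "y \<in> \<Union>J'")
      case True
      have "\<eta> (s y / dist x y) / dist x y ^ ?d * \<bar>b y\<bar> \<le> ?c * (\<eta> (s y / dist x' y) / dist x' y ^ ?d) * \<bar>b y\<bar>"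
        using cmp[OF True] by (intro mult_right_mono) auto
      then have "ennreal (\<eta> (s y / dist x y) / dist x y ^ ?d * \<bar>b y\<bar>) \<le> ennreal (?c * (\<eta> (s y / dist x' y) / dist x' y ^ ?d * \<bar>b y\<bar>))"
        by (intro ennreal_leI) (simp only: mult.assoc)
      also have "\<dots> = ennreal ?c * ennreal (\<eta> (s y / dist x' y) / dist x' y ^ ?d * \<bar>b y\<bar>)"
        by (intro ennreal_mult') simp
      finally show ?thesis using True cmp[OF True] J'J by (auto simp: indicator_def simp del: power_Suc)
    qed simp
  qed
  also have "\<dots> = ennreal ?c * \<Phi> x'"
    unfolding cz_potential_def
  proof (rule nn_integral_cmult)
    have "{y \<in> space lebesgue. y \<in> \<Union>J \<and> s y \<le> dist x' y} \<in> sets lebesgue" by measurable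
    then have [measurable]: "{y. y \<in> \<Union>J \<and> s y \<le> dist x' y} \<in> sets lebesgue" by simp
    show "(\<lambda>y. ennreal (\<eta> (s y / dist x' y) / dist x' y ^ ?d * \<bar>b y\<bar>) * indicator {y. y \<in> \<Union>J \<and> s y \<le> dist x' y} y) \<in> borel_measurable lebesgue"
      by measurable
  qed
  also have "\<dots> \<le> ennreal ?c * ennreal (P * \<tau>)" by (intro mult_left_mono pot) auto
  also have "\<dots> = ennreal (?c * P * \<tau>)" by (subst ennreal_mult'[symmetric]) (simp_all only: mult.assoc, simp)
  finally have pot': "(\<integral>\<^sup>+y\<in>\<Union>J'. ennreal (\<eta> (s y / dist x y) / dist x y ^ ?d * \<bar>b y\<bar>) \<partial>lebesgue) \<le> ennreal (?c * P * \<tau>)" .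
  have cP: "0 \<le> ?c * P" using P by simp
  have "V (\<lambda>y. b y * indicator (\<Union>J') y) x
      \<le> ereal (C * (?c * P * \<tau>) + 2 * (atom_const * sqrt (2 ^ Suc ?d * \<tau> * (?c * P * \<tau>))))"
    using cmp cP lam by (intro bad_part_bound[OF J'J _ _ pot']) auto
  then have bad: "V (\<lambda>y. b y * indicator (- ?T) y) x \<le> ereal (bad_const (?c * P) * \<tau>)"
    by (simp only: bad_const_scale[OF cP] beq)
  define gT where "gT y = g y * indicator ?T y" for y
  define gF where "gF y = g y * indicator (- ?T) y" for y
  have gTi: "integrable lebesgue gT" unfolding gT_def using Tm g_integrable by (rule integrable_real_mult_indicator)
  have nTm: "- ?T \<in> sets lebesgue" using Tm by (simp add: Compl_in_sets_lebesgue)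
  have gFi: "integrable lebesgue gF" unfolding gF_def using nTm g_integrable by (rule integrable_real_mult_indicator)
  have bFi: "integrable lebesgue (\<lambda>y. b y * indicator (- ?T) y)" using nTm b_integrable by (rule integrable_real_mult_indicator)
  \<comment> \<open>At the good point the part of \<open>g\<close> off 3R is handled by sublinearity
    as the difference of \<open>g\<close> and its restriction to 3R; \<open>good\<close> and
    \<open>good3\<close> bound the two.\<close>
  have "gF = (\<lambda>y. g y + - gT y)" by (auto simp: gF_def gT_def indicator_def)
  then have "V gF x' \<le> V g x' + V (\<lambda>y. - gT y) x'"
    using var_op_add_le[OF g_integrable, of "\<lambda>y. - gT y" x'] gTi by simp
  also have "\<dots> \<le> ereal (A * \<tau>) + ereal (A * \<tau>)"
    using good good3 unfolding var_op_minus gT_def by (intro add_mono)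
  finally have gx': "V gF x' \<le> ereal (2 * A * \<tau>)" by (simp add: mult.assoc)
  have "V gF x \<le> V gF x' + ereal (comparison_const * (2 ^ ?d * \<tau>))"
  proof (rule var_op_smooth[OF _ dxx' gFi])
    show "0 < 2 * u" using u by simp
    show "\<bar>gF y\<bar> \<le> 2 ^ ?d * \<tau>" for y
      using g_bound[of y] lam by (auto simp: gF_def indicator_def)
    show "2 * u \<le> dist x y \<and> 2 * u \<le> dist x' y" if "gF y \<noteq> 0" for y
      using that out[OF x] out[OF x'(1)] by (auto simp: gF_def indicator_def split: if_splits)
  qed
  also have "\<dots> \<le> ereal (2 * A * \<tau>) + ereal (comparison_const * (2 ^ ?d * \<tau>))"
    by (intro add_right_mono gx')
  finally have gx: "V gF x \<le> ereal (2 * A * \<tau>) + ereal (comparison_const * (2 ^ ?d * \<tau>))" .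
  have "(\<lambda>y. f y - f y * indicator ?T y) = (\<lambda>y. gF y + b y * indicator (- ?T) y)"
    by (auto simp: gF_def cz_bad_def indicator_def)
  then have "V (\<lambda>y. f y - f y * indicator ?T y) x \<le> V gF x + V (\<lambda>y. b y * indicator (- ?T) y) x"
    using var_op_add_le[OF gFi bFi] by simp
  also have "\<dots> \<le> (ereal (2 * A * \<tau>) + ereal (comparison_const * (2 ^ ?d * \<tau>))) + ereal (bad_const (?c * P) * \<tau>)"
    by (intro add_mono gx bad)
  also have "\<dots> = ereal (cube_const A P * \<tau>)"
    by (simp add: cube_const_def algebra_simps)
  finally show ?thesis .
qed

end

end

subsection \<open>The stopping family\<close>

lemma ennreal_mult_left_cancel_le:
  assumes "0 < c" "ennreal c * a \<le> ennreal c * b"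
  shows "a \<le> b"
  using assms by (simp add: ennreal_mult_le_mult_iff)

lemma ennreal_mult_mult: "0 \<le> a \<Longrightarrow> ennreal (a * b) * X = ennreal a * (ennreal b * X)"
  by (simp only: ennreal_mult' mult.assoc)

lemma weak_constants:
  fixes B q \<kappa> :: real
  assumes "0 \<le> B" "0 < q" "0 < \<kappa>"
  obtains A where "0 < A" "(B / A) powr q \<le> \<kappa>"
proof
  let ?k = "\<kappa> powr (1 / q)"
  have k: "0 < ?k" using assms by simp
  show "0 < B / ?k + 1" using assms k by (intro add_nonneg_pos) auto
  then have "B / (B / ?k + 1) \<le> ?k" using assms k by (simp add: pos_divide_le_eq distrib_left)
  then have "(B / (B / ?k + 1)) powr q \<le> ?k powr q"
    using assms k by (intro powr_mono2) auto
  then show "(B / (B / ?k + 1)) powr q \<le> \<kappa>" using assms by (simp add: powr_powr)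
qed

text \<open>\<open>E\<close> takes at most half of \<open>R\<close> and \<open>Z\<close> at most a
  quarter, so at least a quarter of \<open>R\<close> remains up to a null set.\<close>

lemma exists_good_point:
  fixes R E Z N :: "'a::euclidean_space set"
  assumes R: "R \<in> sets lebesgue" "0 < emeasure lebesgue R" "emeasure lebesgue R < \<infinity>"
    and m: "E \<in> sets lebesgue" "Z \<in> sets lebesgue" "N \<in> sets lebesgue"
    and E: "emeasure lebesgue (R \<inter> E) \<le> ennreal (1/2) * emeasure lebesgue R"
    and Z: "emeasure lebesgue Z \<le> ennreal (1/4) * emeasure lebesgue R"
    and N: "emeasure lebesgue N = 0"
  obtains x where "x \<in> R" "x \<notin> E" "x \<notin> Z" "x \<notin> N"
proof -
  have "\<not> R \<subseteq> (R \<inter> E) \<union> Z \<union> N"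
  proof
    assume sub: "R \<subseteq> (R \<inter> E) \<union> Z \<union> N"
    obtain t where t: "emeasure lebesgue R = ennreal t" "0 < t"
      using R(2,3) by (cases "emeasure lebesgue R") (auto simp del: emeasure_completion)
    have "emeasure lebesgue R \<le> emeasure lebesgue ((R \<inter> E) \<union> Z \<union> N)"
      using sub R m by (intro emeasure_mono) auto
    also have "\<dots> \<le> emeasure lebesgue (R \<inter> E) + emeasure lebesgue Z + emeasure lebesgue N"
      using R m by (intro order_trans[OF emeasure_subadditive] add_right_mono emeasure_subadditive) auto
    also have "\<dots> \<le> ennreal (1/2) * emeasure lebesgue R + ennreal (1/4) * emeasure lebesgue R + 0"
      using E Z N by (intro add_mono) (auto simp del: emeasure_completion)
    also have "\<dots> = ennreal (3/4 * t)"
    proof -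
      have "ennreal (1/2) * ennreal t = ennreal (1/2 * t)" "ennreal (1/4) * ennreal t = ennreal (1/4 * t)"
        by (rule ennreal_mult'[symmetric], simp)+
      moreover have "ennreal (1/2 * t) + ennreal (1/4 * t) + 0 = ennreal (1/2 * t + 1/4 * t)"
        using t(2) by (subst ennreal_plus) auto
      moreover have "1/2 * t + 1/4 * t = 3/4 * t" by simp
      ultimately show ?thesis unfolding t(1) by (simp only:)
    qed
    finally show False unfolding t using t(2) by (simp add: ennreal_le_iff)
  qed
  then show ?thesis using that by blast
qed

context variation_kernel
begin

text \<open>The core result for functions that are bounded and supported at every point and have
  positive mean \<open>m\<close> on the cube. Since \<open>G\<close> is disjoint, the sum over its
  cubes has at most one term at \<open>x\<close>, which gives the two alternatives of the
  conclusion.\<close>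

lemma exceptional_family:
  assumes q: "1 < q" and bd: "var_bounded_Lq K \<rho> q" and eps: "0 < \<epsilon>" "\<epsilon> < 1"
  obtains C0 where "0 < C0"
    "\<And>c0 r0 f M m. \<lbrakk>0 < r0; f \<in> borel_measurable lebesgue; \<And>x. \<bar>f x\<bar> \<le> M; \<And>x. x \<notin> hcube c0 r0 \<Longrightarrow> f x = 0;
      0 < m; (\<integral>\<^sup>+x. ennreal \<bar>f x\<bar> \<partial>lebesgue) = ennreal m * emeasure lebesgue (hcube c0 r0)\<rbrakk> \<Longrightarrow>
      \<exists>F. F \<subseteq> dyadic_sub c0 r0 \<and> disjoint F \<and>
        emeasure lebesgue (\<Union>F) \<le> ennreal \<epsilon> * emeasure lebesgue (hcube c0 r0) \<and>
        (\<forall>G. G \<subseteq> dyadic_sub c0 r0 \<longrightarrow> disjoint G \<longrightarrow> (\<forall>Q\<in>F. \<exists>R\<in>G. Q \<subseteq> R) \<longrightarrow>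
          (AE x in lebesgue. x \<in> hcube c0 r0 \<longrightarrow>
            (\<forall>R\<in>G. x \<in> R \<longrightarrow> \<bar>V f x - V (\<lambda>y. f y * indicator (dilate 3 R) y) x\<bar> \<le> ereal (C0 * m)) \<and>
            (x \<notin> \<Union>G \<longrightarrow> V f x \<le> ereal (C0 * m))))"
proof -
  let ?d = "DIM('a)"
  obtain B where B: "0 \<le> B" and weak:
    "\<And>h S \<Gamma> t. \<lbrakk>h \<in> borel_measurable lebesgue; \<And>x. \<bar>h x\<bar> \<le> \<Gamma>; \<And>x. x \<notin> S \<Longrightarrow> h x = 0; S \<in> lmeasurable; 0 < t\<rbrakk> \<Longrightarrow>
      (AE x in lebesgue. V h x \<noteq> \<infinity>) \<and>
      (\<exists>Z\<in>sets lebesgue. (AE x in lebesgue. x \<notin> Z \<longrightarrow> V h x \<le> ereal t) \<and>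
         emeasure lebesgue Z \<le> ennreal ((B * \<Gamma> / t) powr q) * emeasure lebesgue S)"
    using var_bounded_Lq_weak[OF q bd] by blast
  \<comment> \<open>Chosen so that 2^d \<theta> = 1/2: the parent of a stopping cube has density at
    most \<theta>, so \<open>E\<close> fills at most half of the stopping cube.\<close>
  define \<theta> :: real where "\<theta> = 1 / 2 ^ Suc ?d"
  have \<theta>: "0 < \<theta>" "\<theta> \<le> 1 / 2" by (auto simp: \<theta>_def divide_simps)
  have \<epsilon>\<theta>: "0 < \<epsilon> * \<theta>" "\<epsilon> * \<theta> \<le> 1 / 2" "\<epsilon> * \<theta> \<le> \<theta>"
    using eps \<theta> mult_mono[of \<epsilon> 1 \<theta> "1/2"] mult_right_mono[of \<epsilon> 1 \<theta>] by auto
  \<comment> \<open>The first bound is the share of the initial cube allowed to \<open>Zg\<close>.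
    The second makes the exceptional set of g restricted to 3R at most a quarter of
    \<open>R\<close>, as 3R has 3^d times its volume.\<close>
  define \<kappa> where "\<kappa> = min (\<epsilon> * \<theta> / 4) (1 / (4 * 3 ^ ?d))"
  have \<kappa>: "0 < \<kappa>" "\<kappa> \<le> \<epsilon> * \<theta> / 4" "\<kappa> \<le> 1 / (4 * 3 ^ ?d)" using \<epsilon>\<theta> by (auto simp: \<kappa>_def)
  obtain A where A: "0 < A" "(B * 2 ^ ?d / A) powr q \<le> \<kappa>"
    using weak_constants[of "B * 2 ^ ?d" q \<kappa>] B q \<kappa>(1) by auto
  let ?N = "expansion TYPE('a)"
  have N: "1 \<le> ?N ^ ?d" using expansion_ge[where 'a='a] by (intro one_le_power) auto
  \<comment> \<open>The exceptional set has measure at most N^d m |Q0| / \<tau>; with \<tau> =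
    \<alpha> m this is \<epsilon> \<theta> / 4 of the initial cube.\<close>
  define \<alpha> where "\<alpha> = 4 * ?N ^ ?d / (\<epsilon> * \<theta>)"
  have "\<epsilon> * \<theta> \<le> 4 * ?N ^ ?d" using N \<epsilon>\<theta>(2) by linarith
  then have \<alpha>: "1 \<le> \<alpha>" unfolding \<alpha>_def using \<epsilon>\<theta>(1) by (simp add: pos_le_divide_eq)
  \<comment> \<open>Chebyshev for the potential, whose integral is at most
    \<open>radial_const\<close> times 2^(d+1) m |Q0|; the summand 1 keeps \<open>P\<close>
    positive.\<close>
  define P where "P = 4 * (radial_const * 2 ^ Suc ?d) / (\<epsilon> * \<theta>) + 1"
  have P: "1 \<le> P" "radial_const * 2 ^ Suc ?d \<le> P * (\<epsilon> * \<theta> / 4)"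
    using \<epsilon>\<theta>(1) radial_const_nonneg by (auto simp: P_def field_simps)
  define C0 where "C0 = \<alpha> * (\<bar>cube_const A P\<bar> + \<bar>A + bad_const P\<bar> + 1)"
  have C0: "0 < C0" using \<alpha> by (auto simp: C0_def intro!: mult_pos_pos)
  show ?thesis
  proof (rule that[OF C0])
    fix c0 :: 'a and r0 M m :: real and f :: "'a \<Rightarrow> real"
    assume r0: "0 < r0" and fm: "f \<in> borel_measurable lebesgue" and fM: "\<And>x. \<bar>f x\<bar> \<le> M"
      and fsupp: "\<And>x. x \<notin> hcube c0 r0 \<Longrightarrow> f x = 0" and m: "0 < m"
      and mass: "(\<integral>\<^sup>+x. ennreal \<bar>f x\<bar> \<partial>lebesgue) = ennreal m * emeasure lebesgue (hcube c0 r0)"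
    note [measurable] = fm
    let ?Q0 = "hcube c0 r0"
    define \<tau> where "\<tau> = \<alpha> * m"
    have \<tau>: "0 < \<tau>" "m \<le> \<tau>" using \<alpha> m mult_right_mono[of 1 \<alpha> m] by (auto simp: \<tau>_def)
    have top: "(\<integral>\<^sup>+x\<in>?Q0. ennreal \<bar>f x\<bar> \<partial>lebesgue) \<le> ennreal \<tau> * emeasure lebesgue ?Q0"
    proof -
      have "(\<integral>\<^sup>+x\<in>?Q0. ennreal \<bar>f x\<bar> \<partial>lebesgue) \<le> (\<integral>\<^sup>+x. ennreal \<bar>f x\<bar> \<partial>lebesgue)"
        by (intro nn_integral_mono) (auto simp: indicator_def)
      also have "\<dots> \<le> ennreal \<tau> * emeasure lebesgue ?Q0"
        unfolding mass using \<tau> by (intro mult_right_mono ennreal_leI) auto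
      finally show ?thesis .
    qed
    obtain J where JD: "J \<subseteq> dyadic_sub c0 r0" and Jd: "disjoint J"
      and low: "\<And>Q. Q \<in> J \<Longrightarrow> ennreal \<tau> * emeasure lebesgue Q \<le> (\<integral>\<^sup>+x\<in>Q. ennreal \<bar>f x\<bar> \<partial>lebesgue)"
      and up: "\<And>Q. Q \<in> J \<Longrightarrow> (\<integral>\<^sup>+x\<in>Q. ennreal \<bar>f x\<bar> \<partial>lebesgue) \<le> 2 ^ ?d * ennreal \<tau> * emeasure lebesgue Q"
      and small0: "AE x in lebesgue. x \<in> ?Q0 \<longrightarrow> x \<notin> \<Union>J \<longrightarrow> ennreal \<bar>f x\<bar> \<le> ennreal \<tau>"
    proof (rule dyadic_stopping[OF r0 _ _ top])
      show "(\<lambda>x. ennreal \<bar>f x\<bar>) \<in> borel_measurable lebesgue" by measurable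
      show "0 \<le> \<tau>" using \<tau> by simp
    qed (rule that)
    have UJm [measurable]: "\<Union>J \<in> sets lebesgue"
      using countable_subset[OF JD countable_dyadic_sub] subsetD[OF JD, THEN dyadic_sub_lebesgue]
      by (intro sets.countable_Union subsetI)
    \<comment> \<open>Alters \<open>f\<close> on a null set so that the bound by \<tau> off the bad
      cubes holds at every point; the variation does not change anywhere.\<close>
    define f' where "f' x = (if x \<in> \<Union>J \<or> \<bar>f x\<bar> \<le> \<tau> then f x else 0)" for x
    have f'm [measurable]: "f' \<in> borel_measurable lebesgue" unfolding f'_def[abs_def] by measurable
    have f'J: "f' x = f x" if "x \<in> \<Union>J" for x using that by (simp add: f'_def)
    have f'AE: "AE x in lebesgue. f x = f' x"
      using small0
    proof eventually_elim
      case (elim x)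
      then show ?case using fsupp[of x] \<tau>(1) by (auto simp: f'_def ennreal_le_iff)
    qed
    have f'le: "\<bar>f' x\<bar> \<le> \<bar>f x\<bar>" for x by (simp add: f'_def)
    have f'M: "\<bar>f' x\<bar> \<le> M" for x using f'le[of x] fM[of x] by linarith
    have f'supp: "f' x = 0" if "x \<notin> ?Q0" for x using fsupp[OF that] by (simp add: f'_def)
    have Qf': "(\<integral>\<^sup>+x\<in>Q. ennreal \<bar>f' x\<bar> \<partial>lebesgue) = (\<integral>\<^sup>+x\<in>Q. ennreal \<bar>f x\<bar> \<partial>lebesgue)" if "Q \<in> J" for Q
    proof (intro nn_integral_cong)
      fix x show "ennreal \<bar>f' x\<bar> * indicator Q x = ennreal \<bar>f x\<bar> * indicator Q x"
        using that by (auto simp: f'_def indicator_def)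
    qed
    have low': "ennreal \<tau> * emeasure lebesgue Q \<le> (\<integral>\<^sup>+x\<in>Q. ennreal \<bar>f' x\<bar> \<partial>lebesgue)" if "Q \<in> J" for Q
      unfolding Qf'[OF that] by (rule low[OF that])
    have up': "(\<integral>\<^sup>+x\<in>Q. ennreal \<bar>f' x\<bar> \<partial>lebesgue) \<le> 2 ^ ?d * ennreal \<tau> * emeasure lebesgue Q" if "Q \<in> J" for Q
      unfolding Qf'[OF that] by (rule up[OF that])
    have small': "\<bar>f' x\<bar> \<le> \<tau>" if "x \<notin> \<Union>J" for x using that \<tau>(1) by (simp add: f'_def)
    have mass': "(\<integral>\<^sup>+x. ennreal \<bar>f' x\<bar> \<partial>lebesgue) \<le> ennreal m * emeasure lebesgue ?Q0"
      unfolding mass[symmetric] by (intro nn_integral_mono ennreal_leI f'le)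
    note CZ = r0 \<tau>(1) f'm f'M f'supp JD Jd low' up' small'
    let ?g = "cz_good J f'" and ?b = "cz_bad J f'"
    have gm: "?g \<in> borel_measurable lebesgue" by (rule g_measurable[OF CZ])
    have gb: "\<bar>?g y\<bar> \<le> 2 ^ ?d * \<tau>" for y by (rule g_bound[OF CZ])
    have gs: "?g y = 0" if "y \<notin> ?Q0" for y by (rule g_supp[OF CZ that])
    have \<Omega>m: "cz_exceptional J \<in> sets lebesgue" by (rule exceptional_sets[OF CZ])
    have \<Phi>m: "cz_potential J f' \<in> borel_measurable lebesgue" by (rule potential_measurable[OF CZ])
    note [measurable] = \<Omega>m \<Phi>m
    have A\<tau>: "0 < A * \<tau>" using A \<tau> by simp
    have ratio: "(B * (2 ^ ?d * \<tau>) / (A * \<tau>)) powr q \<le> \<kappa>"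
      using A(2) \<tau>(1) by (simp add: mult.assoc[symmetric])
    obtain Zg where Zg [measurable]: "Zg \<in> sets lebesgue"
      and Zg_AE: "AE x in lebesgue. x \<notin> Zg \<longrightarrow> V ?g x \<le> ereal (A * \<tau>)"
      and Zg_le0: "emeasure lebesgue Zg \<le> ennreal ((B * (2 ^ ?d * \<tau>) / (A * \<tau>)) powr q) * emeasure lebesgue ?Q0"
      using weak[OF gm gb gs hcube_lmeasurable[OF r0] A\<tau>] by blast
    have Zg_le: "emeasure lebesgue Zg \<le> ennreal (\<epsilon> * \<theta> / 4) * emeasure lebesgue ?Q0"
      by (rule order_trans[OF Zg_le0]) (intro mult_right_mono ennreal_leI order_trans[OF ratio \<kappa>(2)] zero_le)
    have \<Omega>_le: "emeasure lebesgue (cz_exceptional J) \<le> ennreal (\<epsilon> * \<theta> / 4) * emeasure lebesgue ?Q0"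
    proof (rule ennreal_mult_left_cancel_le[OF \<tau>(1)])
      have "ennreal \<tau> * emeasure lebesgue (cz_exceptional J) \<le> ennreal (?N ^ ?d) * (\<integral>\<^sup>+x. ennreal \<bar>f' x\<bar> \<partial>lebesgue)"
        by (rule exceptional_measure[OF CZ])
      also have "\<dots> \<le> ennreal (?N ^ ?d) * (ennreal m * emeasure lebesgue ?Q0)"
        by (intro mult_left_mono mass') auto
      also have "\<dots> = ennreal (?N ^ ?d * m) * emeasure lebesgue ?Q0"
        using N m by (simp add: ennreal_mult' mult.assoc)
      also have "?N ^ ?d * m = \<tau> * (\<epsilon> * \<theta> / 4)"
      proof -
        have "a / e * e = a" if "0 < e" for a e :: real using that by simp
        from this[OF \<epsilon>\<theta>(1)] have "\<alpha> * (\<epsilon> * \<theta>) = 4 * ?N ^ ?d" by (simp only: \<alpha>_def)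
        moreover have "\<tau> * (\<epsilon> * \<theta> / 4) = m * (\<alpha> * (\<epsilon> * \<theta>)) / 4" by (simp add: \<tau>_def)
        ultimately show ?thesis by simp
      qed
      also have "ennreal (\<tau> * (\<epsilon> * \<theta> / 4)) * emeasure lebesgue ?Q0 = ennreal \<tau> * (ennreal (\<epsilon> * \<theta> / 4) * emeasure lebesgue ?Q0)"
        using \<tau>(1) by (intro ennreal_mult_mult) simp
      finally show "ennreal \<tau> * emeasure lebesgue (cz_exceptional J) \<le> ennreal \<tau> * (ennreal (\<epsilon> * \<theta> / 4) * emeasure lebesgue ?Q0)" .
    qed
    define Zp where "Zp = {x \<in> space lebesgue. ennreal (P * \<tau>) < cz_potential J f' x}"
    have Zpm [measurable]: "Zp \<in> sets lebesgue" unfolding Zp_def by measurable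
    have P\<tau>: "0 < P * \<tau>" using P \<tau> by simp
    have Zp_le: "emeasure lebesgue Zp \<le> ennreal (\<epsilon> * \<theta> / 4) * emeasure lebesgue ?Q0"
    proof (rule ennreal_mult_left_cancel_le[OF P\<tau>])
      have "ennreal (P * \<tau>) * emeasure lebesgue Zp = (\<integral>\<^sup>+x\<in>Zp. ennreal (P * \<tau>) \<partial>lebesgue)"
        by (rule nn_integral_cmult_indicator[symmetric]) (rule Zpm)
      also have "\<dots> \<le> (\<integral>\<^sup>+x. cz_potential J f' x \<partial>lebesgue)"
        by (intro nn_integral_mono) (auto simp: Zp_def indicator_def less_imp_le)
      also have "\<dots> \<le> ennreal radial_const * (\<integral>\<^sup>+y. ennreal \<bar>?b y\<bar> \<partial>lebesgue)"
        by (rule potential_total[OF CZ])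
      also have "\<dots> \<le> ennreal radial_const * (2 ^ Suc ?d * (ennreal m * emeasure lebesgue ?Q0))"
        by (intro mult_left_mono order_trans[OF b_total[OF CZ]] mass') auto
      also have "\<dots> = ennreal (radial_const * 2 ^ Suc ?d * m) * emeasure lebesgue ?Q0"
        using radial_const_nonneg m by (simp add: ennreal_mult' ennreal_power[symmetric] mult.assoc del: power_Suc)
      also have "\<dots> \<le> ennreal (P * \<tau> * (\<epsilon> * \<theta> / 4)) * emeasure lebesgue ?Q0"
      proof (intro mult_right_mono ennreal_leI)
        have "radial_const * 2 ^ Suc ?d * m \<le> (P * (\<epsilon> * \<theta> / 4)) * \<tau>"
          by (rule mult_mono[OF P(2) \<tau>(2)]) (use P \<epsilon>\<theta>(1) m in auto)
        then show "radial_const * 2 ^ Suc ?d * m \<le> P * \<tau> * (\<epsilon> * \<theta> / 4)" by (simp add: mult_ac)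
      qed auto
      also have "\<dots> = ennreal (P * \<tau>) * (ennreal (\<epsilon> * \<theta> / 4) * emeasure lebesgue ?Q0)"
        using P\<tau> by (intro ennreal_mult_mult) simp
      finally show "ennreal (P * \<tau>) * emeasure lebesgue Zp \<le> ennreal (P * \<tau>) * (ennreal (\<epsilon> * \<theta> / 4) * emeasure lebesgue ?Q0)" .
    qed
    \<comment> \<open>Three sets with a share of at most \<epsilon> \<theta> / 4 each, together
      below the \<epsilon> \<theta> that the stopping argument can afford.\<close>
    define E where "E = ?Q0 \<inter> (cz_exceptional J \<union> Zg \<union> Zp)"
    have Em [measurable]: "E \<in> sets lebesgue" unfolding E_def by measurable
    have E_le: "emeasure lebesgue E \<le> ennreal (\<epsilon> * \<theta>) * emeasure lebesgue ?Q0"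
    proof -
      have "emeasure lebesgue E \<le> emeasure lebesgue (cz_exceptional J \<union> Zg \<union> Zp)"
        by (intro emeasure_mono) (auto simp: E_def)
      also have "\<dots> \<le> emeasure lebesgue (cz_exceptional J) + emeasure lebesgue Zg + emeasure lebesgue Zp"
        by (intro order_trans[OF emeasure_subadditive] add_right_mono emeasure_subadditive) auto
      also have "\<dots> \<le> ennreal (\<epsilon> * \<theta> / 4) * emeasure lebesgue ?Q0 + ennreal (\<epsilon> * \<theta> / 4) * emeasure lebesgue ?Q0
          + ennreal (\<epsilon> * \<theta> / 4) * emeasure lebesgue ?Q0"
        by (intro add_mono \<Omega>_le Zg_le Zp_le)
      also have "\<dots> = ennreal (3 * (\<epsilon> * \<theta> / 4)) * emeasure lebesgue ?Q0"
      proof -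
        have "ennreal (3 * (\<epsilon> * \<theta> / 4)) = ennreal (\<epsilon> * \<theta> / 4) + ennreal (\<epsilon> * \<theta> / 4) + ennreal (\<epsilon> * \<theta> / 4)"
          using \<epsilon>\<theta>(1) by (simp add: ennreal_plus[symmetric] del: ennreal_plus)
        then show ?thesis by (simp only: distrib_right)
      qed
      also have "\<dots> \<le> ennreal (\<epsilon> * \<theta>) * emeasure lebesgue ?Q0"
        using \<epsilon>\<theta>(1) by (intro mult_right_mono ennreal_leI) auto
      finally show ?thesis .
    qed
    have indE: "(\<integral>\<^sup>+x\<in>Q. indicator E x \<partial>lebesgue) = emeasure lebesgue (Q \<inter> E)" if "Q \<in> sets lebesgue" for Q
    proof -
      have "(\<integral>\<^sup>+x\<in>Q. indicator E x \<partial>lebesgue) = (\<integral>\<^sup>+x. indicator (Q \<inter> E) x \<partial>lebesgue)"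
        by (intro nn_integral_cong) (auto simp: indicator_def)
      also have "\<dots> = emeasure lebesgue (Q \<inter> E)" using that by (intro nn_integral_indicator) auto
      finally show ?thesis .
    qed
    have topE: "(\<integral>\<^sup>+x\<in>?Q0. indicator E x \<partial>lebesgue) \<le> ennreal \<theta> * emeasure lebesgue ?Q0"
    proof -
      have "emeasure lebesgue (?Q0 \<inter> E) \<le> emeasure lebesgue E" by (intro emeasure_mono) auto
      also note E_le
      also have "ennreal (\<epsilon> * \<theta>) * emeasure lebesgue ?Q0 \<le> ennreal \<theta> * emeasure lebesgue ?Q0"
        using \<epsilon>\<theta>(3) by (intro mult_right_mono ennreal_leI) auto
      finally show ?thesis unfolding indE[OF hcube_lebesgue] .
    qed
    \<comment> \<open>Stopping cubes for the density of \<open>E\<close>. Each has density at least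
      \<theta>, so their union has at most 1 / \<theta> times the measure of \<open>E\<close>, which
      gives the share \<epsilon>.\<close>
    obtain F where FD: "F \<subseteq> dyadic_sub c0 r0" and Fd: "disjoint F"
      and Flow: "\<And>Q. Q \<in> F \<Longrightarrow> ennreal \<theta> * emeasure lebesgue Q \<le> (\<integral>\<^sup>+x\<in>Q. indicator E x \<partial>lebesgue)"
      and Fup: "\<And>Q. Q \<in> F \<Longrightarrow> (\<integral>\<^sup>+x\<in>Q. indicator E x \<partial>lebesgue) \<le> 2 ^ ?d * ennreal \<theta> * emeasure lebesgue Q"
      and Funsel: "\<And>Q. Q \<in> dyadic_sub c0 r0 \<Longrightarrow> (\<nexists>P. P \<in> F \<and> Q \<subseteq> P) \<Longrightarrow> (\<integral>\<^sup>+x\<in>Q. indicator E x \<partial>lebesgue) \<le> ennreal \<theta> * emeasure lebesgue Q"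
      and FAE: "AE x in lebesgue. x \<in> ?Q0 \<longrightarrow> x \<notin> \<Union>F \<longrightarrow> indicator E x \<le> ennreal \<theta>"
    proof (rule dyadic_stopping[OF r0 _ _ topE])
      show "indicator E \<in> borel_measurable lebesgue" by measurable
      show "0 \<le> \<theta>" using \<theta> by simp
    qed (rule that)
    have Fc: "countable F" by (rule countable_subset[OF FD countable_dyadic_sub])
    have Fs: "F \<subseteq> sets lebesgue" by (rule subsetI) (rule dyadic_sub_lebesgue[OF subsetD[OF FD]])
    have UF: "\<Union>F \<in> sets lebesgue" by (rule sets.countable_Union[OF Fc Fs])
    have F_le: "emeasure lebesgue (\<Union>F) \<le> ennreal \<epsilon> * emeasure lebesgue ?Q0"
    proof (rule ennreal_mult_left_cancel_le[OF \<theta>(1)])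
      have "ennreal \<theta> * emeasure lebesgue (\<Union>F) = (\<integral>\<^sup>+x\<in>\<Union>F. ennreal \<theta> \<partial>lebesgue)"
        by (rule nn_integral_cmult_indicator[symmetric]) (rule UF)
      also have "\<dots> \<le> (\<integral>\<^sup>+x\<in>\<Union>F. indicator E x \<partial>lebesgue)"
      proof (rule nn_integral_Union_mono[OF Fc Fs Fd])
        fix Q assume Q: "Q \<in> F"
        have "(\<integral>\<^sup>+x\<in>Q. ennreal \<theta> \<partial>lebesgue) = ennreal \<theta> * emeasure lebesgue Q"
          by (rule nn_integral_cmult_indicator) (rule subsetD[OF Fs Q])
        then show "(\<integral>\<^sup>+x\<in>Q. ennreal \<theta> \<partial>lebesgue) \<le> (\<integral>\<^sup>+x\<in>Q. indicator E x \<partial>lebesgue)"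
          using Flow[OF Q] by (simp only:)
      qed auto
      also have "\<dots> = emeasure lebesgue (\<Union>F \<inter> E)" by (rule indE[OF UF])
      also have "\<dots> \<le> emeasure lebesgue E" by (intro emeasure_mono) auto
      also note E_le
      also have "ennreal (\<epsilon> * \<theta>) * emeasure lebesgue ?Q0 = ennreal \<theta> * (ennreal \<epsilon> * emeasure lebesgue ?Q0)"
        using eps \<theta> by (simp add: ennreal_mult' mult_ac)
      finally show "ennreal \<theta> * emeasure lebesgue (\<Union>F) \<le> ennreal \<theta> * (ennreal \<epsilon> * emeasure lebesgue ?Q0)" .
    qed
    have Vf: "V f x = V f' x" for x
      by (rule var_op_cong_AE[OF f'AE fm f'm K_measurable])
    have Vf3: "V (\<lambda>y. f y * indicator (dilate 3 R) y) x = V (\<lambda>y. f' y * indicator (dilate 3 R) y) x"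
      if R: "R \<in> dyadic_sub c0 r0" for R x
    proof -
      obtain c r where "0 < r" "R = hcube c r" using dyadic_subE[OF r0 R] by metis
      then have [measurable]: "dilate 3 R \<in> sets lebesgue" using dilate_hcube[of r 3 c] hcube_lebesgue[of c "3 * r"] by simp
      show ?thesis
      proof (rule var_op_cong_AE)
        show "AE y in lebesgue. f y * indicator (dilate 3 R) y = f' y * indicator (dilate 3 R) y"
          using f'AE by eventually_elim simp
        show "(\<lambda>y. f y * indicator (dilate 3 R) y) \<in> borel_measurable lebesgue"
          "(\<lambda>y. f' y * indicator (dilate 3 R) y) \<in> borel_measurable lebesgue"
          by measurable
      qed (rule K_measurable)
    qed
    have fin: "AE x in lebesgue. V f' x \<noteq> \<infinity>"
      using weak[OF f'm f'M f'supp hcube_lmeasurable[OF r0] zero_less_one] by blast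
    have C0c: "cube_const A P * \<tau> \<le> C0 * m" "(A + bad_const P) * \<tau> \<le> C0 * m"
    proof -
      have "cube_const A P * \<tau> \<le> (\<bar>cube_const A P\<bar> + \<bar>A + bad_const P\<bar> + 1) * \<tau>"
        "(A + bad_const P) * \<tau> \<le> (\<bar>cube_const A P\<bar> + \<bar>A + bad_const P\<bar> + 1) * \<tau>"
        using \<tau>(1) by (intro mult_right_mono; linarith)+
      then show "cube_const A P * \<tau> \<le> C0 * m" "(A + bad_const P) * \<tau> \<le> C0 * m"
        by (simp_all add: C0_def \<tau>_def mult_ac)
    qed
    have main: "AE x in lebesgue. x \<in> ?Q0 \<longrightarrow>
            (\<forall>R\<in>G. x \<in> R \<longrightarrow> \<bar>V f x - V (\<lambda>y. f y * indicator (dilate 3 R) y) x\<bar> \<le> ereal (C0 * m)) \<and>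
            (x \<notin> \<Union>G \<longrightarrow> V f x \<le> ereal (C0 * m))"
      if GD: "G \<subseteq> dyadic_sub c0 r0" and Gd: "disjoint G" and cover: "\<forall>Q\<in>F. \<exists>R\<in>G. Q \<subseteq> R" for G
    proof -
      have onR: "V (\<lambda>y. f' y - f' y * indicator (dilate 3 R) y) x \<le> ereal (cube_const A P * \<tau>)"
        if R: "R \<in> G" and x: "x \<in> R" for R x
      proof -
        have RD: "R \<in> dyadic_sub c0 r0" using R GD by blast
        have Rm: "R \<in> sets lebesgue" by (rule dyadic_sub_lebesgue[OF RD])
        have half: "emeasure lebesgue (R \<inter> E) \<le> ennreal (1/2) * emeasure lebesgue R"
        \<comment> \<open>If \<open>R\<close> lies in a stopping cube, that cube lies in a member of
          \<open>G\<close>, which by disjointness is \<open>R\<close> itself; so \<open>R\<close> is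
          a stopping cube and \<open>Fup\<close> gives 2^d \<theta> = 1/2. Otherwise
          \<open>Funsel\<close> gives the smaller bound \<theta>.\<close>
        proof (cases "\<exists>Q\<in>F. R \<subseteq> Q")
          case True
          then obtain Q where Q: "Q \<in> F" "R \<subseteq> Q" by blast
          then obtain R' where R': "R' \<in> G" "Q \<subseteq> R'" using cover by blast
          have "R = R'"
          proof (rule ccontr)
            assume "R \<noteq> R'"
            then have "R \<inter> R' = {}" using Gd R R'(1) by (auto simp: disjoint_def)
            then show False using x Q(2) R'(2) by blast
          qed
          then have "R = Q" using Q R' by blast
          have "emeasure lebesgue (R \<inter> E) \<le> 2 ^ ?d * ennreal \<theta> * emeasure lebesgue R"
            using Fup[OF Q(1)] unfolding \<open>R = Q\<close>[symmetric] indE[OF Rm] .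
          also have "2 ^ ?d * ennreal \<theta> = ennreal (1/2)"
          proof -
            have "2 ^ ?d * \<theta> = 1/2" by (simp add: \<theta>_def)
            moreover have "2 ^ ?d * ennreal \<theta> = ennreal (2 ^ ?d * \<theta>)"
              by (simp add: ennreal_mult' ennreal_power[symmetric])
            ultimately show ?thesis by (simp only:)
          qed
          finally show ?thesis .
        next
          case False
          then have "(\<integral>\<^sup>+x\<in>R. indicator E x \<partial>lebesgue) \<le> ennreal \<theta> * emeasure lebesgue R"
            by (intro Funsel RD) blast
          also have "\<dots> \<le> ennreal (1/2) * emeasure lebesgue R"
            using \<theta> by (intro mult_right_mono ennreal_leI) auto
          finally show ?thesis unfolding indE[OF Rm] .
        qed
        obtain cR u where u: "R = hcube cR u" "0 < u" using dyadic_subE[OF r0 RD] by metis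
        have T: "dilate 3 R = hcube cR (3 * u)" unfolding u(1) by (rule dilate_hcube[OF u(2)])
        have Tl: "dilate 3 R \<in> lmeasurable" unfolding T using u(2) by (intro hcube_lmeasurable) simp
        have Rpos: "0 < emeasure lebesgue R" "emeasure lebesgue R < \<infinity>"
          unfolding u(1) using u(2) emeasure_hcube[of u cR] by (auto simp del: emeasure_completion)
        have Tmeas: "emeasure lebesgue (dilate 3 R) = ennreal (3 ^ ?d) * emeasure lebesgue R"
        proof -
          have "2 * (3 * u) = 3 * (2 * u)" by simp
          then have "emeasure lebesgue (dilate 3 R) = ennreal (3 ^ ?d * (2 * u) ^ ?d)"
            unfolding T using u(2) emeasure_hcube[of "3 * u" cR] by (simp only: power_mult_distrib)
          also have "\<dots> = ennreal (3 ^ ?d) * ennreal ((2 * u) ^ ?d)" by (intro ennreal_mult') simp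
          also have "ennreal ((2 * u) ^ ?d) = emeasure lebesgue R"
            unfolding u(1) using u(2) by (intro emeasure_hcube[symmetric]) simp
          finally show ?thesis .
        qed
        let ?g3 = "\<lambda>y. ?g y * indicator (dilate 3 R) y"
        have [measurable]: "dilate 3 R \<in> sets lebesgue" using Tl by (rule fmeasurableD)
        note [measurable] = gm
        have g3m: "?g3 \<in> borel_measurable lebesgue" by measurable
        have g3b: "\<bar>?g3 y\<bar> \<le> 2 ^ ?d * \<tau>" for y
          using gb[of y] \<tau>(1) by (cases "y \<in> dilate 3 R") auto
        \<comment> \<open>\<open>Z\<close> and the null set \<open>N\<close> depend on
          \<open>R\<close> and serve only to select \<open>x'\<close>. The resulting bound holds at
          every point of \<open>R\<close>, so nothing is accumulated over the cubes of
          \<open>G\<close>.\<close>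
        obtain Z where Z: "Z \<in> sets lebesgue"
          and Z_AE: "AE x in lebesgue. x \<notin> Z \<longrightarrow> V ?g3 x \<le> ereal (A * \<tau>)"
          and Z_le0: "emeasure lebesgue Z \<le> ennreal ((B * (2 ^ ?d * \<tau>) / (A * \<tau>)) powr q) * emeasure lebesgue (dilate 3 R)"
          using weak[OF g3m g3b _ Tl A\<tau>] by auto
        have Z_le: "emeasure lebesgue Z \<le> ennreal (1/4) * emeasure lebesgue R"
        proof -
          note Z_le0
          also have "ennreal ((B * (2 ^ ?d * \<tau>) / (A * \<tau>)) powr q) * emeasure lebesgue (dilate 3 R)
              \<le> ennreal (1 / (4 * 3 ^ ?d)) * emeasure lebesgue (dilate 3 R)"
            by (intro mult_right_mono ennreal_leI order_trans[OF ratio \<kappa>(3)] zero_le)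
          also have "\<dots> = ennreal (1/4) * emeasure lebesgue R"
            unfolding Tmeas mult.assoc[symmetric] by (simp add: ennreal_mult'[symmetric] del: emeasure_completion)
          finally show ?thesis .
        qed
        obtain N where N: "{x \<in> space lebesgue. \<not> ((x \<notin> Zg \<longrightarrow> V ?g x \<le> ereal (A * \<tau>)) \<and> (x \<notin> Z \<longrightarrow> V ?g3 x \<le> ereal (A * \<tau>)))} \<subseteq> N"
          "emeasure lebesgue N = 0" "N \<in> sets lebesgue"
          using AE_E[OF AE_conjI[OF Zg_AE Z_AE]] by blast
        obtain x' where x': "x' \<in> R" "x' \<notin> E" "x' \<notin> Z" "x' \<notin> N"
          using exists_good_point[OF Rm Rpos Em Z N(3) half Z_le N(2)] by blast
        have "x' \<in> ?Q0" using x'(1) dyadic_sub_subset[OF r0 RD] by blast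
        then have x'E: "x' \<notin> cz_exceptional J" "x' \<notin> Zg" "x' \<notin> Zp" using x'(2) by (auto simp: E_def)
        have "V ?g x' \<le> ereal (A * \<tau>) \<and> V ?g3 x' \<le> ereal (A * \<tau>)"
          using N(1) x'(3,4) x'E(2) by auto
        moreover have "cz_potential J f' x' \<le> ennreal (P * \<tau>)" using x'E(3) by (simp add: Zp_def not_less)
        ultimately show ?thesis
          using variation_on_cube[OF CZ RD x x'(1) x'E(1)] P by auto
      qed
      show ?thesis
        using fin FAE Zg_AE
      proof eventually_elim
        case (elim x)
        show ?case
        proof (intro impI conjI ballI)
          fix R assume R: "R \<in> G" "x \<in> R"
          have RD: "R \<in> dyadic_sub c0 r0" using R GD by blast
          obtain c r where "0 < r" "R = hcube c r" using dyadic_subE[OF r0 RD] by metis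
          then have T: "dilate 3 R \<in> sets lebesgue" using dilate_hcube[of r 3 c] hcube_lebesgue[of c "3 * r"] by simp
          have fi: "integrable lebesgue f'" by (rule f_integrable[OF CZ])
          have "\<bar>V f' x - V (\<lambda>y. f' y * indicator (dilate 3 R) y) x\<bar> \<le> ereal (cube_const A P * \<tau>)"
            by (rule var_op_diff_le[OF fi integrable_real_mult_indicator[OF T fi] elim(1) onR[OF R]])
          also have "\<dots> \<le> ereal (C0 * m)" using C0c by simp
          finally show "\<bar>V f x - V (\<lambda>y. f y * indicator (dilate 3 R) y) x\<bar> \<le> ereal (C0 * m)"
            unfolding Vf Vf3[OF RD] .
        next
          assume xQ: "x \<in> ?Q0" and xG: "x \<notin> \<Union>G"
          then have "x \<notin> \<Union>F" using cover by blast
          then have "indicator E x \<le> ennreal \<theta>" using elim(2) xQ by blast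
          \<comment> \<open>\<theta> is below 1, so the indicator can only be 0.\<close>
          then have "x \<notin> E" using \<theta> by (auto simp: indicator_def split: if_splits)
          then have xE: "x \<notin> cz_exceptional J" "x \<notin> Zg" "x \<notin> Zp" using xQ by (auto simp: E_def)
          have "cz_potential J f' x \<le> ennreal (P * \<tau>)" using xE(3) by (simp add: Zp_def not_less)
          then have "V f' x \<le> ereal ((A + bad_const P) * \<tau>)"
            using variation_off_exceptional[OF CZ xE(1)] elim(3) xE(2) P by auto
          also have "\<dots> \<le> ereal (C0 * m)" using C0c by simp
          finally show "V f x \<le> ereal (C0 * m)" unfolding Vf .
        qed
      qed
    qed
    show "\<exists>F. F \<subseteq> dyadic_sub c0 r0 \<and> disjoint F \<and>
        emeasure lebesgue (\<Union>F) \<le> ennreal \<epsilon> * emeasure lebesgue ?Q0 \<and>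
        (\<forall>G. G \<subseteq> dyadic_sub c0 r0 \<longrightarrow> disjoint G \<longrightarrow> (\<forall>Q\<in>F. \<exists>R\<in>G. Q \<subseteq> R) \<longrightarrow>
          (AE x in lebesgue. x \<in> ?Q0 \<longrightarrow>
            (\<forall>R\<in>G. x \<in> R \<longrightarrow> \<bar>V f x - V (\<lambda>y. f y * indicator (dilate 3 R) y) x\<bar> \<le> ereal (C0 * m)) \<and>
            (x \<notin> \<Union>G \<longrightarrow> V f x \<le> ereal (C0 * m))))"
      using FD Fd F_le main by blast
  qed
qed

end

subsection \<open>Dini kernels\<close>

lemma dini_modulusD:
  assumes "dini_modulus \<omega>"
  shows "\<And>s t. 0 \<le> s \<Longrightarrow> s \<le> t \<Longrightarrow> \<omega> s \<le> \<omega> t" "\<And>t. 0 \<le> t \<Longrightarrow> 0 \<le> \<omega> t"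
    "\<And>s t. 0 \<le> s \<Longrightarrow> 0 \<le> t \<Longrightarrow> \<omega> (s + t) \<le> \<omega> s + \<omega> t" "\<omega> 0 = 0"
    "set_integrable lborel {0<..1} (\<lambda>t. \<omega> t / t)"
proof -
  note d = assms[unfolded dini_modulus_def]
  show "\<omega> s \<le> \<omega> t" if "0 \<le> s" "s \<le> t" for s t
    using d[THEN conjunct1] that by blast
  show "0 \<le> \<omega> t" if "0 \<le> t" for t
    using d[THEN conjunct2, THEN conjunct1] that by blast
  show "\<omega> (s + t) \<le> \<omega> s + \<omega> t" if "0 \<le> s" "0 \<le> t" for s t
    using d[THEN conjunct2, THEN conjunct2, THEN conjunct1] that by blast
  show "\<omega> 0 = 0" using d by (elim conjE)
  show "set_integrable lborel {0<..1} (\<lambda>t. \<omega> t / t)" using d by (elim conjE)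
qed

text \<open>Comparison of series and integral: between 2^-(k+1) and 2^-k the integrand is at least
  \<omega>(2^-(k+1)) 2^k, and the interval has length 2^-(k+1).\<close>

lemma dini_summable:
  assumes "dini_modulus \<omega>"
  shows "summable (\<lambda>k::nat. \<omega> (1 / 2 ^ k))"
proof -
  note mono = dini_modulusD(1)[OF assms] and nonneg = dini_modulusD(2)[OF assms]
  have int: "integrable lborel (\<lambda>t. indicat_real {0<..1} t * (\<omega> t / t))"
    using dini_modulusD(5)[OF assms] by (simp add: set_integrable_def)
  define h where "h t = ennreal (indicat_real {0<..1} t * (\<omega> t / t))" for t
  have [measurable]: "h \<in> borel_measurable lborel"
    using borel_measurable_integrable[OF int] unfolding h_def[abs_def] by measurable
  have hfin: "(\<integral>\<^sup>+t. h t \<partial>lborel) = ennreal (\<integral>t. indicat_real {0<..1} t * (\<omega> t / t) \<partial>lborel)"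
    unfolding h_def by (rule nn_integral_eq_integral[OF int]) (auto simp: indicator_def intro!: divide_nonneg_nonneg nonneg)
  define I where "I k = {1 / 2 ^ Suc k <.. 1 / 2 ^ k :: real}" for k :: nat
  have disj: "disjoint_family I"
  proof -
    have *: "I i \<inter> I j = {}" if "i < j" for i j
    proof -
      have "(2::real) ^ Suc i \<le> 2 ^ j" using that by (intro power_increasing) auto
      then have "1 / 2 ^ j \<le> 1 / (2::real) ^ Suc i" by (intro divide_left_mono) auto
      then show ?thesis by (auto simp: I_def)
    qed
    show ?thesis unfolding disjoint_family_on_def by (metis * inf_commute linorder_neqE_nat)
  qed
  have piece: "ennreal (\<omega> (1 / 2 ^ Suc k) / 2) \<le> emeasure (density lborel h) (I k)" for k
  proof -
    have le1: "1 / (2::real) ^ k \<le> 1" by simp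
    have "(\<integral>\<^sup>+t. ennreal (\<omega> (1 / 2 ^ Suc k) * 2 ^ k) * indicator (I k) t \<partial>lborel) \<le> (\<integral>\<^sup>+t. h t * indicator (I k) t \<partial>lborel)"
    proof (intro nn_integral_mono)
      fix t
      show "ennreal (\<omega> (1 / 2 ^ Suc k) * 2 ^ k) * indicator (I k) t \<le> h t * indicator (I k) t"
      proof (cases "t \<in> I k")
        case True
        then have t: "1 / 2 ^ Suc k < t" "t \<le> 1 / 2 ^ k" by (auto simp: I_def)
        have "(0::real) < 1 / 2 ^ Suc k" by simp
        then have t0: "0 < t" using t(1) by linarith
        have t1: "t \<le> 1" using t(2) le1 by linarith
        have "2 ^ k \<le> 1 / t" using t(2) t0 by (simp add: field_simps)
        moreover have "\<omega> (1 / 2 ^ Suc k) \<le> \<omega> t" using t(1) by (intro mono) auto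
        ultimately have "\<omega> (1 / 2 ^ Suc k) * 2 ^ k \<le> \<omega> t * (1 / t)"
          using nonneg t0 by (intro mult_mono) auto
        then show ?thesis using True t0 t1 by (simp add: h_def ennreal_leI)
      qed simp
    qed
    also have "(\<integral>\<^sup>+t. ennreal (\<omega> (1 / 2 ^ Suc k) * 2 ^ k) * indicator (I k) t \<partial>lborel) = ennreal (\<omega> (1 / 2 ^ Suc k) * 2 ^ k) * emeasure lborel (I k)"
      by (rule nn_integral_cmult_indicator) (simp add: I_def)
    also have "emeasure lborel (I k) = ennreal (1 / 2 ^ k - 1 / 2 ^ Suc k)"
      unfolding I_def by (rule emeasure_lborel_Ioc) (simp add: divide_simps)
    also have "1 / 2 ^ k - 1 / 2 ^ Suc k = 1 / (2::real) ^ Suc k" by (simp add: field_simps)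
    also have "ennreal (\<omega> (1 / 2 ^ Suc k) * 2 ^ k) * ennreal (1 / 2 ^ Suc k) = ennreal (\<omega> (1 / 2 ^ Suc k) * 2 ^ k * (1 / 2 ^ Suc k))"
      by (rule ennreal_mult''[symmetric]) simp
    also have "\<omega> (1 / 2 ^ Suc k) * 2 ^ k * (1 / 2 ^ Suc k) = \<omega> (1 / 2 ^ Suc k) / 2" by simp
    also have "(\<integral>\<^sup>+t. h t * indicator (I k) t \<partial>lborel) = emeasure (density lborel h) (I k)"
      by (subst emeasure_density) (auto simp: I_def)
    finally show ?thesis .
  qed
  let ?W = "\<integral>t. indicat_real {0<..1} t * (\<omega> t / t) \<partial>lborel"
  have W0: "0 \<le> ?W"
    by (intro Bochner_Integration.integral_nonneg) (auto simp: indicator_def intro!: divide_nonneg_nonneg nonneg)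
  have part: "(\<Sum>k<n. \<omega> (1 / 2 ^ Suc k) / 2) \<le> ?W" for n
  proof -
    have "ennreal (\<Sum>k<n. \<omega> (1 / 2 ^ Suc k) / 2) = (\<Sum>k<n. ennreal (\<omega> (1 / 2 ^ Suc k) / 2))"
      by (rule sum_ennreal[symmetric]) (simp add: nonneg)
    also have "\<dots> \<le> (\<Sum>k<n. emeasure (density lborel h) (I k))" by (intro sum_mono piece)
    also have "\<dots> = emeasure (density lborel h) (\<Union>k<n. I k)"
      using disj by (intro sum_emeasure) (auto simp: I_def disjoint_family_on_def)
    also have "\<dots> \<le> emeasure (density lborel h) (space (density lborel h))" by (rule emeasure_space)
    also have "\<dots> = (\<integral>\<^sup>+t. h t \<partial>lborel)" by (subst emeasure_density) auto
    finally have "ennreal (\<Sum>k<n. \<omega> (1 / 2 ^ Suc k) / 2) \<le> ennreal ?W" by (simp only: hfin)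
    then show ?thesis using W0 by (simp add: ennreal_le_iff)
  qed
  have "summable (\<lambda>k. \<omega> (1 / 2 ^ Suc k) / 2)"
    by (rule summableI_nonneg_bounded[OF _ part]) (simp add: nonneg)
  then have "summable (\<lambda>k. \<omega> (1 / 2 ^ Suc k))" by (simp add: summable_divide_iff)
  then show ?thesis by (subst summable_Suc_iff[symmetric])
qed

text \<open>Adding the identity to the modulus makes the kernel size, the smoothness and the crossing
  terms controllable by one and the same Dini modulus.\<close>

lemma variation_kernel_CZ_kernel:
  fixes K :: "'a::euclidean_space \<Rightarrow> 'a \<Rightarrow> real"
  assumes \<omega>: "dini_modulus \<omega>" and K: "CZ_kernel K \<omega>" and \<rho>: "2 \<le> \<rho>"
  obtains C where "variation_kernel K (\<lambda>t. \<omega> (max 0 t) + max 0 t) C \<rho>"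
proof -
  \<comment> \<open>\<omega> is controlled on nonnegative arguments only; \<open>max 0\<close>
    extends it so that monotonicity and nonnegativity hold on the whole line.\<close>
  define \<eta> where "\<eta> t = \<omega> (max 0 t) + max 0 t" for t
  note mono = dini_modulusD(1)[OF \<omega>] and nonneg = dini_modulusD(2)[OF \<omega>]
    and sub = dini_modulusD(3)[OF \<omega>] and zero = dini_modulusD(4)[OF \<omega>]
  obtain C0 where meas: "\<And>x. (\<lambda>y. K x y) \<in> borel_measurable lebesgue"
    and size: "\<And>x y. x \<noteq> y \<Longrightarrow> \<bar>K x y\<bar> \<le> C0 / dist x y ^ DIM('a)"
    and smooth: "\<And>x x' y. x \<noteq> y \<Longrightarrow> dist x x' \<le> dist x y / 2 \<Longrightarrow>
              \<bar>K x y - K x' y\<bar> + \<bar>K y x - K y x'\<bar> \<le> C0 * \<omega> (dist x x' / dist x y) / dist x y ^ DIM('a)"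
    using K unfolding CZ_kernel_def by blast
  \<comment> \<open>The kernel constant \<open>C0\<close> may fail to be positive.\<close>
  define C where "C = max C0 1"
  have C: "0 < C" "C0 \<le> C" by (auto simp: C_def)
  have smooth': "\<bar>K x y - K x' y\<bar> + \<bar>K y x - K y x'\<bar> \<le> C * \<eta> (dist x x' / dist x y) / dist x y ^ DIM('a)"
    if "x \<noteq> y" "dist x x' \<le> dist x y / 2" for x x' y
  proof -
    have "C0 * \<omega> (dist x x' / dist x y) \<le> C * \<eta> (dist x x' / dist x y)"
      using C nonneg[of "dist x x' / dist x y"] by (intro mult_mono) (auto simp: \<eta>_def)
    then have "C0 * \<omega> (dist x x' / dist x y) / dist x y ^ DIM('a) \<le> C * \<eta> (dist x x' / dist x y) / dist x y ^ DIM('a)"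
      by (intro divide_right_mono) auto
    then show ?thesis using smooth[OF that] by linarith
  qed
  have mult\<omega>: "\<omega> (real n * t) \<le> real n * \<omega> t" if t: "0 \<le> t" for n t
  proof (induction n)
    case 0
    then show ?case by (simp add: zero)
  next
    case (Suc n)
    have "\<omega> (real (Suc n) * t) = \<omega> (real n * t + t)" by (simp add: algebra_simps)
    also have "\<dots> \<le> \<omega> (real n * t) + \<omega> t" using t by (intro sub) auto
    finally show ?case using Suc by (simp add: algebra_simps)
  qed
  have "variation_kernel K \<eta> C \<rho>"
  proof
    show "K x \<in> borel_measurable lebesgue" for x using meas[of x] by simp
    show "\<bar>K x y\<bar> \<le> C / dist x y ^ DIM('a)" if "x \<noteq> y" for x y
    proof -
      have "C0 / dist x y ^ DIM('a) \<le> C / dist x y ^ DIM('a)" using C by (intro divide_right_mono) auto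
      then show ?thesis using size[OF that] by linarith
    qed
    show "\<bar>K x y - K x' y\<bar> \<le> C * \<eta> (dist x x' / dist x y) / dist x y ^ DIM('a)"
      if "x \<noteq> y" "dist x x' \<le> dist x y / 2" for x x' y
      using smooth'[OF that] by linarith
    show "\<bar>K y x - K y x'\<bar> \<le> C * \<eta> (dist x x' / dist x y) / dist x y ^ DIM('a)"
      if "x \<noteq> y" "dist x x' \<le> dist x y / 2" for x x' y
      using smooth'[OF that] by linarith
    show "\<eta> s \<le> \<eta> t" if "s \<le> t" for s t unfolding \<eta>_def using that by (intro add_mono mono) auto
    show "0 \<le> \<eta> t" for t using nonneg[of "max 0 t"] by (simp add: \<eta>_def)
    show "t \<le> \<eta> t" for t using nonneg[of "max 0 t"] by (simp add: \<eta>_def)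
    show "\<eta> (real n * t) \<le> real n * \<eta> t" if "0 \<le> t" for t n
      using mult\<omega>[OF that, of n] that by (simp add: \<eta>_def max_def distrib_left)
    have "summable (\<lambda>k::nat. \<omega> (1 / 2 ^ k) + (1 / 2) ^ k)"
      by (intro summable_add dini_summable[OF \<omega>] summable_geometric) simp
    then show "summable (\<lambda>k::nat. \<eta> (1 / 2 ^ k))" by (simp add: \<eta>_def power_one_over max_def)
  qed (use C \<rho> in auto)
  then show ?thesis using that unfolding \<eta>_def[abs_def] by blast
qed

theorem mainTheorem1:
  fixes T :: "('a::euclidean_space \<Rightarrow> real) \<Rightarrow> ('a \<Rightarrow> real)"
    and K :: "'a \<Rightarrow> 'a \<Rightarrow> real" and \<omega> :: "real \<Rightarrow> real"
    and \<rho> q \<epsilon> :: real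
  assumes "CZO T K \<omega>"
    and "2 < \<rho>"
    and "1 < q"
    and "var_bounded_Lq K \<rho> q"
    and "0 < \<epsilon>" "\<epsilon> < 1"
  shows "\<exists>C>0. \<forall>c0 r0 f. 0 < r0 \<longrightarrow> memLinf f \<longrightarrow>
           (AE x in lebesgue. x \<notin> hcube c0 r0 \<longrightarrow> f x = 0) \<longrightarrow>
           (\<exists>F. F \<subseteq> dyadic_sub c0 r0 \<and> disjoint F \<and>
              (\<Sum>\<^sub>\<infinity>Q\<in>F. emeasure lebesgue Q) \<le> ennreal \<epsilon> * emeasure lebesgue (hcube c0 r0) \<and>
              (AE x in lebesgue. x \<in> hcube c0 r0 \<longrightarrow>
                 \<bar>var_op K \<rho> f x -
                   (\<Sum>Q\<in>{Q\<in>F. x \<in> Q}. var_op K \<rho> (\<lambda>y. f y * indicator (dilate 3 Q) y) x)\<bar>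
                 \<le> ereal (C * avg f (dilate 3 (hcube c0 r0)))) \<and>
              (\<forall>G. G \<subseteq> dyadic_sub c0 r0 \<longrightarrow> disjoint G \<longrightarrow> (\<forall>Q\<in>F. \<exists>R\<in>G. Q \<subseteq> R) \<longrightarrow>
                 (AE x in lebesgue. x \<in> hcube c0 r0 \<longrightarrow>
                   \<bar>var_op K \<rho> f x -
                     (\<Sum>Q\<in>{Q\<in>G. x \<in> Q}. var_op K \<rho> (\<lambda>y. f y * indicator (dilate 3 Q) y) x)\<bar>
                   \<le> ereal (C * avg f (dilate 3 (hcube c0 r0))))))"
proof -
  note czo = assms(1)[unfolded CZO_def]
  note \<omega> = czo[THEN conjunct1] and K = czo[THEN conjunct2, THEN conjunct1]
  obtain C1 where vk: "variation_kernel K (\<lambda>t. \<omega> (max 0 t) + max 0 t) C1 \<rho>"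
    using variation_kernel_CZ_kernel[OF \<omega> K] assms(2) by (metis less_imp_le)
  interpret variation_kernel K "\<lambda>t. \<omega> (max 0 t) + max 0 t" C1 \<rho> by (rule vk)
  obtain C0 where C0: "0 < C0" and fam:
    "\<And>c0 r0 f M m. \<lbrakk>0 < r0; f \<in> borel_measurable lebesgue; \<And>x. \<bar>f x\<bar> \<le> M; \<And>x. x \<notin> hcube c0 r0 \<Longrightarrow> f x = 0;
      0 < m; (\<integral>\<^sup>+x. ennreal \<bar>f x\<bar> \<partial>lebesgue) = ennreal m * emeasure lebesgue (hcube c0 r0)\<rbrakk> \<Longrightarrow>
      \<exists>F. F \<subseteq> dyadic_sub c0 r0 \<and> disjoint F \<and>
        emeasure lebesgue (\<Union>F) \<le> ennreal \<epsilon> * emeasure lebesgue (hcube c0 r0) \<and>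
        (\<forall>G. G \<subseteq> dyadic_sub c0 r0 \<longrightarrow> disjoint G \<longrightarrow> (\<forall>Q\<in>F. \<exists>R\<in>G. Q \<subseteq> R) \<longrightarrow>
          (AE x in lebesgue. x \<in> hcube c0 r0 \<longrightarrow>
            (\<forall>R\<in>G. x \<in> R \<longrightarrow> \<bar>V f x - V (\<lambda>y. f y * indicator (dilate 3 R) y) x\<bar> \<le> ereal (C0 * m)) \<and>
            (x \<notin> \<Union>G \<longrightarrow> V f x \<le> ereal (C0 * m))))"
    using exceptional_family[OF assms(3-6)] by blast
  \<comment> \<open>\<open>m\<close> is the mean of \<bar>f\<bar> over Q0, whereas the mean over 3Q0
    of a function supported in Q0 is m / 3^d.\<close>
  define C where "C = C0 * 3 ^ DIM('a)"
  have C: "0 < C" using C0 by (simp add: C_def)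
  \<comment> \<open>Condition (ii) is the instance G = F of the covering statement, so the latter is
    proved first.\<close>
  have main: "\<exists>F. F \<subseteq> dyadic_sub c0 r0 \<and> disjoint F \<and>
      (\<Sum>\<^sub>\<infinity>Q\<in>F. emeasure lebesgue Q) \<le> ennreal \<epsilon> * emeasure lebesgue (hcube c0 r0) \<and>
      (\<forall>G. G \<subseteq> dyadic_sub c0 r0 \<longrightarrow> disjoint G \<longrightarrow> (\<forall>Q\<in>F. \<exists>R\<in>G. Q \<subseteq> R) \<longrightarrow>
         (AE x in lebesgue. x \<in> hcube c0 r0 \<longrightarrow>
           \<bar>V f x - (\<Sum>Q\<in>{Q\<in>G. x \<in> Q}. V (\<lambda>y. f y * indicator (dilate 3 Q) y) x)\<bar>
           \<le> ereal (C * avg f (dilate 3 (hcube c0 r0)))))"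
    if r0: "0 < r0" and f: "memLinf f" and supp: "AE x in lebesgue. x \<notin> hcube c0 r0 \<longrightarrow> f x = 0"
    for c0 :: 'a and r0 f
  proof -
    let ?Q0 = "hcube c0 r0"
    have fm [measurable]: "f \<in> borel_measurable lebesgue" using f by (simp add: memLinf_def)
    obtain M0 where M0: "AE x in lebesgue. \<bar>f x\<bar> \<le> M0" using f by (auto simp: memLinf_def)
    define M where "M = max M0 0"
    \<comment> \<open>Turns the almost everywhere bound and support condition into pointwise ones;
      all variations and averages stay the same.\<close>
    define f' where "f' x = (if x \<in> ?Q0 \<and> \<bar>f x\<bar> \<le> M then f x else 0)" for x
    have f'm [measurable]: "f' \<in> borel_measurable lebesgue" unfolding f'_def[abs_def] by measurable
    have ae: "AE x in lebesgue. f x = f' x"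
      using supp M0 by eventually_elim (auto simp: f'_def M_def)
    have f'M: "\<bar>f' x\<bar> \<le> M" for x by (simp add: f'_def M_def)
    have f's: "f' x = 0" if "x \<notin> ?Q0" for x using that by (simp add: f'_def)
    have f'i: "integrable lebesgue f'"
      by (rule bounded_support_integrable[OF f'm f'M f's hcube_lmeasurable[OF r0]])
    have Vf: "V f x = V f' x" for x by (rule var_op_cong_AE[OF ae fm f'm K_measurable])
    have Tm: "dilate 3 R \<in> sets lebesgue" if R: "R \<in> dyadic_sub c0 r0" for R
    proof -
      obtain c r where "0 < r" "R = hcube c r" using dyadic_subE[OF r0 R] by metis
      then show ?thesis using dilate_hcube[of r 3 c] hcube_lebesgue[of c "3 * r"] by simp
    qed
    have Vf3: "V (\<lambda>y. f y * indicator (dilate 3 R) y) x = V (\<lambda>y. f' y * indicator (dilate 3 R) y) x"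
      if R: "R \<in> dyadic_sub c0 r0" for R x
    proof (rule var_op_cong_AE)
      note [measurable] = Tm[OF R]
      show "AE y in lebesgue. f y * indicator (dilate 3 R) y = f' y * indicator (dilate 3 R) y"
        using ae by eventually_elim simp
      show "(\<lambda>y. f y * indicator (dilate 3 R) y) \<in> borel_measurable lebesgue"
        "(\<lambda>y. f' y * indicator (dilate 3 R) y) \<in> borel_measurable lebesgue"
        by measurable
    qed (rule K_measurable)
    define q0 where "q0 = (2 * r0) ^ DIM('a)"
    have q0: "0 < q0" "emeasure lebesgue ?Q0 = ennreal q0"
      using r0 emeasure_hcube[of r0 c0] by (auto simp: q0_def simp del: emeasure_completion)
    define m where "m = (\<integral>x. \<bar>f' x\<bar> \<partial>lebesgue) / q0"
    have m0: "0 \<le> m" unfolding m_def using q0 by (intro divide_nonneg_pos Bochner_Integration.integral_nonneg) auto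
    have mass: "(\<integral>\<^sup>+x. ennreal \<bar>f' x\<bar> \<partial>lebesgue) = ennreal m * emeasure lebesgue ?Q0"
    proof -
      have "(\<integral>\<^sup>+x. ennreal \<bar>f' x\<bar> \<partial>lebesgue) = ennreal (\<integral>x. \<bar>f' x\<bar> \<partial>lebesgue)"
        using f'i by (intro nn_integral_eq_integral) auto
      also have "(\<integral>x. \<bar>f' x\<bar> \<partial>lebesgue) = m * q0" using q0 by (simp add: m_def)
      also have "ennreal (m * q0) = ennreal m * emeasure lebesgue ?Q0" unfolding q0(2) using m0 by (rule ennreal_mult')
      finally show ?thesis .
    qed
    have avg: "C0 * m = C * avg f (dilate 3 ?Q0)"
    proof -
      have d3: "dilate 3 ?Q0 = hcube c0 (3 * r0)" by (rule dilate_hcube[OF r0])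
      have "measure lebesgue (hcube c0 (3 * r0)) = (2 * (3 * r0)) ^ DIM('a)"
        using r0 emeasure_hcube[of "3 * r0" c0] by (simp add: measure_def del: emeasure_completion)
      also have "2 * (3 * r0) = 3 * (2 * r0)" by simp
      also have "(3 * (2 * r0)) ^ DIM('a) = 3 ^ DIM('a) * q0" unfolding q0_def by (rule power_mult_distrib)
      finally have m3: "measure lebesgue (hcube c0 (3 * r0)) = 3 ^ DIM('a) * q0" .
      have "(LINT y:hcube c0 (3 * r0)|lebesgue. \<bar>f y\<bar>) = (\<integral>x. \<bar>f' x\<bar> \<partial>lebesgue)"
        unfolding set_lebesgue_integral_def
      proof (rule integral_cong_AE)
        note [measurable] = hcube_lebesgue
        show "(\<lambda>x. indicat_real (hcube c0 (3 * r0)) x *\<^sub>R \<bar>f x\<bar>) \<in> borel_measurable lebesgue" by measurable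
        show "(\<lambda>x. \<bar>f' x\<bar>) \<in> borel_measurable lebesgue" by measurable
        show "AE x in lebesgue. indicat_real (hcube c0 (3 * r0)) x *\<^sub>R \<bar>f x\<bar> = \<bar>f' x\<bar>"
          using ae
        proof eventually_elim
          case (elim x)
          have "?Q0 \<subseteq> hcube c0 (3 * r0)" using r0 by (intro hcube_subset) simp
          then show ?case using elim f's[of x] by (auto simp: indicator_def)
        qed
      qed
      then have "avg f (dilate 3 ?Q0) = (\<integral>x. \<bar>f' x\<bar> \<partial>lebesgue) / (3 ^ DIM('a) * q0)"
        unfolding avg_def d3 m3 by simp
      then show ?thesis using q0 by (simp add: C_def m_def)
    qed
    show ?thesis
    proof (cases "m = 0")
      \<comment> \<open>The stopping height would degenerate to 0. Here \<open>f\<close> vanishes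
        almost everywhere, every variation is 0, and the empty family works.\<close>
      case True
      have "AE x in lebesgue. f' x = 0"
      proof -
        have "(\<integral>\<^sup>+x. ennreal \<bar>f' x\<bar> \<partial>lebesgue) = 0" using mass True by simp
        then have "AE x in lebesgue. ennreal \<bar>f' x\<bar> = 0"
          by (subst (asm) nn_integral_0_iff_AE) measurable
        then show ?thesis by eventually_elim simp
      qed
      then have f0: "AE x in lebesgue. f x = 0" using ae by eventually_elim simp
      have V0: "V f x = 0" for x
        using var_op_cong_AE[OF f0 fm _ K_measurable] var_op_zero[of K \<rho> x] by simp
      have V30: "V (\<lambda>y. f y * indicator (dilate 3 R) y) x = 0" if R: "R \<in> dyadic_sub c0 r0" for R x
      proof -
        note [measurable] = Tm[OF R]
        have "V (\<lambda>y. f y * indicator (dilate 3 R) y) x = V (\<lambda>_. 0) x"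
        proof (rule var_op_cong_AE)
          show "AE y in lebesgue. f y * indicator (dilate 3 R) y = 0" using f0 by eventually_elim simp
          show "(\<lambda>y. f y * indicator (dilate 3 R) y) \<in> borel_measurable lebesgue" by measurable
        qed (simp_all add: K_measurable)
        then show ?thesis using var_op_zero[of K \<rho> x] by simp
      qed
      have z: "C * avg f (dilate 3 ?Q0) = 0" using avg True by simp
      have sum0: "(\<Sum>Q\<in>{Q\<in>G. x \<in> Q}. V (\<lambda>y. f y * indicator (dilate 3 Q) y) x) = 0"
        if "G \<subseteq> dyadic_sub c0 r0" for G x
        using that by (intro sum.neutral) (auto intro!: V30)
      show ?thesis unfolding z
        by (intro exI[of _ "{}"]) (auto simp: V0 sum0 zero_ereal_def[symmetric])
    next
      case False
      then have mpos: "0 < m" using m0 by simp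
      obtain F where FD: "F \<subseteq> dyadic_sub c0 r0" and Fd: "disjoint F"
        and Fle: "emeasure lebesgue (\<Union>F) \<le> ennreal \<epsilon> * emeasure lebesgue ?Q0"
        and FG: "\<And>G. G \<subseteq> dyadic_sub c0 r0 \<Longrightarrow> disjoint G \<Longrightarrow> (\<forall>Q\<in>F. \<exists>R\<in>G. Q \<subseteq> R) \<Longrightarrow>
          (AE x in lebesgue. x \<in> ?Q0 \<longrightarrow>
            (\<forall>R\<in>G. x \<in> R \<longrightarrow> \<bar>V f' x - V (\<lambda>y. f' y * indicator (dilate 3 R) y) x\<bar> \<le> ereal (C0 * m)) \<and>
            (x \<notin> \<Union>G \<longrightarrow> V f' x \<le> ereal (C0 * m)))"
        using fam[OF r0 f'm f'M f's mpos mass] by blast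
      have Fs: "F \<subseteq> sets lebesgue" by (rule subsetI) (rule dyadic_sub_lebesgue[OF subsetD[OF FD]])
      have UF: "\<Union>F \<in> sets lebesgue"
        by (rule sets.countable_Union[OF countable_subset[OF FD countable_dyadic_sub] Fs])
      have "(\<Sum>\<^sub>\<infinity>Q\<in>F. emeasure lebesgue Q) \<le> ennreal \<epsilon> * emeasure lebesgue ?Q0"
        by (rule order_trans[OF infsum_emeasure_le[OF Fs Fd UF] Fle])
      moreover have "AE x in lebesgue. x \<in> ?Q0 \<longrightarrow>
           \<bar>V f x - (\<Sum>Q\<in>{Q\<in>G. x \<in> Q}. V (\<lambda>y. f y * indicator (dilate 3 Q) y) x)\<bar>
           \<le> ereal (C * avg f (dilate 3 ?Q0))"
        if GD: "G \<subseteq> dyadic_sub c0 r0" and Gd: "disjoint G" and cov: "\<forall>Q\<in>F. \<exists>R\<in>G. Q \<subseteq> R" for G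
        using FG[OF that]
      proof eventually_elim
        case (elim x)
        show ?case
        proof
          assume x: "x \<in> ?Q0"
          show "\<bar>V f x - (\<Sum>Q\<in>{Q\<in>G. x \<in> Q}. V (\<lambda>y. f y * indicator (dilate 3 Q) y) x)\<bar> \<le> ereal (C * avg f (dilate 3 ?Q0))"
          proof (cases "x \<in> \<Union>G")
            case True
            then obtain R where R: "R \<in> G" "x \<in> R" by blast
            then have eq: "{Q\<in>G. x \<in> Q} = {R}" using Gd by (auto simp: disjoint_def)
            have "(\<Sum>Q\<in>{Q\<in>G. x \<in> Q}. V (\<lambda>y. f y * indicator (dilate 3 Q) y) x) = V (\<lambda>y. f' y * indicator (dilate 3 R) y) x"
              unfolding eq using Vf3[of R x] R(1) GD by auto
            then show ?thesis using elim x R unfolding Vf avg[symmetric] by simp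
          next
            case False
            then have eq: "{Q\<in>G. x \<in> Q} = {}" by blast
            have "V f' x \<le> ereal (C0 * m)" using elim x False by blast
            then show ?thesis unfolding eq Vf avg[symmetric] using var_op_nonneg[of K \<rho> f' x] by simp
          qed
        qed
      qed
      ultimately show ?thesis using FD Fd by blast
    qed
  qed
  show ?thesis
  proof (intro exI[of _ C] conjI C allI impI)
    fix c0 :: 'a and r0 f
    assume "0 < r0" "memLinf f" "AE x in lebesgue. x \<notin> hcube c0 r0 \<longrightarrow> f x = 0"
    from main[OF this] obtain F where F: "F \<subseteq> dyadic_sub c0 r0" "disjoint F"
      "(\<Sum>\<^sub>\<infinity>Q\<in>F. emeasure lebesgue Q) \<le> ennreal \<epsilon> * emeasure lebesgue (hcube c0 r0)"
      and G: "\<And>G. G \<subseteq> dyadic_sub c0 r0 \<Longrightarrow> disjoint G \<Longrightarrow> (\<forall>Q\<in>F. \<exists>R\<in>G. Q \<subseteq> R) \<Longrightarrow>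
         (AE x in lebesgue. x \<in> hcube c0 r0 \<longrightarrow>
           \<bar>V f x - (\<Sum>Q\<in>{Q\<in>G. x \<in> Q}. V (\<lambda>y. f y * indicator (dilate 3 Q) y) x)\<bar>
           \<le> ereal (C * avg f (dilate 3 (hcube c0 r0))))"
      by blast
    show "\<exists>F. F \<subseteq> dyadic_sub c0 r0 \<and> disjoint F \<and>
              (\<Sum>\<^sub>\<infinity>Q\<in>F. emeasure lebesgue Q) \<le> ennreal \<epsilon> * emeasure lebesgue (hcube c0 r0) \<and>
              (AE x in lebesgue. x \<in> hcube c0 r0 \<longrightarrow>
                 \<bar>V f x - (\<Sum>Q\<in>{Q\<in>F. x \<in> Q}. V (\<lambda>y. f y * indicator (dilate 3 Q) y) x)\<bar>
                 \<le> ereal (C * avg f (dilate 3 (hcube c0 r0)))) \<and>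
              (\<forall>G. G \<subseteq> dyadic_sub c0 r0 \<longrightarrow> disjoint G \<longrightarrow> (\<forall>Q\<in>F. \<exists>R\<in>G. Q \<subseteq> R) \<longrightarrow>
                 (AE x in lebesgue. x \<in> hcube c0 r0 \<longrightarrow>
                   \<bar>V f x - (\<Sum>Q\<in>{Q\<in>G. x \<in> Q}. V (\<lambda>y. f y * indicator (dilate 3 Q) y) x)\<bar>
                   \<le> ereal (C * avg f (dilate 3 (hcube c0 r0)))))"
    proof (intro exI[of _ F] conjI F allI impI)
      show "AE x in lebesgue. x \<in> hcube c0 r0 \<longrightarrow>
                 \<bar>V f x - (\<Sum>Q\<in>{Q\<in>F. x \<in> Q}. V (\<lambda>y. f y * indicator (dilate 3 Q) y) x)\<bar>
                 \<le> ereal (C * avg f (dilate 3 (hcube c0 r0)))"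
        by (rule G[OF F(1,2)]) blast
    qed (rule G)
  qed
qed

end
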